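(* Let $\llbracket n(l),k(l)\rrbracket$, $l=1,2,3,\dots$, be a family of stabilizer codes on $m$-dimensional qudits, each equipped with a qudit partition, and let $d_\downarrow(l)$, $d_\uparrow(l)$ and $\Delta(l)$ be the corresponding min-distance, max-distance and disjointness. If there exists a positive integer $M$ satisfying $$\lim_{l\to\infty}\frac{d_\uparrow(l)}{d_\downarrow(l)\,\Delta(l)^{M-1}}=0,$$ then for any constants (positive integers independent of $l$) $q$ and $h$, all $q$-local logical gates of depth $h$ that the code family has are in the $M$-th level $\overline C_M$ of the Clifford hierarchy of the logical Pauli group.
   Context: Fix a qudit dimension $m\ge2$, $\omega_m=e^{2\pi i/m}$, $X=\sum_{l}|l\oplus1\rangle\langle l|$ (addition mod $m$), $Z=\sum_l\omega_m^l|l\rangle\langle l|$. $\mathcal P_n$ is the group generated by the single-qudit $X$'s and $Z$'s on $n$ qudits (for $m=2$ one may also include $Y=iXZ$ among the generators). The group commutator is $[A,B]=ABA^\dagger B^\dagger$. Stabilizer code: an $\llbracket n,k\rrbracket$ code ($k\ge1$) is given by a group $\mathcal S=\langle s_1,\dots,s_{n-k}\rangle\subseteq\mathcal P_n$ of mutually commuting Paulis with $|\mathcal S|=m^{n-k}$; its code space $\mathcal C\subseteq(\mathbb C^m)^{\otimes n}$ is the simultaneous $+1$ eigenspace of $\mathcal S$, of dimension $m^k$. A logical operator is a unitary on $(\mathbb C^m)^{\otimes n}$ mapping $\mathcal C$ to $\mathcal C$. Logical Pauli generators $\bar X_i,\bar Z_i\in\mathcal P_n$ ($1\le i\le k$)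 commute with $\mathcal S$ and satisfy $[\bar X_i,\bar Z_j]=\omega_m^{-\delta_{ij}}I$, $[\bar X_i,\bar X_j]=[\bar Z_i,\bar Z_j]=I$. The set of non-trivial logical Paulis is the set of cosets $\mathcal L=\{\mathcal S\prod_{i=1}^k\bar X_i^{a_i}\bar Z_i^{a_{i+k}}:a\in\{0,\dots,m-1\}^{2k}\setminus\{0\}\}$. Let $[n]=Q_1\cup\dots\cup Q_N$ be a partition of the qudits into disjoint non-empty subsets. A unitary is transversal with respect to a partition if it is a tensor product of unitaries each acting only on one subset of the partition. $\mathrm{supp}(U)\subseteq[N]$ is the set of $i$ such that $U$ acts non-trivially (not as a scalar multiple of the identity) on $Q_i$. A unitary is $q$-local of depth one if it is transversal with respect to some coarse-grained partition $\{R_j\}$ in which each $R_j$ is a union of at most $q$ of the $Q_i$. A $q$-local unitary (circuit) of depth $h$ is a product of $h$ $q$-local unitaries of depth one. Distances: $d(G)=\min_{g\in G}|\mathrm{supp}(g)|$, $d_\downarrow=\min_{G\in\mathcal L}d(G)$, $d_\uparrow=\max_{G\in\mathcal L}d(G)$. Disjointness: for an integer $c\ge1$, $A\subseteq G$ is $c$-disjoint if for every $i\in[N]$ at most $c$ elements $a\in A$ have $i\in\mathrm{supp}(a)$; $\Delta_c(G)=\frac1c\max\{|A|:A\subseteq G\ c\text{-disjoint}\}$ and $\Delta=\max_{c\ge1}\min_{G\in\mathcal L}\Delta_c(G)$. Clifford hierarchy: for a Pauli group $\mathcal P$, $C_1(\mathcal P)=\mathcal P$ and $C_M(\mathcal P)=\{U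 \text{ unitary}:[U,p]\in C_{M-1}(\mathcal P)\ \forall p\in\mathcal P\}$, where unitaries are considered up to global phase. A logical operator is in $\overline C_M$ if the $k$-qudit unitary it induces on $\mathcal C$ (identified with $(\mathbb C^m)^{\otimes k}$ via $\bar X_i,\bar Z_i$) lies in $C_M(\mathcal P_k)$ up to global phase. Gates of a family: the code family has a $q$-local logical gate of depth $h$ if there is a constant $l_0$ such that for all $l\ge l_0$ the logical gate can be implemented in the $l$-th code by some $q$-local circuit of depth $h$. Here a logical gate of the family is specified by a unitary $V_l$ on the $k(l)$ logical qudits for each $l$ (for instance, one fixed unitary on a fixed number of logical qudits, tensored with the identity), and it is said to be in $\overline C_M$ if $V_l\in C_M(\mathcal P_{k(l)})$ (up to global phase) for all sufficiently large $l$. *)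

theory Defs
  imports
    "Jordan_Normal_Form.Schur_Decomposition"
    "Jordan_Normal_Form.VS_Connect"
    "HOL-Algebra.Generated_Groups"
    "HOL-Algebra.Coset"
    "HOL-Library.Disjoint_Sets"
    Complex_Main
begin

section \<open>Operators on qudits\<close>

text \<open>Operators on \<open>n\<close> qudits of dimension \<open>m\<close> are complex matrices of size \<open>m ^ n\<close>. The qudits are
  numbered \<open>0, \<dots>, n - 1\<close>, and the basis vector with index \<open>x < m ^ n\<close> is the product state in which
  qudit \<open>j\<close> is in the state given by the \<open>j\<close>-th base-\<open>m\<close> digit of \<open>x\<close>.\<close>

definition digit :: "nat \<Rightarrow> nat \<Rightarrow> nat \<Rightarrow> nat" where
  "digit m x j = (x div m ^ j) mod m"

definition unitary_mat :: "nat \<Rightarrow> complex mat \<Rightarrow> bool" where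
  "unitary_mat d U \<longleftrightarrow>
     U \<in> carrier_mat d d \<and> mat_adjoint U * U = 1\<^sub>m d \<and> U * mat_adjoint U = 1\<^sub>m d"

definition unitary_group :: "nat \<Rightarrow> complex mat monoid" where
  "unitary_group d = \<lparr>carrier = {U. unitary_mat d U}, monoid.mult = (*), one = 1\<^sub>m d\<rparr>"

definition commutator :: "complex mat \<Rightarrow> complex mat \<Rightarrow> complex mat" where
  "commutator A B = A * B * mat_adjoint A * mat_adjoint B"

definition mat_prod_list :: "nat \<Rightarrow> complex mat list \<Rightarrow> complex mat" where
  "mat_prod_list d As = foldr (*) As (1\<^sub>m d)"

text \<open>\<open>U\<close> acts only on the qudits in \<open>R\<close>, that is, \<open>U = A \<otimes> I\<close> with \<open>A\<close> an operator on the qudits in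
  \<open>R\<close>. The entries of \<open>A\<close> are indexed by the assignments of a digit to every qudit in \<open>R\<close>.\<close>

definition acts_only_on :: "nat \<Rightarrow> nat \<Rightarrow> nat set \<Rightarrow> complex mat \<Rightarrow> bool" where
  "acts_only_on m n R U \<longleftrightarrow>
     U \<in> carrier_mat (m ^ n) (m ^ n) \<and>
     (\<exists>A :: (nat \<Rightarrow> nat) \<Rightarrow> (nat \<Rightarrow> nat) \<Rightarrow> complex. \<forall>x < m ^ n. \<forall>y < m ^ n.
        U $$ (x, y) =
          (if \<forall>j \<in> {..<n} - R. digit m x j = digit m y j
           then A (restrict (digit m x) R) (restrict (digit m y) R) else 0))"

section \<open>Pauli group and Clifford hierarchy\<close>

definition omega :: "nat \<Rightarrow> complex" where
  "omega m = cis (2 * pi / real m)"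

definition pauli_X :: "nat \<Rightarrow> nat \<Rightarrow> nat \<Rightarrow> complex mat" where
  "pauli_X m n j = mat (m ^ n) (m ^ n) (\<lambda>(x, y).
     if \<forall>i<n. digit m x i = (if i = j then (digit m y i + 1) mod m else digit m y i) then 1 else 0)"

definition pauli_Z :: "nat \<Rightarrow> nat \<Rightarrow> nat \<Rightarrow> complex mat" where
  "pauli_Z m n j = mat (m ^ n) (m ^ n) (\<lambda>(x, y). if x = y then omega m ^ digit m x j else 0)"

text \<open>For qubits \<open>Y = iXZ\<close> is included among the generators. This is the more permissive convention:
  every stabilizer code over the group generated by \<open>X\<close> and \<open>Z\<close> alone is also one over this group,
  with the same logical cosets, and the Clifford hierarchy, being taken up to phase, is unaffected.\<close>

definition pauli_group :: "nat \<Rightarrow> nat \<Rightarrow> complex mat set" where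
  "pauli_group m n = generate (unitary_group (m ^ n))
     (pauli_X m n ` {..<n} \<union> pauli_Z m n ` {..<n} \<union>
      (if m = 2 then (\<lambda>j. \<i> \<cdot>\<^sub>m (pauli_X m n j * pauli_Z m n j)) ` {..<n} else {}))"

text \<open>Levels start at 1; level 0 is a dummy. Closure under global phases at level 1 passes to all
  higher levels, since the commutator does not see the phase of its arguments.\<close>

fun clifford_hierarchy :: "nat \<Rightarrow> nat \<Rightarrow> nat \<Rightarrow> complex mat set" where
  "clifford_hierarchy m k 0 = {}"
| "clifford_hierarchy m k (Suc 0) = {c \<cdot>\<^sub>m p | c p. cmod c = 1 \<and> p \<in> pauli_group m k}"
| "clifford_hierarchy m k (Suc (Suc M)) =
     {U. unitary_mat (m ^ k) U \<and>
         (\<forall>p \<in> pauli_group m k. commutator U p \<in> clifford_hierarchy m k (Suc M))}"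

section \<open>Stabilizer codes with a qudit partition\<close>

record qudit_code =
  num_qudits :: nat
  num_logical :: nat
  stab_gens :: "complex mat list"
  logical_X :: "nat \<Rightarrow> complex mat"
  logical_Z :: "nat \<Rightarrow> complex mat"
  parts :: "nat set set"

definition stabilizer :: "nat \<Rightarrow> qudit_code \<Rightarrow> complex mat set" where
  "stabilizer m C = generate (unitary_group (m ^ num_qudits C)) (set (stab_gens C))"

definition code_space :: "nat \<Rightarrow> qudit_code \<Rightarrow> complex vec set" where
  "code_space m C = {v \<in> carrier_vec (m ^ num_qudits C). \<forall>s \<in> stabilizer m C. s *\<^sub>v v = v}"

definition stabilizer_code :: "nat \<Rightarrow> qudit_code \<Rightarrow> bool" where
  "stabilizer_code m C \<longleftrightarrow>
     (let n = num_qudits C; k = num_logical C; S = stabilizer m C;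
          X = logical_X C; Z = logical_Z C in
      1 \<le> k \<and> k \<le> n \<and>
      partition_on {..<n} (parts C) \<and>
      length (stab_gens C) = n - k \<and>
      set (stab_gens C) \<subseteq> pauli_group m n \<and>
      (\<forall>s \<in> S. \<forall>t \<in> S. s * t = t * s) \<and>
      card S = m ^ (n - k) \<and>
      vectorspace.dim class_ring
        ((module_vec TYPE(complex) (m ^ n))\<lparr>carrier := code_space m C\<rparr>) = m ^ k \<and>
      (\<forall>i<k. X i \<in> pauli_group m n \<and> Z i \<in> pauli_group m n \<and>
         (\<forall>s \<in> S. X i * s = s * X i \<and> Z i * s = s * Z i)) \<and>
      (\<forall>i<k. \<forall>j<k.
         commutator (X i) (Z j) = (if i = j then inverse (omega m) else 1) \<cdot>\<^sub>m 1\<^sub>m (m ^ n) \<and>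
         commutator (X i) (X j) = 1\<^sub>m (m ^ n) \<and>
         commutator (Z i) (Z j) = 1\<^sub>m (m ^ n)))"

definition logical_pauli :: "nat \<Rightarrow> qudit_code \<Rightarrow> (nat \<Rightarrow> nat) \<Rightarrow> complex mat" where
  "logical_pauli m C a = mat_prod_list (m ^ num_qudits C)
     (map (\<lambda>i. (logical_X C i ^\<^sub>m a i) * (logical_Z C i ^\<^sub>m a (i + num_logical C)))
          [0..<num_logical C])"

definition nontrivial_logical_paulis :: "nat \<Rightarrow> qudit_code \<Rightarrow> complex mat set set" where
  "nontrivial_logical_paulis m C =
     {stabilizer m C #>\<^bsub>unitary_group (m ^ num_qudits C)\<^esub> logical_pauli m C a | a.
        a \<in> {..<2 * num_logical C} \<rightarrow>\<^sub>E {..<m} \<and> (\<exists>i < 2 * num_logical C. a i \<noteq> 0)}"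

section \<open>Distances and disjointness\<close>

text \<open>The support is the set of parts themselves rather than of their indices. An operator acts on
  \<open>B\<close> as a scalar multiple of the identity iff it acts only on the qudits outside \<open>B\<close>.\<close>

definition supp :: "nat \<Rightarrow> qudit_code \<Rightarrow> complex mat \<Rightarrow> nat set set" where
  "supp m C U = {B \<in> parts C. \<not> acts_only_on m (num_qudits C) ({..<num_qudits C} - B) U}"

definition coset_dist :: "nat \<Rightarrow> qudit_code \<Rightarrow> complex mat set \<Rightarrow> nat" where
  "coset_dist m C G = Min ((\<lambda>g. card (supp m C g)) ` G)"

definition min_distance :: "nat \<Rightarrow> qudit_code \<Rightarrow> nat" where
  "min_distance m C = Min (coset_dist m C ` nontrivial_logical_paulis m C)"

definition max_distance :: "nat \<Rightarrow> qudit_code \<Rightarrow> nat" where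
  "max_distance m C = Max (coset_dist m C ` nontrivial_logical_paulis m C)"

definition c_disjoint :: "nat \<Rightarrow> qudit_code \<Rightarrow> nat \<Rightarrow> complex mat set \<Rightarrow> bool" where
  "c_disjoint m C c A \<longleftrightarrow> (\<forall>B \<in> parts C. card {a \<in> A. B \<in> supp m C a} \<le> c)"

definition coset_disjointness :: "nat \<Rightarrow> qudit_code \<Rightarrow> nat \<Rightarrow> complex mat set \<Rightarrow> real" where
  "coset_disjointness m C c G = real (Max (card ` {A. A \<subseteq> G \<and> c_disjoint m C c A})) / real c"

text \<open>The supremum over \<open>c\<close> is a maximum: the minimum is at most \<open>m ^ (n - k) / c\<close>, which tends to 0,
  and it is positive at \<open>c = 1\<close>.\<close>

definition disjointness :: "nat \<Rightarrow> qudit_code \<Rightarrow> real" where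
  "disjointness m C =
     (SUP c \<in> {1..}. Min (coset_disjointness m C c ` nontrivial_logical_paulis m C))"

section \<open>Local circuits and logical gates\<close>

text \<open>Operators acting only on disjoint sets of qudits commute, and their product (in any order) is
  the tensor product of the operators they induce on these sets.\<close>

definition transversal :: "nat \<Rightarrow> nat \<Rightarrow> nat set set \<Rightarrow> complex mat \<Rightarrow> bool" where
  "transversal m n P U \<longleftrightarrow>
     (\<exists>Bs F. distinct Bs \<and> set Bs = P \<and>
        (\<forall>B \<in> P. unitary_mat (m ^ n) (F B) \<and> acts_only_on m n B (F B)) \<and>
        U = mat_prod_list (m ^ n) (map F Bs))"

definition local_depth_one :: "nat \<Rightarrow> qudit_code \<Rightarrow> nat \<Rightarrow> complex mat \<Rightarrow> bool" where
  "local_depth_one m C q U \<longleftrightarrow>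
     (\<exists>R. partition_on {..<num_qudits C} R \<and>
        (\<forall>B \<in> R. \<exists>T \<subseteq> parts C. card T \<le> q \<and> B = \<Union>T) \<and>
        transversal m (num_qudits C) R U)"

definition local_circuit :: "nat \<Rightarrow> qudit_code \<Rightarrow> nat \<Rightarrow> nat \<Rightarrow> complex mat \<Rightarrow> bool" where
  "local_circuit m C q h U \<longleftrightarrow>
     (\<exists>Us. length Us = h \<and> (\<forall>W \<in> set Us. local_depth_one m C q W) \<and>
        U = mat_prod_list (m ^ num_qudits C) Us)"

definition logical_operator :: "nat \<Rightarrow> qudit_code \<Rightarrow> complex mat \<Rightarrow> bool" where
  "logical_operator m C U \<longleftrightarrow>
     unitary_mat (m ^ num_qudits C) U \<and> (\<forall>v \<in> code_space m C. U *\<^sub>v v \<in> code_space m C)"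

text \<open>An identification of \<open>k\<close> logical qudits with the code space: an isometry onto the code space
  carrying \<open>X\<^sub>i\<close>, \<open>Z\<^sub>i\<close> to the logical \<open>X\<^sub>i\<close>, \<open>Z\<^sub>i\<close>. Phases must be allowed here: the commutation
  relations do not force \<open>m\<close>-th powers of logical Paulis to be the identity (for even \<open>m\<close>, a logical
  \<open>X\<close> of the form \<open>XZ\<close> has \<open>m\<close>-th power \<open>-I\<close>). The remaining freedom is a logical Pauli and a global
  phase, and the Clifford hierarchy is invariant under conjugation by Paulis.\<close>

definition encoding :: "nat \<Rightarrow> qudit_code \<Rightarrow> complex mat \<Rightarrow> bool" where
  "encoding m C E \<longleftrightarrow>
     (let n = num_qudits C; k = num_logical C in
      E \<in> carrier_mat (m ^ n) (m ^ k) \<and>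
      mat_adjoint E * E = 1\<^sub>m (m ^ k) \<and>
      (\<lambda>v. E *\<^sub>v v) ` carrier_vec (m ^ k) = code_space m C \<and>
      (\<forall>i<k. (\<exists>c. cmod c = 1 \<and> logical_X C i * E = c \<cdot>\<^sub>m (E * pauli_X m k i)) \<and>
             (\<exists>c. cmod c = 1 \<and> logical_Z C i * E = c \<cdot>\<^sub>m (E * pauli_Z m k i))))"

definition implements :: "nat \<Rightarrow> qudit_code \<Rightarrow> complex mat \<Rightarrow> complex mat \<Rightarrow> bool" where
  "implements m C U V \<longleftrightarrow>
     logical_operator m C U \<and>
     (\<exists>E c. encoding m C E \<and> cmod c = 1 \<and> U * E = c \<cdot>\<^sub>m (E * V))"

definition has_local_gate ::
    "nat \<Rightarrow> (nat \<Rightarrow> qudit_code) \<Rightarrow> nat \<Rightarrow> nat \<Rightarrow> (nat \<Rightarrow> complex mat) \<Rightarrow> bool" where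
  "has_local_gate m C q h V \<longleftrightarrow>
     (\<exists>l0. \<forall>l\<ge>l0. \<exists>U. local_circuit m (C l) q h U \<and> implements m (C l) U (V l))"

definition gate_in_level ::
    "nat \<Rightarrow> (nat \<Rightarrow> qudit_code) \<Rightarrow> nat \<Rightarrow> (nat \<Rightarrow> complex mat) \<Rightarrow> bool" where
  "gate_in_level m C M V \<longleftrightarrow>
     (\<exists>l1. \<forall>l\<ge>l1. V l \<in> clifford_hierarchy m (num_logical (C l)) M)"

end

theory Submission
  imports Defs
begin

text \<open>Let \<open>U\<close> be a circuit implementing \<open>V\<close>. Conjugation by a circuit of locality \<open>q\<close> and depth \<open>h\<close>
  enlarges supports by a factor of at most \<open>s = q\<^sup>h\<close>. For a logical Pauli \<open>p\<^sub>1\<close> choose a lightest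
  representative \<open>g\<^sub>1\<close>; then \<open>W\<^sub>1 = [U, g\<^sub>1]\<close> has support at most \<open>s d\<^sub>\<up>\<close>. For the next logical Pauli
  there is a representative \<open>g\<^sub>2\<close> meeting this support in at most a fraction \<open>1 / \<Delta>\<close> of its parts, by
  averaging over a \<open>c\<close>-disjoint set, and as \<open>W\<^sub>1\<close> is itself a product of such circuits and Paulis with
  spreading factor \<open>s\<^sup>2\<close>, the support of \<open>[W\<^sub>1, g\<^sub>2]\<close> is at most \<open>s\<^sup>2 (s d\<^sub>\<up>) / \<Delta>\<close>. After \<open>M\<close> steps the
  support is at most a constant times \<open>d\<^sub>\<up> / \<Delta>\<^bsup>M-1\<^esup>\<close>, which is eventually below \<open>d\<^sub>\<down>\<close>, so that the nested
  commutator acts on the code space as a scalar. Hence all \<open>M\<close>-fold commutators of \<open>V\<close> with Paulis are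
  scalars, and a unitary commuting with every Pauli up to a scalar is itself a Pauli up to phase.\<close>

section \<open>Matrices\<close>

text \<open>All Paulis are handled as \<open>weyl m n a b\<close> with natural-number exponents read
  modulo \<open>m\<close>. Phases are never normalised, since the encoding fixes logical Paulis only
  up to phase and the Clifford hierarchy does not see them. Two properties of these operators carry
  the argument. They detect locality: an operator acts only on \<open>R\<close> exactly when it
  commutes with every Weyl operator off \<open>R\<close>. And they are complete for the trace
  pairing, which gives both the cleaning lemma and the fact that commuting with Paulis up to scalars
  characterises Paulis.

  The first commutator is special: \<open>U\<close> acts on all parts, so disjointness gains nothing
  there, and \<open>M\<close> commutators yield only the power \<open>M - 1\<close>. Every
  commutator contains both \<open>W\<close> and its adjoint, so the spreading factor squares each
  time and the total constant is \<open>s ^ (2 ^ M - 1)\<close>, which depends on \<open>q\<close>,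
  \<open>h\<close> and \<open>M\<close> but not on \<open>l\<close>. Since nested commutators are
  not circuits of the original shape, spreading is tracked as a property of arbitrary unitaries that
  survives products and adjoints.\<close>

lemma mat_adjoint_carrier [simp, intro]:
  "A \<in> carrier_mat r c \<Longrightarrow> mat_adjoint A \<in> carrier_mat c r"
  unfolding mat_adjoint_def by (metis carrier_matD cols_length length_map mat_of_rows_carrier(1))

lemma mat_adjoint_index:
  "i < dim_col A \<Longrightarrow> j < dim_row A \<Longrightarrow> mat_adjoint A $$ (i, j) = cnj (A $$ (j, i))"
  unfolding mat_adjoint_def by (simp add: mat_of_rows_index conjugate_complex_def)

lemma mat_adjoint_dim [simp]:
  "dim_row (mat_adjoint A) = dim_col A" "dim_col (mat_adjoint A) = dim_row A"
  using carrier_matD[OF mat_adjoint_carrier[OF carrier_matI[OF refl refl], of A]] by auto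

lemma mult_mat_index_sum:
  fixes A :: "complex mat"
  shows "i < dim_row A \<Longrightarrow> j < dim_col B \<Longrightarrow> dim_col A = dim_row B \<Longrightarrow>
    (A * B) $$ (i, j) = (\<Sum>l<dim_row B. A $$ (i, l) * B $$ (l, j))"
  by (simp add: scalar_prod_def lessThan_atLeast0)

lemma mat_adjoint_adjoint [simp]: "mat_adjoint (mat_adjoint A) = (A :: complex mat)"
  by (rule eq_matI) (auto simp: mat_adjoint_index)

lemma mat_adjoint_smult: "mat_adjoint (c \<cdot>\<^sub>m A) = cnj c \<cdot>\<^sub>m mat_adjoint A"
  by (rule eq_matI) (auto simp: mat_adjoint_index)

lemma mat_adjoint_one [simp]: "mat_adjoint (1\<^sub>m d :: complex mat) = 1\<^sub>m d"
  by (rule eq_matI) (auto simp: mat_adjoint_index)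

lemma mat_adjoint_mult:
  fixes A B :: "complex mat"
  assumes "A \<in> carrier_mat r l" "B \<in> carrier_mat l c"
  shows "mat_adjoint (A * B) = mat_adjoint B * mat_adjoint A"
proof (rule eq_matI)
  fix i j assume "i < dim_row (mat_adjoint B * mat_adjoint A)" "j < dim_col (mat_adjoint B * mat_adjoint A)"
  then have "i < c" "j < r" using assms by auto
  then show "mat_adjoint (A * B) $$ (i, j) = (mat_adjoint B * mat_adjoint A) $$ (i, j)"
    using assms by (simp add: mat_adjoint_index mult_mat_index_sum mult.commute del: index_mult_mat(1))
qed (use assms in auto)

lemma smult_mult_mat:
  fixes A B :: "complex mat"
  assumes "A \<in> carrier_mat r l" "B \<in> carrier_mat l c"
  shows "(x \<cdot>\<^sub>m A) * B = x \<cdot>\<^sub>m (A * B)" "A * (x \<cdot>\<^sub>m B) = x \<cdot>\<^sub>m (A * B)"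
  using assms mult_smult_assoc_mat mult_smult_distrib by blast+

lemma smult_smult_mat: "x \<cdot>\<^sub>m (y \<cdot>\<^sub>m A) = (x * y) \<cdot>\<^sub>m (A :: complex mat)"
  by (rule eq_matI) auto

lemma smult_one_mat [simp]: "1 \<cdot>\<^sub>m A = (A :: complex mat)"
  by (rule eq_matI) auto

lemma smult_mat_cancel:
  assumes "c \<noteq> 0" "c \<cdot>\<^sub>m A = c \<cdot>\<^sub>m B"
  shows "A = (B :: complex mat)"
proof -
  have "inverse c \<cdot>\<^sub>m (c \<cdot>\<^sub>m A) = inverse c \<cdot>\<^sub>m (c \<cdot>\<^sub>m B)" using assms(2) by simp
  then show ?thesis unfolding smult_smult_mat left_inverse[OF assms(1)] by simp
qed

section \<open>Traces and equality of matrices\<close>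

definition mtrace :: "complex mat \<Rightarrow> complex" where
  "mtrace A = (\<Sum>i<dim_row A. A $$ (i, i))"

lemma mtrace_comm:
  assumes "A \<in> carrier_mat r c" "B \<in> carrier_mat c r"
  shows "mtrace (A * B) = mtrace (B * A)"
proof -
  have "mtrace (A * B) = (\<Sum>i<r. \<Sum>j<c. A $$ (i, j) * B $$ (j, i))"
    using assms by (simp add: mtrace_def mult_mat_index_sum del: index_mult_mat(1))
  also have "\<dots> = (\<Sum>j<c. \<Sum>i<r. B $$ (j, i) * A $$ (i, j))"
    by (subst sum.swap) (simp add: mult.commute)
  also have "\<dots> = mtrace (B * A)"
    using assms by (simp add: mtrace_def mult_mat_index_sum del: index_mult_mat(1))
  finally show ?thesis .
qed

lemma mtrace_smult: "A \<in> carrier_mat d d \<Longrightarrow> mtrace (c \<cdot>\<^sub>m A) = c * mtrace A"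
  by (auto simp: mtrace_def sum_distrib_left intro!: sum.cong)

text \<open>Testing on unit vectors recovers the columns. The code space is a set of vectors, so
  matrix identities about it are reached by applying both sides to vectors.\<close>

lemma mat_eqI_vec:
  fixes A B :: "complex mat"
  assumes "A \<in> carrier_mat r c" "B \<in> carrier_mat r c"
    and "\<And>v. v \<in> carrier_vec c \<Longrightarrow> A *\<^sub>v v = B *\<^sub>v v"
  shows "A = B"
proof (rule eq_matI)
  fix i j assume "i < dim_row B" "j < dim_col B"
  then have ij: "i < r" "j < c" using assms by auto
  have "(A *\<^sub>v unit_vec c j) $ i = (B *\<^sub>v unit_vec c j) $ i"
    using assms(3)[of "unit_vec c j"] by simp
  moreover have "(D *\<^sub>v unit_vec c j) $ i = D $$ (i, j)" if "D \<in> carrier_mat r c" for D :: "complex mat"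
    using that ij scalar_prod_right_unit[of j c "row D i"] by auto
  ultimately show "A $$ (i, j) = B $$ (i, j)" using assms(1,2) by metis
qed (use assms in auto)

section \<open>Unitary matrices and their group\<close>

lemma unitary_matI:
  assumes "U \<in> carrier_mat d d" "mat_adjoint U * U = 1\<^sub>m d"
  shows "unitary_mat d U"
  using assms mat_mult_left_right_inverse[of "mat_adjoint U" d U] by (simp add: unitary_mat_def)

lemma unitary_matD:
  assumes "unitary_mat d U"
  shows "U \<in> carrier_mat d d" "mat_adjoint U * U = 1\<^sub>m d" "U * mat_adjoint U = 1\<^sub>m d"
  using assms by (auto simp: unitary_mat_def)

lemma unitary_mat_cancel:
  assumes "unitary_mat d U" "A \<in> carrier_mat d c"
  shows "mat_adjoint U * (U * A) = A" "U * (mat_adjoint U * A) = A"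
proof -
  have U: "U \<in> carrier_mat d d" "mat_adjoint U \<in> carrier_mat d d"
    using assms by (auto simp: unitary_mat_def)
  show "mat_adjoint U * (U * A) = A" "U * (mat_adjoint U * A) = A"
    using assms(2) unitary_matD[OF assms(1)] U
    by (simp_all flip: assoc_mult_mat[OF U(2) U(1) assms(2)] assoc_mult_mat[OF U(1) U(2) assms(2)])
qed

lemma unitary_mat_one: "unitary_mat d (1\<^sub>m d)"
  by (simp add: unitary_mat_def)

lemma unitary_mat_adjoint: "unitary_mat d U \<Longrightarrow> unitary_mat d (mat_adjoint U)"
  by (auto simp: unitary_mat_def)

lemma unitary_mat_mult:
  assumes "unitary_mat d U" "unitary_mat d V"
  shows "unitary_mat d (U * V)"
proof (rule unitary_matI)
  note U = unitary_matD[OF assms(1)] mat_adjoint_carrier[OF unitary_matD(1)[OF assms(1)]]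
  note V = unitary_matD[OF assms(2)] mat_adjoint_carrier[OF unitary_matD(1)[OF assms(2)]]
  show UV: "U * V \<in> carrier_mat d d" using U(1) V(1) by simp
  have "mat_adjoint (U * V) * (U * V) = mat_adjoint V * mat_adjoint U * (U * V)"
    by (simp only: mat_adjoint_mult[OF U(1) V(1)])
  also have "\<dots> = mat_adjoint V * (mat_adjoint U * (U * V))"
    by (rule assoc_mult_mat[OF V(4) U(4) UV])
  finally show "mat_adjoint (U * V) * (U * V) = 1\<^sub>m d"
    by (simp only: unitary_mat_cancel[OF assms(1) V(1)] V(2))
qed

lemma unitary_mat_smult:
  assumes "unitary_mat d U" "cmod c = 1"
  shows "unitary_mat d (c \<cdot>\<^sub>m U)"
proof (rule unitary_matI)
  note U = unitary_matD[OF assms(1)]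
  have "c * cnj c = 1"
    using assms(2) complex_norm_square[of c] by simp
  then show "mat_adjoint (c \<cdot>\<^sub>m U) * (c \<cdot>\<^sub>m U) = 1\<^sub>m d"
    using U by (simp add: mat_adjoint_smult smult_mult_mat[of _ d d _ d] smult_smult_mat mult.commute)
qed (use assms in \<open>auto simp: unitary_mat_def\<close>)

lemma unitary_group_simps [simp]:
  "carrier (unitary_group d) = {U. unitary_mat d U}"
  "monoid.mult (unitary_group d) = (*)"
  "one (unitary_group d) = 1\<^sub>m d"
  by (auto simp: unitary_group_def)

lemma group_unitary_group: "group (unitary_group d)"
proof (rule groupI)
  fix U V W assume "U \<in> carrier (unitary_group d)" "V \<in> carrier (unitary_group d)" "W \<in> carrier (unitary_group d)"
  then show "U \<otimes>\<^bsub>unitary_group d\<^esub> V \<otimes>\<^bsub>unitary_group d\<^esub> W = U \<otimes>\<^bsub>unitary_group d\<^esub> (V \<otimes>\<^bsub>unitary_group d\<^esub> W)"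
    by (auto simp: unitary_mat_def intro!: assoc_mult_mat[of _ d d _ d _ d])
next
  fix U assume "U \<in> carrier (unitary_group d)"
  then show "\<exists>V\<in>carrier (unitary_group d). V \<otimes>\<^bsub>unitary_group d\<^esub> U = \<one>\<^bsub>unitary_group d\<^esub>"
    by (auto intro!: exI[of _ "mat_adjoint U"] simp: unitary_mat_def)
qed (auto simp: unitary_mat_one unitary_mat_mult, auto simp: unitary_mat_def)

lemma inv_unitary_group:
  assumes "unitary_mat d U"
  shows "inv\<^bsub>unitary_group d\<^esub> U = mat_adjoint U"
proof -
  interpret group "unitary_group d" by (rule group_unitary_group)
  show ?thesis using assms unitary_mat_adjoint[OF assms] unitary_matD[OF assms] inv_equality by auto
qed

lemma mat_prod_list_simps [simp]:
  "mat_prod_list d [] = 1\<^sub>m d" "mat_prod_list d (A # As) = A * mat_prod_list d As"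
  by (auto simp: mat_prod_list_def)

section \<open>Digits\<close>

lemma digit_less: "m > 0 \<Longrightarrow> digit m x j < m"
  by (simp add: digit_def)

lemma digit_mod [simp]: "digit m x j mod m = digit m x j"
  by (simp add: digit_def)

lemma digit_Suc: "digit m x (Suc j) = digit m (x div m) j"
  by (simp add: digit_def div_mult2_eq)

lemma digit_eqI:
  assumes "x < m ^ n" "y < m ^ n" "\<And>j. j < n \<Longrightarrow> digit m x j = digit m y j"
  shows "x = y"
  using assms
proof (induction n arbitrary: x y)
  case (Suc n)
  have m: "m > 0" using Suc.prems(1) by (cases m) auto
  have "x div m = y div m"
  proof (rule Suc.IH)
    show "x div m < m ^ n" "y div m < m ^ n"
      using Suc.prems by (simp_all add: less_mult_imp_div_less mult.commute)
  qed (use Suc.prems(3)[of "Suc _"] in \<open>simp add: digit_Suc\<close>)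
  moreover have "x mod m = y mod m" using Suc.prems(3)[of 0] by (simp add: digit_def)
  ultimately show ?case by (metis div_mult_mod_eq)
qed auto

text \<open>Exponents are natural numbers, so the shift from one digit to another is written with
  \<open>m - digit m x j\<close>, which subtracts modulo \<open>m\<close> without going
  negative.\<close>

lemma digit_shift_cancel:
  assumes "m > 0"
  shows "(digit m x j + (digit m y j + (m - digit m x j))) mod m = digit m y j"
proof -
  have "digit m x j + (digit m y j + (m - digit m x j)) = digit m y j + m"
    using digit_less[OF assms, of x j] by simp
  then show ?thesis by simp
qed

text \<open>With \<open>digit_eqI\<close> this makes the indices below \<open>m ^ n\<close>
  correspond bijectively to digit strings. Reducing \<open>f j\<close> modulo \<open>m\<close> lets
  any function prescribe the digits.\<close>

lemma ex_digits:
  assumes "m > 0"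
  shows "\<exists>x < m ^ n. \<forall>j<n. digit m x j = f j mod m"
proof (induction n arbitrary: f)
  case (Suc n)
  obtain x where x: "x < m ^ n" "\<forall>j<n. digit m x j = f (Suc j) mod m" using Suc[of "f \<circ> Suc"] by auto
  let ?y = "x * m + f 0 mod m"
  have "?y < (x + 1) * m" using assms by (simp add: algebra_simps)
  also have "\<dots> \<le> m ^ n * m" using x(1) by (intro mult_right_mono) auto
  finally have "?y < m ^ Suc n" by (simp add: mult.commute)
  moreover have "digit m ?y j = f j mod m" if "j < Suc n" for j
    using x that assms by (cases j) (auto simp: digit_Suc, simp add: digit_def)
  ultimately show ?case by blast
qed auto

section \<open>Weyl operators\<close>

lemma omega_power: "omega m ^ i = cis (2 * pi * real i / real m)"
  by (simp add: omega_def DeMoivre field_simps)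

lemma omega_power_m: "m > 0 \<Longrightarrow> omega m ^ m = 1"
  by (simp add: omega_power)

lemma omega_power_mod: "m > 0 \<Longrightarrow> omega m ^ (i mod m) = omega m ^ i"
  by (metis div_mult_mod_eq mult.commute mult.left_neutral omega_power_m power_add power_mult power_one)

lemma omega_power_cong: "m > 0 \<Longrightarrow> i mod m = j mod m \<Longrightarrow> omega m ^ i = omega m ^ j"
  by (metis omega_power_mod)

text \<open>Reducing both exponents modulo \<open>m\<close> brings them into the range where the
  roots of unity are enumerated injectively; \<open>omega m\<close> is thus a primitive
  root.\<close>

lemma omega_power_eq_iff:
  assumes "m > 0"
  shows "omega m ^ i = omega m ^ j \<longleftrightarrow> i mod m = j mod m"
proof
  assume "omega m ^ i = omega m ^ j"
  then have "cis (2 * pi * real (i mod m) / real m) = cis (2 * pi * real (j mod m) / real m)"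
    by (simp only: omega_power[symmetric] omega_power_mod[OF assms])
  moreover have "inj_on (\<lambda>k. cis (2 * pi * real k / real m)) {..<m}"
    using bij_betw_roots_unity[OF assms] by (simp add: bij_betw_def)
  ultimately show "i mod m = j mod m"
    using assms by (auto dest: inj_onD)
next
  assume "i mod m = j mod m"
  then show "omega m ^ i = omega m ^ j" by (rule omega_power_cong[OF assms])
qed

lemma norm_omega [simp]: "cmod (omega m) = 1"
  by (simp add: omega_def)

lemma norm_omega_power [simp]: "cmod (omega m ^ i) = 1"
  by (simp add: norm_power)

lemma omega_nonzero [simp]: "omega m \<noteq> 0"
  by (metis norm_omega norm_zero zero_neq_one)

text \<open>Up to a phase, \<open>weyl m n a b\<close> is the product of the \<open>X\<^sub>j\<^bsup>a j\<^esup> Z\<^sub>j\<^bsup>b j\<^esup>\<close>; exponents matter only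
  modulo \<open>m\<close>.\<close>

definition shifted :: "nat \<Rightarrow> nat \<Rightarrow> (nat \<Rightarrow> nat) \<Rightarrow> nat \<Rightarrow> nat \<Rightarrow> bool" where
  "shifted m n a x y \<longleftrightarrow> (\<forall>j<n. digit m x j = (digit m y j + a j) mod m)"

definition weyl :: "nat \<Rightarrow> nat \<Rightarrow> (nat \<Rightarrow> nat) \<Rightarrow> (nat \<Rightarrow> nat) \<Rightarrow> complex mat" where
  "weyl m n a b = mat (m ^ n) (m ^ n) (\<lambda>(x, y).
     if shifted m n a x y then omega m ^ (\<Sum>j<n. b j * digit m y j) else 0)"

definition vanishes_on :: "nat \<Rightarrow> nat set \<Rightarrow> (nat \<Rightarrow> nat) \<Rightarrow> bool" where
  "vanishes_on m T a \<longleftrightarrow> (\<forall>j\<in>T. a j mod m = 0)"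

lemma weyl_carrier [simp, intro]: "weyl m n a b \<in> carrier_mat (m ^ n) (m ^ n)"
  by (simp add: weyl_def)

lemma weyl_dim [simp]: "dim_row (weyl m n a b) = m ^ n" "dim_col (weyl m n a b) = m ^ n"
  by (simp_all add: weyl_def)

lemma weyl_index:
  "x < m ^ n \<Longrightarrow> y < m ^ n \<Longrightarrow> weyl m n a b $$ (x, y) =
     (if shifted m n a x y then omega m ^ (\<Sum>j<n. b j * digit m y j) else 0)"
  by (simp add: weyl_def)

text \<open>Together with its mirror image below, this makes a Weyl operator a monomial matrix: one
  nonzero entry per column and per row, so sums in products with it collapse to one term.\<close>

lemma ex1_shifted:
  assumes "m > 0"
  shows "\<exists>!x. x < m ^ n \<and> shifted m n a x y"
proof -
  obtain x where "x < m ^ n" "shifted m n a x y"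
    using ex_digits[OF assms, of n "\<lambda>j. digit m y j + a j"] unfolding shifted_def by blast
  moreover have "x = x'" if "x < m ^ n" "x' < m ^ n" "shifted m n a x y" "shifted m n a x' y" for x x'
    using that by (intro digit_eqI[of x m n x']) (auto simp: shifted_def)
  ultimately show ?thesis by blast
qed

lemma ex1_shifted':
  assumes "m > 0"
  shows "\<exists>!y. y < m ^ n \<and> shifted m n a x y"
proof -
  \<comment> \<open>Multiplication by \<open>m - 1\<close> negates modulo \<open>m\<close>, so
    \<open>m - 1\<close> copies of a shift undo it.\<close>
  have cancel: "(t + u * (m - 1) + u) mod m = t mod m" for t u :: nat
  proof -
    have "t + u * (m - 1) + u = t + u * m" using assms by (cases m) auto
    then show ?thesis by (simp only: mod_mult_self1 mod_mult_self2)
  qed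
  obtain y where y: "y < m ^ n" "\<forall>j<n. digit m y j = (digit m x j + a j * (m - 1)) mod m"
    using ex_digits[OF assms, of n "\<lambda>j. digit m x j + a j * (m - 1)"] by blast
  then have "shifted m n a x y"
    by (simp add: shifted_def mod_add_left_eq cancel del: One_nat_def)
  moreover have "y' = y''" if "y' < m ^ n" "y'' < m ^ n" "shifted m n a x y'" "shifted m n a x y''" for y' y''
  proof (rule digit_eqI[OF that(1,2)])
    fix j assume "j < n"
    then have "(digit m y' j + a j) mod m = (digit m y'' j + a j) mod m"
      using that by (simp add: shifted_def)
    then have "(digit m y' j + a j + a j * (m - 1)) mod m = (digit m y'' j + a j + a j * (m - 1)) mod m"
      by (metis mod_add_left_eq)
    then show "digit m y' j = digit m y'' j"
      using cancel[of "digit m _ j" "a j"] by (simp add: algebra_simps)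
  qed
  ultimately show ?thesis using y(1) by blast
qed

lemma sum_mod_cong:
  "(\<And>j. j \<in> J \<Longrightarrow> f j mod m = g j mod (m :: nat)) \<Longrightarrow> sum f J mod m = sum g J mod m"
  by (subst (1 2) mod_sum_eq[symmetric]) (simp cong: sum.cong)

lemma weyl_cong:
  assumes "m > 0" "\<And>j. j < n \<Longrightarrow> a j mod m = a' j mod m" "\<And>j. j < n \<Longrightarrow> b j mod m = b' j mod m"
  shows "weyl m n a b = weyl m n a' b'"
proof -
  have 1: "shifted m n a x y = shifted m n a' x y" for x y
    using assms(2) unfolding shifted_def by (metis mod_add_right_eq)
  have "(\<Sum>j<n. b j * digit m y j) mod m = (\<Sum>j<n. b' j * digit m y j) mod m" for y
    by (intro sum_mod_cong mod_mult_cong assms(3)) auto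
  then have 2: "omega m ^ (\<Sum>j<n. b j * digit m y j) = omega m ^ (\<Sum>j<n. b' j * digit m y j)" for y
    using assms(1) by (intro omega_power_cong)
  show ?thesis unfolding weyl_def 1 2 by simp
qed

text \<open>The phase is the price of moving the \<open>Z\<close> powers of the left factor past the
  \<open>X\<close> powers of the right one. Exponents are added without reduction, which
  \<open>weyl_cong\<close> makes harmless.\<close>

lemma weyl_mult:
  assumes "m > 0"
  shows "weyl m n a b * weyl m n a' b' =
    omega m ^ (\<Sum>j<n. b j * a' j) \<cdot>\<^sub>m weyl m n (\<lambda>j. a j + a' j) (\<lambda>j. b j + b' j)"
proof (rule eq_matI)
  fix x y assume "x < dim_row (omega m ^ (\<Sum>j<n. b j * a' j) \<cdot>\<^sub>m weyl m n (\<lambda>j. a j + a' j) (\<lambda>j. b j + b' j))"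
    "y < dim_col (omega m ^ (\<Sum>j<n. b j * a' j) \<cdot>\<^sub>m weyl m n (\<lambda>j. a j + a' j) (\<lambda>j. b j + b' j))"
  then have x: "x < m ^ n" and y: "y < m ^ n" by auto
  obtain z where z: "z < m ^ n" "shifted m n a' z y" and u: "\<And>w. w < m ^ n \<Longrightarrow> shifted m n a' w y \<Longrightarrow> w = z"
    using ex1_shifted[OF assms, of n a' y] by blast
  have "(weyl m n a b * weyl m n a' b') $$ (x, y) =
      (\<Sum>w<m ^ n. weyl m n a b $$ (x, w) * weyl m n a' b' $$ (w, y))"
    using x y by (simp add: mult_mat_index_sum del: index_mult_mat(1))
  also have "\<dots> = (\<Sum>w\<in>{z}. weyl m n a b $$ (x, w) * weyl m n a' b' $$ (w, y))"
    using z(1) u y by (intro sum.mono_neutral_right) (auto simp: weyl_index)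
  also have "\<dots> = (if shifted m n a x z then omega m ^ ((\<Sum>j<n. b j * digit m z j) + (\<Sum>j<n. b' j * digit m y j)) else 0)"
    using x y z by (simp add: weyl_index power_add)
  also have "shifted m n a x z = shifted m n (\<lambda>j. a j + a' j) x y"
    using z(2) by (simp add: shifted_def mod_add_left_eq add.assoc add.commute[of "a' _"])
  \<comment> \<open>The digits of \<open>z\<close> are sums only modulo \<open>m\<close>; in an
    exponent of \<open>omega m\<close> this suffices to replace them by the unreduced sums.\<close>
  also have "(\<Sum>j<n. b j * digit m z j) mod m = (\<Sum>j<n. b j * (digit m y j + a' j)) mod m"
    by (intro sum_mod_cong mod_mult_cong) (use z(2) in \<open>auto simp: shifted_def\<close>)
  then have "((\<Sum>j<n. b j * digit m z j) + (\<Sum>j<n. b' j * digit m y j)) mod m =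
      ((\<Sum>j<n. b j * (digit m y j + a' j)) + (\<Sum>j<n. b' j * digit m y j)) mod m"
    by (metis mod_add_left_eq)
  then have "omega m ^ ((\<Sum>j<n. b j * digit m z j) + (\<Sum>j<n. b' j * digit m y j)) =
      omega m ^ ((\<Sum>j<n. b j * a' j) + (\<Sum>j<n. (b j + b' j) * digit m y j))"
    by (intro omega_power_cong assms) (simp add: algebra_simps sum.distrib)
  finally show "(weyl m n a b * weyl m n a' b') $$ (x, y) =
      (omega m ^ (\<Sum>j<n. b j * a' j) \<cdot>\<^sub>m weyl m n (\<lambda>j. a j + a' j) (\<lambda>j. b j + b' j)) $$ (x, y)"
    using x y by (simp add: weyl_index power_add)
qed auto

lemma weyl_zero:
  assumes "m > 0" "vanishes_on m {..<n} a" "vanishes_on m {..<n} b"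
  shows "weyl m n a b = 1\<^sub>m (m ^ n)"
proof -
  have "weyl m n a b = weyl m n (\<lambda>_. 0) (\<lambda>_. 0)"
    using assms by (intro weyl_cong) (auto simp: vanishes_on_def)
  also have "\<dots> = 1\<^sub>m (m ^ n)"
    by (rule eq_matI) (use digit_eqI in \<open>auto simp: weyl_index shifted_def\<close>)
  finally show ?thesis .
qed

lemma weyl_unitary:
  assumes "m > 0"
  shows "unitary_mat (m ^ n) (weyl m n a b)"
proof (rule unitary_matI)
  show "mat_adjoint (weyl m n a b) * weyl m n a b = 1\<^sub>m (m ^ n)"
  proof (rule eq_matI)
    fix x y assume "x < dim_row (1\<^sub>m (m ^ n) :: complex mat)" "y < dim_col (1\<^sub>m (m ^ n) :: complex mat)"
    then have x: "x < m ^ n" and y: "y < m ^ n" by auto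
    obtain z where z: "z < m ^ n" "shifted m n a z x" and u: "\<And>w. w < m ^ n \<Longrightarrow> shifted m n a w x \<Longrightarrow> w = z"
      using ex1_shifted[OF assms, of n a x] by blast
    have "(mat_adjoint (weyl m n a b) * weyl m n a b) $$ (x, y) =
        (\<Sum>w<m ^ n. cnj (weyl m n a b $$ (w, x)) * weyl m n a b $$ (w, y))"
      using x y by (simp add: mult_mat_index_sum mat_adjoint_index del: index_mult_mat(1))
    also have "\<dots> = (\<Sum>w\<in>{z}. cnj (weyl m n a b $$ (w, x)) * weyl m n a b $$ (w, y))"
      using z(1) u x by (intro sum.mono_neutral_right) (auto simp: weyl_index)
    also have "\<dots> = 1\<^sub>m (m ^ n) $$ (x, y)"
    proof (cases "x = y")
      case True
      have "cnj (omega m ^ i) * omega m ^ i = 1" for i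
        using complex_norm_square[of "omega m ^ i"] by (simp add: mult.commute del: complex_cnj_power)
      then show ?thesis using True x z by (simp add: weyl_index del: complex_cnj_power)
    next
      case False
      then have "\<not> shifted m n a z y" using ex1_shifted'[OF assms, of n a z] x y z by blast
      then show ?thesis using x y z False by (simp add: weyl_index)
    qed
    finally show "(mat_adjoint (weyl m n a b) * weyl m n a b) $$ (x, y) = 1\<^sub>m (m ^ n) $$ (x, y)" .
  qed auto
qed auto

lemma weyl_mult_left_index:
  assumes "m > 0" "A \<in> carrier_mat (m ^ n) c" "x < m ^ n" "x' < m ^ n" "y < c" "shifted m n a x' x"
  shows "(weyl m n a b * A) $$ (x', y) = omega m ^ (\<Sum>j<n. b j * digit m x j) * A $$ (x, y)"
proof -
  have "(weyl m n a b * A) $$ (x', y) = (\<Sum>z<m ^ n. weyl m n a b $$ (x', z) * A $$ (z, y))"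
    using assms by (simp add: mult_mat_index_sum del: index_mult_mat(1))
  also have "\<dots> = (\<Sum>z\<in>{x}. weyl m n a b $$ (x', z) * A $$ (z, y))"
    using assms ex1_shifted'[OF assms(1), of n a x']
    by (intro sum.mono_neutral_right) (auto simp: weyl_index)
  finally show ?thesis using assms by (simp add: weyl_index)
qed

lemma weyl_mult_right_index:
  assumes "m > 0" "A \<in> carrier_mat r (m ^ n)" "x < r" "y < m ^ n" "y' < m ^ n" "shifted m n a y' y"
  shows "(A * weyl m n a b) $$ (x, y) = A $$ (x, y') * omega m ^ (\<Sum>j<n. b j * digit m y j)"
proof -
  have "(A * weyl m n a b) $$ (x, y) = (\<Sum>z<m ^ n. A $$ (x, z) * weyl m n a b $$ (z, y))"
    using assms by (simp add: mult_mat_index_sum del: index_mult_mat(1))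
  also have "\<dots> = (\<Sum>z\<in>{y'}. A $$ (x, z) * weyl m n a b $$ (z, y))"
    using assms ex1_shifted[OF assms(1), of n a y]
    by (intro sum.mono_neutral_right) (auto simp: weyl_index)
  finally show ?thesis using assms by (simp add: weyl_index)
qed

section \<open>Phases and commutation relations of Weyl operators\<close>

lemma unitary_smult_inj:
  assumes "unitary_mat d U" "d > 0" "c \<cdot>\<^sub>m U = c' \<cdot>\<^sub>m U"
  shows "c = c'"
proof -
  note U = unitary_matD[OF assms(1)]
  have "c \<cdot>\<^sub>m 1\<^sub>m d = (c \<cdot>\<^sub>m U) * mat_adjoint U" for c
    using U smult_mult_mat(1)[of U d d "mat_adjoint U" d c] by simp
  then have "c \<cdot>\<^sub>m 1\<^sub>m d = c' \<cdot>\<^sub>m (1\<^sub>m d :: complex mat)" using assms(3) by metis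
  then have "(c \<cdot>\<^sub>m 1\<^sub>m d) $$ (0, 0) = (c' \<cdot>\<^sub>m (1\<^sub>m d :: complex mat)) $$ (0, 0)" by simp
  then show ?thesis using assms(2) by simp
qed

text \<open>Both orders give the same Weyl operator with different phases. Keeping one phase on each
  side avoids negative powers of \<open>omega m\<close>.\<close>

lemma weyl_exchange:
  assumes "m > 0"
  shows "omega m ^ (\<Sum>j<n. b' j * a j) \<cdot>\<^sub>m (weyl m n a b * weyl m n a' b') =
    omega m ^ (\<Sum>j<n. b j * a' j) \<cdot>\<^sub>m (weyl m n a' b' * weyl m n a b)"
  by (simp add: weyl_mult[OF assms] smult_smult_mat add.commute mult.commute)

text \<open>The difference of the two sums is the symplectic form of the exponent pairs, and
  commutation is its vanishing modulo \<open>m\<close>.\<close>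

lemma weyl_commute_iff:
  assumes "m > 0"
  shows "weyl m n a b * weyl m n a' b' = weyl m n a' b' * weyl m n a b \<longleftrightarrow>
    (\<Sum>j<n. b j * a' j) mod m = (\<Sum>j<n. b' j * a j) mod m"
proof -
  have eq: "weyl m n (\<lambda>j. a' j + a j) (\<lambda>j. b' j + b j) = weyl m n (\<lambda>j. a j + a' j) (\<lambda>j. b j + b' j)"
    by (simp add: add.commute)
  show ?thesis
    unfolding weyl_mult[OF assms] omega_power_eq_iff[OF assms, symmetric] eq
    using unitary_smult_inj[OF weyl_unitary[OF assms]] assms by auto
qed

definition unit_exp :: "nat \<Rightarrow> nat \<Rightarrow> nat" where
  "unit_exp j i = (if i = j then 1 else 0)"

lemma sum_unit_exp [simp]:
  "j < n \<Longrightarrow> (\<Sum>i<n. unit_exp j i * f i) = f j" "j < n \<Longrightarrow> (\<Sum>i<n. f i * unit_exp j i) = f j"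
  unfolding unit_exp_def by (simp_all add: if_distrib if_distribR cong: if_cong)

text \<open>Nondegeneracy of the symplectic form: \<open>X\<close> on qudit \<open>j\<close> reads
  off \<open>b j\<close>, and \<open>Z\<close> on it reads off \<open>a j\<close>.\<close>

lemma weyl_exponent_zero:
  assumes "m > 0" "j < n"
    and "weyl m n a b * weyl m n (unit_exp j) (\<lambda>_. 0) = weyl m n (unit_exp j) (\<lambda>_. 0) * weyl m n a b"
    and "weyl m n a b * weyl m n (\<lambda>_. 0) (unit_exp j) = weyl m n (\<lambda>_. 0) (unit_exp j) * weyl m n a b"
  shows "a j mod m = 0 \<and> b j mod m = 0"
  using assms(3,4) assms(2) unfolding weyl_commute_iff[OF assms(1)] by simp

lemma pauli_X_eq_weyl:
  assumes "m > 0"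
  shows "pauli_X m n j = weyl m n (unit_exp j) (\<lambda>_. 0)"
proof -
  have "shifted m n (unit_exp j) x y \<longleftrightarrow>
      (\<forall>i<n. digit m x i = (if i = j then (digit m y i + 1) mod m else digit m y i))" for x y
    by (auto simp: shifted_def unit_exp_def)
  then show ?thesis by (intro eq_matI) (simp_all add: pauli_X_def weyl_index)
qed

lemma shifted_zero: "x < m ^ n \<Longrightarrow> y < m ^ n \<Longrightarrow> shifted m n (\<lambda>_. 0) x y \<longleftrightarrow> x = y"
  using digit_eqI[of x m n y] by (auto simp: shifted_def)

lemma pauli_Z_eq_weyl:
  assumes "j < n"
  shows "pauli_Z m n j = weyl m n (\<lambda>_. 0) (unit_exp j)"
  by (rule eq_matI) (auto simp: pauli_Z_def weyl_index shifted_zero assms)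

section \<open>Operators acting on a subset of the qudits\<close>

text \<open>Intersecting with \<open>{..<n}\<close> allows \<open>T\<close> to be a complement such
  as \<open>- R\<close>, so that digits off \<open>R\<close> need no notion of their own.\<close>

definition agree :: "nat \<Rightarrow> nat \<Rightarrow> nat set \<Rightarrow> nat \<Rightarrow> nat \<Rightarrow> bool" where
  "agree m n T x y \<longleftrightarrow> (\<forall>j\<in>{..<n} \<inter> T. digit m x j = digit m y j)"

lemma agree_sym: "agree m n T x y \<Longrightarrow> agree m n T y x"
  by (auto simp: agree_def)

lemma agreeD: "agree m n T x y \<Longrightarrow> j < n \<Longrightarrow> j \<in> T \<Longrightarrow> digit m x j = digit m y j"
  by (auto simp: agree_def)

text \<open>\<open>R\<close> may contain numbers beyond the last qudit. The digits of an index below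
  \<open>m ^ n\<close> vanish there, so the restrictions compare nothing more than
  \<open>agree\<close> does.\<close>

lemma restrict_digit_eq_iff:
  assumes "x < m ^ n" "y < m ^ n"
  shows "restrict (digit m x) R = restrict (digit m y) R \<longleftrightarrow> agree m n R x y"
proof -
  have big: "digit m z j = 0" if "z < m ^ n" "\<not> j < n" for z j
  proof -
    have "m > 0 \<or> n = 0" using assms by (cases m; cases n) auto
    then have "m ^ n \<le> m ^ j \<or> z = 0" using that by (auto intro: power_increasing)
    then show ?thesis using that(1) by (auto simp: digit_def)
  qed
  have "digit m x j = digit m y j" if "agree m n R x y" "j \<in> R" for j
    using that big assms by (cases "j < n") (auto simp: agree_def)
  moreover have "agree m n R x y" if "restrict (digit m x) R = restrict (digit m y) R"
    unfolding agree_def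
  proof
    fix j assume "j \<in> {..<n} \<inter> R"
    then show "digit m x j = digit m y j" using fun_cong[OF that, of j] by simp
  qed
  ultimately show ?thesis by (auto simp: restrict_def fun_eq_iff)
qed

text \<open>Trades the existential quantifier over an operator on \<open>R\<close> for conditions on
  single entries, the form in which locality can be tested against Weyl operators.\<close>

lemma acts_only_on_iff:
  "acts_only_on m n R W \<longleftrightarrow> W \<in> carrier_mat (m ^ n) (m ^ n) \<and>
    (\<forall>x<m ^ n. \<forall>y<m ^ n. \<not> agree m n (- R) x y \<longrightarrow> W $$ (x, y) = 0) \<and>
    (\<forall>x<m ^ n. \<forall>y<m ^ n. \<forall>x'<m ^ n. \<forall>y'<m ^ n.
       agree m n (- R) x y \<longrightarrow> agree m n (- R) x' y' \<longrightarrow> agree m n R x x' \<longrightarrow> agree m n R y y' \<longrightarrow>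
       W $$ (x, y) = W $$ (x', y'))" (is "?L \<longleftrightarrow> ?R")
proof -
  have off: "(\<forall>j\<in>{..<n} - R. digit m x j = digit m y j) \<longleftrightarrow> agree m n (- R) x y" for x y
    by (auto simp: agree_def)
  have L: "?L \<longleftrightarrow> W \<in> carrier_mat (m ^ n) (m ^ n) \<and>
    (\<exists>A. \<forall>x<m ^ n. \<forall>y<m ^ n. W $$ (x, y) =
      (if agree m n (- R) x y then A (restrict (digit m x) R) (restrict (digit m y) R) else 0))"
    unfolding acts_only_on_def off ..
  show ?thesis
  proof
    assume ?L
    then obtain A where W: "W \<in> carrier_mat (m ^ n) (m ^ n)" and
      A: "\<And>x y. x < m ^ n \<Longrightarrow> y < m ^ n \<Longrightarrow> W $$ (x, y) =
      (if agree m n (- R) x y then A (restrict (digit m x) R) (restrict (digit m y) R) else 0)"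
      unfolding L by blast
    have "W $$ (x, y) = W $$ (x', y')"
      if "x < m ^ n" "y < m ^ n" "x' < m ^ n" "y' < m ^ n" "agree m n (- R) x y" "agree m n (- R) x' y'"
        "agree m n R x x'" "agree m n R y y'" for x y x' y'
    proof -
      have "restrict (digit m x) R = restrict (digit m x') R" "restrict (digit m y) R = restrict (digit m y') R"
        using that by (simp_all add: restrict_digit_eq_iff)
      then show ?thesis using that by (simp add: A)
    qed
    then show ?R using W A by auto
  next
    assume R: ?R
    \<comment> \<open>\<open>A\<close> reads its value off any pair of indices with the given digits
      in \<open>R\<close>; the last condition of \<open>?R\<close> makes the choice
      irrelevant.\<close>
    define A where "A f g = (SOME w. \<exists>x<m ^ n. \<exists>y<m ^ n. agree m n (- R) x y \<and>
      f = restrict (digit m x) R \<and> g = restrict (digit m y) R \<and> w = W $$ (x, y))" for f g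
    have "A (restrict (digit m x) R) (restrict (digit m y) R) = W $$ (x, y)"
      if xy: "x < m ^ n" "y < m ^ n" "agree m n (- R) x y" for x y
      unfolding A_def
    proof (rule some_equality)
      fix w assume "\<exists>x'<m ^ n. \<exists>y'<m ^ n. agree m n (- R) x' y' \<and>
        restrict (digit m x) R = restrict (digit m x') R \<and>
        restrict (digit m y) R = restrict (digit m y') R \<and> w = W $$ (x', y')"
      then obtain x' y' where x': "x' < m ^ n" "y' < m ^ n" "agree m n (- R) x' y'" "w = W $$ (x', y')"
        and *: "restrict (digit m x) R = restrict (digit m x') R" "restrict (digit m y) R = restrict (digit m y') R"
        by blast
      have "agree m n R x x'" "agree m n R y y'"
        using * xy x' by (simp_all add: restrict_digit_eq_iff)
      then show "w = W $$ (x, y)" using R xy x' by metis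
    qed (use xy in blast)
    then have "\<forall>x<m ^ n. \<forall>y<m ^ n. W $$ (x, y) =
      (if agree m n (- R) x y then A (restrict (digit m x) R) (restrict (digit m y) R) else 0)"
      using R by auto
    then show ?L unfolding L using R by blast
  qed
qed

lemma acts_only_onD:
  assumes "acts_only_on m n R W"
  shows "W \<in> carrier_mat (m ^ n) (m ^ n)"
    and "x < m ^ n \<Longrightarrow> y < m ^ n \<Longrightarrow> \<not> agree m n (- R) x y \<Longrightarrow> W $$ (x, y) = 0"
    and "x < m ^ n \<Longrightarrow> y < m ^ n \<Longrightarrow> x' < m ^ n \<Longrightarrow> y' < m ^ n \<Longrightarrow>
       agree m n (- R) x y \<Longrightarrow> agree m n (- R) x' y' \<Longrightarrow> agree m n R x x' \<Longrightarrow> agree m n R y y' \<Longrightarrow>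
       W $$ (x, y) = W $$ (x', y')"
  using assms unfolding acts_only_on_iff by blast+

lemma ex_merge:
  assumes "m > 0"
  shows "\<exists>z<m ^ n. agree m n T z y \<and> agree m n (- T) z x"
proof -
  obtain z where "z < m ^ n" "\<forall>j<n. digit m z j = (if j \<in> T then digit m y j else digit m x j) mod m"
    using ex_digits[OF assms, of n "\<lambda>j. if j \<in> T then digit m y j else digit m x j"] by blast
  then show ?thesis by (intro exI[of _ z]) (auto simp: agree_def)
qed

text \<open>The intermediate index in a product of operators on disjoint \<open>R\<close> and
  \<open>R'\<close> is forced: off \<open>R\<close> the first factor keeps the row index, and on
  \<open>R\<close> the second keeps the column index.\<close>

lemma merge_unique:
  assumes "w < m ^ n" "z < m ^ n" "agree m n (- R) x w" "agree m n (- R') w y"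
    and "agree m n R z y" "agree m n (- R) z x" "R \<inter> R' \<inter> {..<n} = {}"
  shows "w = z"
proof (rule digit_eqI[OF assms(1,2)])
  fix j assume j: "j < n"
  show "digit m w j = digit m z j"
  proof (cases "j \<in> R")
    case True
    then have "j \<in> - R'" using j assms(7) by auto
    then show ?thesis using agreeD[OF assms(4) j] agreeD[OF assms(5) j True] by simp
  next
    case False
    then show ?thesis using agreeD[OF assms(3) j] agreeD[OF assms(6) j] by simp
  qed
qed

text \<open>Each entry of either product has at most one surviving term, at a hybrid of the row and
  column index. The hybrids \<open>z\<close> and \<open>u\<close> for the two orders are
  complementary, and locality identifies the factors at \<open>z\<close> with those at
  \<open>u\<close>.\<close>

lemma acts_only_on_disjoint_commute:
  assumes "m > 0" "acts_only_on m n R A" "acts_only_on m n R' B" "R \<inter> R' \<inter> {..<n} = {}"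
  shows "A * B = B * A"
proof (rule eq_matI)
  note A = acts_only_onD[OF assms(2)] and B = acts_only_onD[OF assms(3)]
  fix x y assume "x < dim_row (B * A)" "y < dim_col (B * A)"
  then have xy: "x < m ^ n" "y < m ^ n" using A(1) B(1) by auto
  obtain z where z: "z < m ^ n" "agree m n R z y" "agree m n (- R) z x"
    using ex_merge[OF assms(1)] by blast
  obtain u where u: "u < m ^ n" "agree m n R u x" "agree m n (- R) u y"
    using ex_merge[OF assms(1)] by blast
  have AB: "(A * B) $$ (x, y) = (\<Sum>w<m ^ n. A $$ (x, w) * B $$ (w, y))"
    and BA: "(B * A) $$ (x, y) = (\<Sum>w<m ^ n. B $$ (x, w) * A $$ (w, y))"
    using A(1) B(1) xy by (simp_all add: mult_mat_index_sum del: index_mult_mat(1))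
  show "(A * B) $$ (x, y) = (B * A) $$ (x, y)"
  proof (cases "agree m n (- (R \<union> R')) x y")
    case True
    have ag: "agree m n (- R) x z" "agree m n (- R) u y" "agree m n R x u" "agree m n R z y"
      "agree m n (- R') z y" "agree m n (- R') x u" "agree m n R' z x" "agree m n R' y u"
    proof -
      have zu: "digit m z j = (if j \<in> R then digit m y j else digit m x j)"
        "digit m u j = (if j \<in> R then digit m x j else digit m y j)" if "j < n" for j
        using z u that by (auto simp: agree_def)
      have "digit m x j = digit m y j" if "j < n" "j \<notin> R" "j \<notin> R'" for j
        using True that by (auto simp: agree_def)
      then show "agree m n (- R) x z" "agree m n (- R) u y" "agree m n R x u" "agree m n R z y"
          "agree m n (- R') z y" "agree m n (- R') x u" "agree m n R' z x" "agree m n R' y u"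
        using zu assms(4) by (auto simp: agree_def)
    qed
    have "w = z" if w: "w < m ^ n" "A $$ (x, w) * B $$ (w, y) \<noteq> 0" for w
    proof -
      have "A $$ (x, w) \<noteq> 0" "B $$ (w, y) \<noteq> 0" using w(2) by auto
      then have "agree m n (- R) x w" "agree m n (- R') w y"
        using A(2)[OF xy(1) w(1)] B(2)[OF w(1) xy(2)] by blast+
      then show ?thesis using merge_unique[OF w(1) z(1) _ _ z(2,3)] assms(4) by blast
    qed
    then have "A $$ (x, w) * B $$ (w, y) = 0" if "w \<in> {..<m ^ n} - {z}" for w using that by blast
    then have "(A * B) $$ (x, y) = (\<Sum>w\<in>{z}. A $$ (x, w) * B $$ (w, y))"
      unfolding AB using z(1) by (intro sum.mono_neutral_right ballI) auto
    moreover have "w = u" if w: "w < m ^ n" "B $$ (x, w) * A $$ (w, y) \<noteq> 0" for w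
    proof -
      have "A $$ (w, y) \<noteq> 0" "B $$ (x, w) \<noteq> 0" using w(2) by auto
      then have "agree m n (- R) y w" "agree m n (- R') w x"
        using A(2)[OF w(1) xy(2)] B(2)[OF xy(1) w(1)] agree_sym by blast+
      then show ?thesis using merge_unique[OF w(1) u(1) _ _ u(2,3)] assms(4) by blast
    qed
    then have "B $$ (x, w) * A $$ (w, y) = 0" if "w \<in> {..<m ^ n} - {u}" for w using that by blast
    then have "(B * A) $$ (x, y) = (\<Sum>w\<in>{u}. B $$ (x, w) * A $$ (w, y))"
      unfolding BA using u(1) by (intro sum.mono_neutral_right ballI) auto
    moreover have "A $$ (x, z) = A $$ (u, y)" "B $$ (z, y) = B $$ (x, u)"
      by (rule A(3)[OF xy(1) z(1) u(1) xy(2) ag(1,2,3,4)], rule B(3)[OF z(1) xy(2,1) u(1) ag(5,6,7,8)])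
    ultimately show ?thesis by simp
  next
    \<comment> \<open>A qudit outside both sets is changed by neither factor, so both entries
      vanish.\<close>
    case False
    then obtain j where j: "j < n" "j \<notin> R" "j \<notin> R'" "digit m x j \<noteq> digit m y j" by (auto simp: agree_def)
    have "A $$ (x, w) = 0 \<or> B $$ (w, y) = 0" if "w < m ^ n" for w
    proof (rule ccontr)
      assume "\<not> ?thesis"
      then have "agree m n (- R) x w" "agree m n (- R') w y"
        using A(2)[OF xy(1) that] B(2)[OF that xy(2)] by blast+
      then show False using j agreeD by (metis ComplI)
    qed
    moreover have "B $$ (x, w) = 0 \<or> A $$ (w, y) = 0" if "w < m ^ n" for w
    proof (rule ccontr)
      assume "\<not> ?thesis"
      then have "agree m n (- R') x w" "agree m n (- R) w y"
        using A(2)[OF that xy(2)] B(2)[OF xy(1) that] by blast+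
      then show False using j agreeD by (metis ComplI)
    qed
    ultimately show ?thesis unfolding AB BA by (simp add: sum.neutral)
  qed
qed (use assms(2,3) in \<open>auto simp: acts_only_on_def\<close>)

lemma acts_only_on_smult:
  assumes "acts_only_on m n R W"
  shows "acts_only_on m n R (c \<cdot>\<^sub>m W)"
proof -
  have W: "W \<in> carrier_mat (m ^ n) (m ^ n)" using assms by (simp add: acts_only_on_def)
  then show ?thesis using acts_only_onD[OF assms] unfolding acts_only_on_iff by auto
qed

lemma acts_only_on_adjoint:
  assumes "acts_only_on m n R W"
  shows "acts_only_on m n R (mat_adjoint W)"
proof -
  note W = acts_only_onD[OF assms]
  have "mat_adjoint W $$ (x, y) = cnj (W $$ (y, x))" if "x < m ^ n" "y < m ^ n" for x y
    using W(1) that by (simp add: mat_adjoint_index)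
  moreover have "agree m n (- R) x y \<longleftrightarrow> agree m n (- R) y x" for x y
    using agree_sym by blast
  ultimately show ?thesis
    using W(1,2) unfolding acts_only_on_iff by (auto intro!: W(3))
qed

lemma acts_only_on_weyl:
  assumes "m > 0" "vanishes_on m ({..<n} - R) a" "vanishes_on m ({..<n} - R) b"
  shows "acts_only_on m n R (weyl m n a b)"
proof -
  \<comment> \<open>Off \<open>R\<close> the exponents vanish only modulo \<open>m\<close>; genuine
    zeros make the entries visibly independent of the digits there.\<close>
  define a' b' where "a' j = (if j \<in> R then a j else 0)" and "b' j = (if j \<in> R then b j else 0)" for j
  have "weyl m n a b = weyl m n a' b'"
    using assms by (intro weyl_cong) (auto simp: vanishes_on_def a'_def b'_def)
  moreover have "acts_only_on m n R (weyl m n a' b')"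
    unfolding acts_only_on_iff
  proof (intro conjI allI impI)
    fix x y assume "x < m ^ n" "y < m ^ n" "\<not> agree m n (- R) x y"
    then show "weyl m n a' b' $$ (x, y) = 0"
      by (auto simp: weyl_index shifted_def agree_def a'_def)
  next
    fix x y x' y' assume xy: "x < m ^ n" "y < m ^ n" "x' < m ^ n" "y' < m ^ n"
      and ag: "agree m n (- R) x y" "agree m n (- R) x' y'" "agree m n R x x'" "agree m n R y y'"
    have "digit m x j = (digit m y j + a' j) mod m \<longleftrightarrow> digit m x' j = (digit m y' j + a' j) mod m" if "j < n" for j
      using ag that by (cases "j \<in> R") (auto simp: agree_def a'_def)
    then have "shifted m n a' x y \<longleftrightarrow> shifted m n a' x' y'" by (simp add: shifted_def)
    moreover have "(\<Sum>j<n. b' j * digit m y j) = (\<Sum>j<n. b' j * digit m y' j)"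
      using ag(4) by (intro sum.cong) (auto simp: b'_def agree_def)
    ultimately show "weyl m n a' b' $$ (x, y) = weyl m n a' b' $$ (x', y')"
      using xy by (simp add: weyl_index)
  qed auto
  ultimately show ?thesis by simp
qed

text \<open>The commutant of all Weyl operators off \<open>R\<close> consists of the operators on
  \<open>R\<close>: commuting with \<open>Z\<close> on a qudit off \<open>R\<close> forces
  diagonality in its digit, and commuting with shifts off \<open>R\<close> forces independence of
  the digits there.\<close>

lemma acts_only_onI_commute:
  assumes "m > 0" "W \<in> carrier_mat (m ^ n) (m ^ n)"
    and comm: "\<And>a b. \<forall>j\<in>R. a j = 0 \<and> b j = 0 \<Longrightarrow> W * weyl m n a b = weyl m n a b * W"
  shows "acts_only_on m n R W"
  unfolding acts_only_on_iff
proof (intro conjI allI impI)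
  fix x y assume xy: "x < m ^ n" "y < m ^ n" and "\<not> agree m n (- R) x y"
  then obtain j where j: "j < n" "j \<notin> R" "digit m x j \<noteq> digit m y j" by (auto simp: agree_def)
  let ?Z = "weyl m n (\<lambda>_. 0) (unit_exp j)"
  have "W * ?Z = ?Z * W" using j by (intro comm) (auto simp: unit_exp_def)
  then have "(W * ?Z) $$ (x, y) = (?Z * W) $$ (x, y)" by simp
  then have "W $$ (x, y) * omega m ^ digit m y j = omega m ^ digit m x j * W $$ (x, y)"
    using weyl_mult_left_index[OF assms(1,2), of x x y "\<lambda>_. 0" "unit_exp j"]
      weyl_mult_right_index[OF assms(1,2), of x y y "\<lambda>_. 0" "unit_exp j"] xy j(1)
    by (simp add: shifted_zero del: index_mult_mat(1))
  then have "W $$ (x, y) = 0 \<or> omega m ^ digit m x j = omega m ^ digit m y j" by (auto simp: mult.commute)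
  then show "W $$ (x, y) = 0" using j(3) by (simp add: omega_power_eq_iff[OF assms(1)])
next
  fix x y x' y' assume xy: "x < m ^ n" "y < m ^ n" "x' < m ^ n" "y' < m ^ n"
    and ag: "agree m n (- R) x y" "agree m n (- R) x' y'" "agree m n R x x'" "agree m n R y y'"
  \<comment> \<open>The shift carrying \<open>x\<close> to \<open>x'\<close>. It also carries
    \<open>y\<close> to \<open>y'\<close>, because off \<open>R\<close> the digits of
    \<open>x\<close> and \<open>y\<close> agree, as do those of \<open>x'\<close> and
    \<open>y'\<close>.\<close>
  define a where "a j = (if j \<in> R then 0 else digit m x' j + (m - digit m x j))" for j
  have sh: "shifted m n a x' x" "shifted m n a y' y"
    unfolding shifted_def
  proof (safe)
    fix j assume j: "j < n"
    have "digit m x' j = (digit m x j + a j) mod m \<and> digit m y' j = (digit m y j + a j) mod m"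
    proof (cases "j \<in> R")
      case True
      then show ?thesis using agreeD[OF ag(3) j] agreeD[OF ag(4) j] by (simp add: a_def)
    next
      case False
      then have "digit m x j = digit m y j" "digit m x' j = digit m y' j"
        using agreeD[OF ag(1) j] agreeD[OF ag(2) j] by simp_all
      then show ?thesis using False digit_shift_cancel[OF assms(1), of x j x'] by (simp add: a_def)
    qed
    then show "digit m x' j = (digit m x j + a j) mod m" "digit m y' j = (digit m y j + a j) mod m" by simp_all
  qed
  let ?X = "weyl m n a (\<lambda>_. 0)"
  have "W * ?X = ?X * W" by (intro comm) (auto simp: a_def)
  then have "(W * ?X) $$ (x', y) = (?X * W) $$ (x', y)" by simp
  then show "W $$ (x, y) = W $$ (x', y')"
    using weyl_mult_left_index[OF assms(1,2) xy(1,3,2) sh(1), of "\<lambda>_. 0"]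
      weyl_mult_right_index[OF assms(1,2) xy(3,2,4) sh(2), of "\<lambda>_. 0"]
    by (simp del: index_mult_mat(1))
qed (use assms in auto)

lemma acts_only_on_iff_commute:
  assumes "m > 0"
  shows "acts_only_on m n R W \<longleftrightarrow> W \<in> carrier_mat (m ^ n) (m ^ n) \<and>
    (\<forall>a b. (\<forall>j\<in>R. a j = 0 \<and> b j = 0) \<longrightarrow> W * weyl m n a b = weyl m n a b * W)"
proof
  assume W: "acts_only_on m n R W"
  have "acts_only_on m n (- R) (weyl m n a b)" if "\<forall>j\<in>R. a j = 0 \<and> b j = 0" for a b
    using that by (intro acts_only_on_weyl assms) (auto simp: vanishes_on_def)
  then show "W \<in> carrier_mat (m ^ n) (m ^ n) \<and>
    (\<forall>a b. (\<forall>j\<in>R. a j = 0 \<and> b j = 0) \<longrightarrow> W * weyl m n a b = weyl m n a b * W)"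
    using acts_only_onD(1)[OF W] acts_only_on_disjoint_commute[OF assms W, of "- R"] by blast
qed (use acts_only_onI_commute[OF assms] in blast)

text \<open>In terms of commutation, a larger set only leaves fewer Weyl operators to test.\<close>

lemma acts_only_on_mono:
  assumes "m > 0" "acts_only_on m n R W" "R \<inter> {..<n} \<subseteq> R'"
  shows "acts_only_on m n R' W"
proof (rule acts_only_onI_commute[OF assms(1) acts_only_onD(1)[OF assms(2)]])
  fix a b :: "nat \<Rightarrow> nat" assume "\<forall>j\<in>R'. a j = 0 \<and> b j = 0"
  then have "acts_only_on m n (- R') (weyl m n a b)"
    by (intro acts_only_on_weyl assms(1)) (auto simp: vanishes_on_def)
  then show "W * weyl m n a b = weyl m n a b * W"
    using assms(3) by (intro acts_only_on_disjoint_commute[OF assms(1,2)]) auto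
qed

lemma acts_only_on_mult:
  assumes "m > 0" "acts_only_on m n R A" "acts_only_on m n R B"
  shows "acts_only_on m n R (A * B)"
proof -
  have A: "A \<in> carrier_mat (m ^ n) (m ^ n)" and B: "B \<in> carrier_mat (m ^ n) (m ^ n)"
    using assms by (auto simp: acts_only_on_def)
  have "A * B * weyl m n a b = weyl m n a b * (A * B)" if "\<forall>j\<in>R. a j = 0 \<and> b j = 0" for a b
  proof -
    let ?w = "weyl m n a b"
    have c: "A * ?w = ?w * A" "B * ?w = ?w * B"
      using that assms by (simp_all add: acts_only_on_iff_commute)
    have "A * B * ?w = A * (?w * B)" using A B c(2) by (simp add: assoc_mult_mat[OF A B weyl_carrier])
    also have "\<dots> = A * ?w * B" by (rule assoc_mult_mat[OF A weyl_carrier B, symmetric])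
    also have "\<dots> = ?w * (A * B)" unfolding c(1) by (rule assoc_mult_mat[OF weyl_carrier A B])
    finally show ?thesis .
  qed
  then show ?thesis using A B mult_carrier_mat[OF A B] by (simp add: acts_only_on_iff_commute assms(1))
qed

section \<open>The Pauli group\<close>

text \<open>The Pauli group enlarged by all phases, in a normal form that exposes the exponents. It
  coincides with the first level of the Clifford hierarchy.\<close>

definition is_pauli :: "nat \<Rightarrow> nat \<Rightarrow> complex mat \<Rightarrow> bool" where
  "is_pauli m n g \<longleftrightarrow> (\<exists>c a b. cmod c = 1 \<and> g = c \<cdot>\<^sub>m weyl m n a b)"

lemma is_pauli_weyl: "is_pauli m n (weyl m n a b)"
  unfolding is_pauli_def by (intro exI[of _ 1]) auto

lemma is_pauli_smult: "is_pauli m n g \<Longrightarrow> cmod c = 1 \<Longrightarrow> is_pauli m n (c \<cdot>\<^sub>m g)"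
  unfolding is_pauli_def by (auto simp: smult_smult_mat norm_mult) (metis norm_mult mult_1)

lemma is_pauli_unitary: "m > 0 \<Longrightarrow> is_pauli m n g \<Longrightarrow> unitary_mat (m ^ n) g"
  unfolding is_pauli_def using unitary_mat_smult[OF weyl_unitary] by blast

lemma is_pauli_mult:
  assumes "m > 0" "is_pauli m n g" "is_pauli m n h"
  shows "is_pauli m n (g * h)"
proof -
  obtain c a b c' a' b' where *: "cmod c = 1" "g = c \<cdot>\<^sub>m weyl m n a b" "cmod c' = 1" "h = c' \<cdot>\<^sub>m weyl m n a' b'"
    using assms by (auto simp: is_pauli_def)
  have "g * h = (c * c') \<cdot>\<^sub>m (weyl m n a b * weyl m n a' b')"
    unfolding * using smult_mult_mat[OF weyl_carrier weyl_carrier]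
      smult_mult_mat(1)[OF weyl_carrier smult_carrier_mat[OF weyl_carrier]] by (simp add: smult_smult_mat)
  then show ?thesis
    using * unfolding is_pauli_def weyl_mult[OF assms(1)] smult_smult_mat
    by (metis norm_mult norm_omega_power mult_1)
qed

lemma is_pauli_adjoint:
  assumes "m > 0" "is_pauli m n g"
  shows "is_pauli m n (mat_adjoint g)"
proof -
  obtain c a b where g: "cmod c = 1" "g = c \<cdot>\<^sub>m weyl m n a b"
    using assms by (auto simp: is_pauli_def)
  \<comment> \<open>Exponents times \<open>m - 1\<close> are negatives modulo \<open>m\<close>, so
    this is the inverse up to the phase \<open>f\<close>.\<close>
  let ?w = "weyl m n (\<lambda>j. (m - 1) * a j) (\<lambda>j. (m - 1) * b j)"
  define f where "f = omega m ^ (\<Sum>j<n. b j * ((m - 1) * a j))"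
  have k: "x + (m - 1) * x = m * x" for x using assms(1) by (cases m) auto
  have "weyl m n a b * ?w = f \<cdot>\<^sub>m 1\<^sub>m (m ^ n)"
    unfolding weyl_mult[OF assms(1)] f_def k using assms(1) by (simp add: weyl_zero vanishes_on_def)
  then have "mat_adjoint (weyl m n a b) * (weyl m n a b * ?w) = f \<cdot>\<^sub>m mat_adjoint (weyl m n a b)"
    using smult_mult_mat(2)[OF mat_adjoint_carrier[OF weyl_carrier] one_carrier_mat]
    by (simp add: right_mult_one_mat[OF mat_adjoint_carrier[OF weyl_carrier]])
  then have "?w = f \<cdot>\<^sub>m mat_adjoint (weyl m n a b)"
    by (simp only: unitary_mat_cancel[OF weyl_unitary[OF assms(1)] weyl_carrier])
  then have "cnj f \<cdot>\<^sub>m ?w = (cnj f * f) \<cdot>\<^sub>m mat_adjoint (weyl m n a b)" by (simp add: smult_smult_mat)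
  moreover have "cnj f * f = 1"
    using complex_norm_square[of f] by (simp add: f_def mult.commute del: complex_cnj_power)
  ultimately have "mat_adjoint g = (cnj c * cnj f) \<cdot>\<^sub>m ?w"
    by (simp add: g(2) mat_adjoint_smult flip: smult_smult_mat)
  moreover have "cmod (cnj c * cnj f) = 1" using g by (simp add: norm_mult f_def norm_power)
  ultimately show ?thesis unfolding is_pauli_def by blast
qed

lemma pauli_X_is_pauli: "m > 0 \<Longrightarrow> is_pauli m n (pauli_X m n j)"
  by (simp add: pauli_X_eq_weyl is_pauli_weyl)

lemma pauli_Z_is_pauli: "j < n \<Longrightarrow> is_pauli m n (pauli_Z m n j)"
  by (simp add: pauli_Z_eq_weyl is_pauli_weyl)

lemma generate_is_pauli:
  assumes "m > 0" "g \<in> generate (unitary_group (m ^ n)) H" "\<And>h. h \<in> H \<Longrightarrow> is_pauli m n h"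
  shows "is_pauli m n g"
  using assms(2)
proof induction
  case one
  show ?case using is_pauli_weyl[of m n "\<lambda>_. 0" "\<lambda>_. 0"] assms(1) by (simp add: weyl_zero vanishes_on_def)
next
  case (inv h)
  then show ?case
    using assms by (simp add: inv_unitary_group[OF is_pauli_unitary] is_pauli_adjoint)
qed (use assms is_pauli_mult in auto)

lemma pauli_group_is_pauli:
  assumes "m > 0" "g \<in> pauli_group m n"
  shows "is_pauli m n g"
  using assms(2) unfolding pauli_group_def
  by (rule generate_is_pauli[OF assms(1)])
    (use assms(1) in \<open>auto intro!: is_pauli_smult is_pauli_mult pauli_X_is_pauli pauli_Z_is_pauli split: if_splits\<close>)

text \<open>The exponent pairs realised up to phase contain the unit exponents and are closed under
  addition, hence exhaust everything. The phase is left open because each product contributes a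
  power of \<open>omega m\<close>.\<close>

lemma weyl_in_pauli_group:
  assumes "m > 0"
  shows "\<exists>c. cmod c = 1 \<and> c \<cdot>\<^sub>m weyl m n a b \<in> pauli_group m n"
proof -
  define P where "P a b \<longleftrightarrow> (\<exists>c. cmod c = 1 \<and> c \<cdot>\<^sub>m weyl m n a b \<in> pauli_group m n)" for a b
  have one: "P (\<lambda>_. 0) (\<lambda>_. 0)"
    using generate.one[of "unitary_group (m ^ n)"] unfolding P_def pauli_group_def
    by (intro exI[of _ 1]) (simp add: weyl_zero vanishes_on_def assms)
  have X: "P (unit_exp j) (\<lambda>_. 0)" if "j < n" for j
    unfolding P_def pauli_group_def
    by (intro exI[of _ 1] conjI generate.incl) (use that assms in \<open>auto simp: pauli_X_eq_weyl\<close>)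
  have Z: "P (\<lambda>_. 0) (unit_exp j)" if "j < n" for j
    unfolding P_def pauli_group_def
    by (intro exI[of _ 1] conjI generate.incl) (use that assms in \<open>auto simp: pauli_Z_eq_weyl\<close>)
  have add: "P (\<lambda>j. a j + a' j) (\<lambda>j. b j + b' j)" if "P a b" "P a' b'" for a a' b b'
  proof -
    obtain c c' where *: "cmod c = 1" "cmod c' = 1"
      "c \<cdot>\<^sub>m weyl m n a b \<in> pauli_group m n" "c' \<cdot>\<^sub>m weyl m n a' b' \<in> pauli_group m n"
      using \<open>P a b\<close> \<open>P a' b'\<close> unfolding P_def by blast
    have "(c \<cdot>\<^sub>m weyl m n a b) * (c' \<cdot>\<^sub>m weyl m n a' b') \<in> pauli_group m n"
      using generate.eng[OF *(3,4)[unfolded pauli_group_def]] unfolding pauli_group_def by simp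
    also have "(c \<cdot>\<^sub>m weyl m n a b) * (c' \<cdot>\<^sub>m weyl m n a' b') = (c * c') \<cdot>\<^sub>m (weyl m n a b * weyl m n a' b')"
      using smult_mult_mat[OF weyl_carrier weyl_carrier]
        smult_mult_mat(1)[OF weyl_carrier smult_carrier_mat[OF weyl_carrier]] by (simp add: smult_smult_mat)
    finally show ?thesis
      using * unfolding P_def weyl_mult[OF assms(1)] smult_smult_mat
      by (metis norm_mult norm_omega_power mult_1)
  qed
  have rep: "P (\<lambda>j. t * a j) (\<lambda>j. t * b j)" if "P a b" for t a b
    using one add[OF that] by (induction t) auto
  have "P (\<lambda>j. if j < i then a j else 0) (\<lambda>j. if j < i then b j else 0)" if "i \<le> n" for i
    using that
  proof (induction i)
    case (Suc i)
    \<comment> \<open>The products with 0 keep the exponents in the literal shape produced by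
      \<open>rep\<close> and \<open>add\<close>.\<close>
    have "P (\<lambda>j. a i * unit_exp i j + b i * 0) (\<lambda>j. a i * 0 + b i * unit_exp i j)"
      using Suc.prems by (intro add rep X Z) auto
    moreover have "P (\<lambda>j. if j < i then a j else 0) (\<lambda>j. if j < i then b j else 0)" using Suc by simp
    ultimately have "P (\<lambda>j. (if j < i then a j else 0) + (a i * unit_exp i j + b i * 0))
      (\<lambda>j. (if j < i then b j else 0) + (a i * 0 + b i * unit_exp i j))" by (rule add[rotated])
    moreover have "(\<lambda>j. (if j < i then f j else 0) + f i * unit_exp i j) = (\<lambda>j. if j < Suc i then f j else 0)"
      for f :: "nat \<Rightarrow> nat" by (auto simp: fun_eq_iff unit_exp_def less_Suc_eq)
    ultimately show ?case by simp
  qed (simp add: one)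
  from this[OF order_refl] have "P (\<lambda>j. if j < n then a j else 0) (\<lambda>j. if j < n then b j else 0)" .
  moreover have "weyl m n (\<lambda>j. if j < n then a j else 0) (\<lambda>j. if j < n then b j else 0) = weyl m n a b"
    by (intro weyl_cong assms) auto
  ultimately show ?thesis by (simp add: P_def)
qed

lemma clifford_hierarchy_one:
  assumes "m > 0"
  shows "g \<in> clifford_hierarchy m n (Suc 0) \<longleftrightarrow> is_pauli m n g"
proof
  assume "is_pauli m n g"
  then obtain c a b where g: "cmod c = 1" "g = c \<cdot>\<^sub>m weyl m n a b" by (auto simp: is_pauli_def)
  obtain d where d: "cmod d = 1" "d \<cdot>\<^sub>m weyl m n a b \<in> pauli_group m n"
    using weyl_in_pauli_group[OF assms] by blast
  then have "d \<noteq> 0" by auto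
  then have "g = (c * inverse d) \<cdot>\<^sub>m (d \<cdot>\<^sub>m weyl m n a b)" "cmod (c * inverse d) = 1"
    using g d(1) by (auto simp: smult_smult_mat norm_mult norm_inverse)
  then show "g \<in> clifford_hierarchy m n (Suc 0)" using d(2) by auto
qed (use assms pauli_group_is_pauli is_pauli_smult in auto)

section \<open>Completeness of the Weyl operators\<close>

text \<open>Orthogonality of the characters of the integers modulo \<open>m\<close>: for distinct
  \<open>u\<close> and \<open>v\<close> this is a geometric series whose ratio is an
  \<open>m\<close>-th root of unity other than 1.\<close>

lemma char_sum:
  assumes "u < m" "v < m"
  shows "(\<Sum>t<m. cnj (omega m ^ (t * u)) * omega m ^ (t * v)) = (if u = v then of_nat m else 0)"
proof -
  have m: "m > 0" using assms by simp
  define q where "q = cnj (omega m ^ u) * omega m ^ v"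
  have norm: "omega m ^ u * cnj (omega m ^ u) = 1"
    using complex_norm_square[of "omega m ^ u"] by (simp del: complex_cnj_power)
  have "(\<Sum>t<m. cnj (omega m ^ (t * u)) * omega m ^ (t * v)) = (\<Sum>t<m. q ^ t)"
    by (intro sum.cong) (simp_all add: q_def power_mult_distrib power_mult power_commutes mult.commute
        flip: power_mult)
  also have "\<dots> = (if u = v then of_nat m else 0)"
  proof (cases "u = v")
    case True
    then have "q = 1" using norm by (simp add: q_def mult.commute)
    then show ?thesis using True by simp
  next
    case False
    have "q \<noteq> 1"
    proof
      assume "q = 1"
      then have "omega m ^ u * cnj (omega m ^ u) * omega m ^ v = omega m ^ u"
        by (simp add: q_def mult.assoc del: complex_cnj_power)
      then have "omega m ^ v = omega m ^ u" unfolding norm by simp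
      then show False using False assms by (simp add: omega_power_eq_iff[OF m])
    qed
    moreover have "q ^ m = 1"
      unfolding q_def power_mult_distrib complex_cnj_power[symmetric] power_mult[symmetric]
        mult.commute[of _ m] power_mult omega_power_m[OF m] by simp
    ultimately show ?thesis using False by (simp add: geometric_sum)
  qed
  finally show ?thesis .
qed

text \<open>For fixed \<open>a\<close>, the traces against \<open>weyl m k a b\<close> are the
  Fourier transform in \<open>b\<close> of the entries of \<open>A\<close> along one shifted
  diagonal. Orthogonality of characters, one factor per qudit, recovers a single entry.\<close>

lemma fourier_inversion:
  assumes m: "m > 0" and A: "A \<in> carrier_mat (m ^ k) (m ^ k)"
    and x: "x < m ^ k" and y: "y < m ^ k" and sh: "shifted m k a x y"
  shows "of_nat m ^ k * A $$ (y, x) = (\<Sum>b\<in>{..<k} \<rightarrow>\<^sub>E {..<m}.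
    cnj (omega m ^ (\<Sum>j<k. b j * digit m y j)) * mtrace (A * weyl m k a b))"
proof -
  obtain s where s: "\<And>z. s z < m ^ k \<and> shifted m k a (s z) z"
    using ex1_shifted[OF m] by metis
  have sy: "s y = x" using s[of y] x sh ex1_shifted[OF m] by blast
  have tr: "mtrace (A * weyl m k a b) = (\<Sum>z<m ^ k. A $$ (z, s z) * omega m ^ (\<Sum>j<k. b j * digit m z j))" for b
    unfolding mtrace_def
    by (rule sum.cong) (use A s weyl_mult_right_index[OF m A] in auto)
  have prod: "(\<Sum>b\<in>{..<k} \<rightarrow>\<^sub>E {..<m}.
      cnj (omega m ^ (\<Sum>j<k. b j * digit m y j)) * omega m ^ (\<Sum>j<k. b j * digit m z j)) =
      (if z = y then of_nat m ^ k else 0)" if z: "z < m ^ k" for z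
  proof -
    have "(\<Sum>b\<in>{..<k} \<rightarrow>\<^sub>E {..<m}.
      cnj (omega m ^ (\<Sum>j<k. b j * digit m y j)) * omega m ^ (\<Sum>j<k. b j * digit m z j)) =
      (\<Sum>b\<in>{..<k} \<rightarrow>\<^sub>E {..<m}. \<Prod>j<k. cnj (omega m ^ (b j * digit m y j)) * omega m ^ (b j * digit m z j))"
      by (simp add: power_sum prod.distrib)
    also have "\<dots> = (\<Prod>j<k. \<Sum>t<m. cnj (omega m ^ (t * digit m y j)) * omega m ^ (t * digit m z j))"
      by (rule prod_sum_PiE[symmetric]) auto
    also have "\<dots> = (\<Prod>j<k. if digit m y j = digit m z j then of_nat m else 0)"
      by (intro prod.cong refl char_sum digit_less m)
    also have "\<dots> = (if z = y then of_nat m ^ k else 0)"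
    proof (cases "z = y")
      case False
      then obtain j where "j < k" "digit m y j \<noteq> digit m z j" using digit_eqI[OF z y] by metis
      then show ?thesis using False by auto
    qed simp
    finally show ?thesis .
  qed
  have "(\<Sum>b\<in>{..<k} \<rightarrow>\<^sub>E {..<m}.
      cnj (omega m ^ (\<Sum>j<k. b j * digit m y j)) * mtrace (A * weyl m k a b)) =
    (\<Sum>b\<in>{..<k} \<rightarrow>\<^sub>E {..<m}. \<Sum>z<m ^ k. A $$ (z, s z) *
      (cnj (omega m ^ (\<Sum>j<k. b j * digit m y j)) * omega m ^ (\<Sum>j<k. b j * digit m z j)))"
    unfolding tr sum_distrib_left by (simp add: mult.left_commute del: complex_cnj_power)
  also have "\<dots> = (\<Sum>z<m ^ k. A $$ (z, s z) * (\<Sum>b\<in>{..<k} \<rightarrow>\<^sub>E {..<m}.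
      cnj (omega m ^ (\<Sum>j<k. b j * digit m y j)) * omega m ^ (\<Sum>j<k. b j * digit m z j)))"
    by (subst sum.swap) (simp only: sum_distrib_left)
  also have "\<dots> = (\<Sum>z<m ^ k. A $$ (z, s z) * (if z = y then of_nat m ^ k else 0))"
    by (intro sum.cong refl) (simp only: prod lessThan_iff)
  also have "\<dots> = (\<Sum>z\<in>{y}. A $$ (z, s z) * (if z = y then of_nat m ^ k else 0))"
    using y by (intro sum.mono_neutral_right) auto
  finally show ?thesis by (simp add: sy)
qed

lemma ex_shift_exponent:
  assumes "m > 0"
  shows "\<exists>a. shifted m k a x y"
  by (intro exI[of _ "\<lambda>j. digit m x j + (m - digit m y j)"])
    (simp add: shifted_def digit_shift_cancel[OF assms])

text \<open>By Fourier inversion the traces against Weyl operators determine a matrix, and here only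
  the trace against the identity can survive. Dividing it by the dimension gives the scalar.\<close>

lemma scalar_if_mtrace_zero:
  assumes m: "m > 0" and A: "A \<in> carrier_mat (m ^ k) (m ^ k)"
    and tr: "\<And>a b. \<not> (vanishes_on m {..<k} a \<and> vanishes_on m {..<k} b) \<Longrightarrow> mtrace (A * weyl m k a b) = 0"
  shows "\<exists>c. A = c \<cdot>\<^sub>m 1\<^sub>m (m ^ k)"
proof -
  define t where "t = mtrace A / of_nat m ^ k"
  have pos: "of_nat m ^ k \<noteq> (0 :: complex)" using m by simp
  have "A $$ (y, x) = (t \<cdot>\<^sub>m 1\<^sub>m (m ^ k)) $$ (y, x)" if xy: "x < m ^ k" "y < m ^ k" for x y
  proof -
    obtain a where a: "shifted m k a x y" using ex_shift_exponent[OF m] by blast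
    have inv: "of_nat m ^ k * A $$ (y, x) = (\<Sum>b\<in>{..<k} \<rightarrow>\<^sub>E {..<m}.
      cnj (omega m ^ (\<Sum>j<k. b j * digit m y j)) * mtrace (A * weyl m k a b))"
      by (rule fourier_inversion[OF m A xy a])
    show ?thesis
    proof (cases "x = y")
      case False
      \<comment> \<open>Off the diagonal the shift itself is non-trivial, so every summand vanishes
        whatever \<open>b\<close> is.\<close>
      have "\<not> vanishes_on m {..<k} a"
      proof
        assume v: "vanishes_on m {..<k} a"
        have "digit m x j = digit m y j" if "j < k" for j
        proof -
          have "digit m x j = (digit m y j + a j mod m) mod m"
            using a that by (simp add: shifted_def mod_add_right_eq)
          then show ?thesis using v that by (simp add: vanishes_on_def)
        qed
        then show False using digit_eqI[OF xy] False by blast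
      qed
      then have "of_nat m ^ k * A $$ (y, x) = 0" unfolding inv by (simp add: tr)
      then have "A $$ (y, x) = 0" using pos by (simp only: mult_eq_0_iff) blast
      then show ?thesis using False xy by simp
    next
      case True
      have a0: "vanishes_on m {..<k} a"
        unfolding vanishes_on_def
      proof
        fix j assume "j \<in> {..<k}"
        then have "(digit m y j + a j) mod m = digit m y j mod m"
          using a True by (simp add: shifted_def)
        then have "m dvd digit m y j + a j - digit m y j"
          by (subst (asm) mod_eq_dvd_iff_nat) simp_all
        then show "a j mod m = 0" by simp
      qed
      \<comment> \<open>The zero tuple must be extensional to lie in the index set; it is the only
        trivial exponent there.\<close>
      define b0 where "b0 = (\<lambda>j\<in>{..<k}. 0 :: nat)"
      have b0: "vanishes_on m {..<k} b0" "b0 \<in> {..<k} \<rightarrow>\<^sub>E {..<m}"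
        using m by (auto simp: b0_def vanishes_on_def)
      have "\<not> vanishes_on m {..<k} b" if "b \<in> ({..<k} \<rightarrow>\<^sub>E {..<m}) - {b0}" for b
      proof
        assume v: "vanishes_on m {..<k} b"
        have "b j = b0 j" for j
        proof (cases "j < k")
          case True
          then have "b j < m" "b j mod m = 0" using that v by (auto simp: vanishes_on_def)
          then show ?thesis using True by (simp add: b0_def)
        next
          case False
          then show ?thesis using that by (auto simp: b0_def PiE_def extensional_def)
        qed
        then show False using that by auto
      qed
      then have "of_nat m ^ k * A $$ (y, x) = (\<Sum>b\<in>{b0}.
        cnj (omega m ^ (\<Sum>j<k. b j * digit m y j)) * mtrace (A * weyl m k a b))"
        unfolding inv using b0(2) by (intro sum.mono_neutral_right) (auto simp: tr intro: finite_PiE)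
      also have "\<dots> = mtrace A"
      proof -
        have 1: "A * weyl m k a b0 = A"
          unfolding weyl_zero[OF m a0 b0(1)] by (rule right_mult_one_mat[OF A])
        have 2: "omega m ^ (\<Sum>j<k. b0 j * digit m y j) = 1" by (simp add: b0_def)
        show ?thesis by (simp add: 1 2 del: complex_cnj_power)
      qed
      finally show ?thesis using pos True xy by (simp add: t_def field_simps)
    qed
  qed
  then have "A = t \<cdot>\<^sub>m 1\<^sub>m (m ^ k)" using A by (intro eq_matI) auto
  then show ?thesis ..
qed

lemma zero_if_mtrace_zero:
  assumes m: "m > 0" and A: "A \<in> carrier_mat (m ^ k) (m ^ k)"
    and tr: "\<And>a b. mtrace (A * weyl m k a b) = 0"
  shows "A = 0\<^sub>m (m ^ k) (m ^ k)"
proof (rule eq_matI)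
  fix y x assume "y < dim_row (0\<^sub>m (m ^ k) (m ^ k) :: complex mat)" "x < dim_col (0\<^sub>m (m ^ k) (m ^ k) :: complex mat)"
  then have xy: "x < m ^ k" "y < m ^ k" by auto
  obtain a where a: "shifted m k a x y" using ex_shift_exponent[OF m] by blast
  have "of_nat m ^ k * A $$ (y, x) = 0" unfolding fourier_inversion[OF m A xy a] by (simp add: tr)
  then show "A $$ (y, x) = 0\<^sub>m (m ^ k) (m ^ k) $$ (y, x)" using m xy by simp
qed (use A in auto)

lemma acts_only_on_empty_scalar:
  assumes "m > 0" "acts_only_on m n {} W"
  shows "\<exists>c. W = c \<cdot>\<^sub>m 1\<^sub>m (m ^ n)"
proof -
  note W = acts_only_onD[OF assms(2)]
  have pos: "0 < m ^ n" using assms(1) by simp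
  have "W $$ (x, y) = (W $$ (0, 0) \<cdot>\<^sub>m 1\<^sub>m (m ^ n)) $$ (x, y)" if xy: "x < m ^ n" "y < m ^ n" for x y
  proof (cases "x = y")
    case True
    have "W $$ (x, x) = W $$ (0, 0)"
      by (rule W(3)[OF xy(1) xy(1) pos pos]) (auto simp: agree_def)
    then show ?thesis using True xy by simp
  next
    case False
    then have "\<not> agree m n (- {}) x y" using digit_eqI[OF xy] by (auto simp: agree_def)
    then show ?thesis using W(2)[OF xy] xy False by simp
  qed
  then have "W = W $$ (0, 0) \<cdot>\<^sub>m 1\<^sub>m (m ^ n)" using W(1) by (intro eq_matI) auto
  then show ?thesis ..
qed

lemma unitary_scalar_norm:
  assumes "unitary_mat d (c \<cdot>\<^sub>m 1\<^sub>m d)" "d > 0"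
  shows "cmod c = 1"
proof -
  have "mat_adjoint (c \<cdot>\<^sub>m 1\<^sub>m d) * (c \<cdot>\<^sub>m 1\<^sub>m d) = (cnj c * c) \<cdot>\<^sub>m 1\<^sub>m d"
    by (simp add: mat_adjoint_smult smult_mult_mat[of _ d d _ d] smult_smult_mat mult.commute)
  then have "(cnj c * c) \<cdot>\<^sub>m 1\<^sub>m d = 1 \<cdot>\<^sub>m (1\<^sub>m d :: complex mat)"
    using unitary_matD(2)[OF assms(1)] by simp
  then have "cnj c * c = 1" by (rule unitary_smult_inj[OF unitary_mat_one assms(2)])
  then have "complex_of_real ((cmod c)\<^sup>2) = complex_of_real 1"
    using complex_norm_square[of c] by (simp add: mult.commute)
  then have "(cmod c)\<^sup>2 = 1" using of_real_eq_iff by blast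
  then show ?thesis by (simp add: power2_eq_1_iff) (metis norm_ge_zero not_one_le_zero neg_0_le_iff_le)
qed

lemma mtrace_conj:
  assumes U: "unitary_mat d U" and A: "A \<in> carrier_mat d d"
  shows "mtrace (mat_adjoint U * (A * U)) = mtrace A"
proof -
  note U = unitary_matD[OF U] mat_adjoint_carrier[OF unitary_matD(1)[OF U]]
  have "mtrace (mat_adjoint U * (A * U)) = mtrace (A * U * mat_adjoint U)"
    by (rule mtrace_comm[OF U(4) mult_carrier_mat[OF A U(1)]])
  also have "A * U * mat_adjoint U = A"
    by (simp only: assoc_mult_mat[OF A U(1) U(4)] U(3) right_mult_one_mat[OF A])
  finally show ?thesis .
qed

text \<open>Some Weyl operator \<open>Q\<close> has nonzero trace against \<open>U\<close>. The
  product \<open>N\<close> still commutes with each Weyl operator up to a scalar, and since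
  conjugation preserves its nonzero trace, that scalar is 1. So \<open>N\<close> commutes with all
  of them and is itself a scalar.\<close>

lemma is_pauli_if_commutes_up_to_scalar:
  assumes m: "m > 0" and U: "unitary_mat (m ^ k) U"
    and comm: "\<And>a b. \<exists>c. U * weyl m k a b = c \<cdot>\<^sub>m (weyl m k a b * U)"
  shows "is_pauli m k U"
proof -
  have Uc: "U \<in> carrier_mat (m ^ k) (m ^ k)" using U by (simp add: unitary_mat_def)
  have "U \<noteq> 0\<^sub>m (m ^ k) (m ^ k)"
  proof
    assume "U = 0\<^sub>m (m ^ k) (m ^ k)"
    then have "(0\<^sub>m (m ^ k) (m ^ k) :: complex mat) = 1\<^sub>m (m ^ k)" using unitary_matD(2)[OF U] Uc
      by (metis mat_adjoint_carrier right_mult_zero_mat)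
    then have "(0\<^sub>m (m ^ k) (m ^ k) :: complex mat) $$ (0, 0) = 1\<^sub>m (m ^ k) $$ (0, 0)" by simp
    then show False using m by simp
  qed
  then obtain a b where ab: "mtrace (U * weyl m k a b) \<noteq> 0"
    using zero_if_mtrace_zero[OF m Uc] by blast
  define Q where "Q = weyl m k a b"
  define N where "N = U * Q"
  have Q: "unitary_mat (m ^ k) Q" unfolding Q_def by (rule weyl_unitary[OF m])
  note Qc = unitary_matD(1)[OF Q]
  have N: "unitary_mat (m ^ k) N" unfolding N_def by (rule unitary_mat_mult[OF U Q])
  note Nc = unitary_matD(1)[OF N]
  have "N * weyl m k a' b' = weyl m k a' b' * N" for a' b'
  proof -
    let ?w = "weyl m k a' b'"
    have w: "unitary_mat (m ^ k) ?w" by (rule weyl_unitary[OF m])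
    note wc = unitary_matD(1)[OF w]
    define f where "f = omega m ^ (\<Sum>j<k. b j * a' j) / omega m ^ (\<Sum>j<k. b' j * a j)"
    obtain c where c: "U * ?w = c \<cdot>\<^sub>m (?w * U)" using comm by blast
    have "omega m ^ (\<Sum>j<k. b' j * a j) \<cdot>\<^sub>m (Q * ?w) = omega m ^ (\<Sum>j<k. b' j * a j) \<cdot>\<^sub>m (f \<cdot>\<^sub>m (?w * Q))"
      unfolding Q_def f_def weyl_exchange[OF m, where n = k and a = a and b = b and a' = a' and b' = b'] smult_smult_mat by simp
    then have f: "Q * ?w = f \<cdot>\<^sub>m (?w * Q)" by (rule smult_mat_cancel[rotated]) simp
    have "N * ?w = U * (Q * ?w)" unfolding N_def by (rule assoc_mult_mat[OF Uc Qc wc])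
    also have "\<dots> = f \<cdot>\<^sub>m (U * ?w * Q)"
      unfolding f smult_mult_mat(2)[OF Uc mult_carrier_mat[OF wc Qc]] assoc_mult_mat[OF Uc wc Qc] ..
    also have "\<dots> = (f * c) \<cdot>\<^sub>m (?w * N)"
      unfolding c smult_mult_mat(1)[OF mult_carrier_mat[OF wc Uc] Qc] smult_smult_mat
        assoc_mult_mat[OF wc Uc Qc] N_def ..
    finally have Nw: "N * ?w = (f * c) \<cdot>\<^sub>m (?w * N)" .
    have "mtrace N = mtrace (mat_adjoint ?w * (N * ?w))" by (rule mtrace_conj[OF w Nc, symmetric])
    also have "mat_adjoint ?w * (N * ?w) = (f * c) \<cdot>\<^sub>m N"
      unfolding Nw smult_mult_mat(2)[OF mat_adjoint_carrier[OF wc] mult_carrier_mat[OF wc Nc]]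
        unitary_mat_cancel(1)[OF w Nc] ..
    also have "mtrace \<dots> = f * c * mtrace N" by (rule mtrace_smult[OF Nc])
    finally have "f * c = 1" using ab by (simp add: N_def Q_def)
    then show ?thesis using Nw by simp
  qed
  then have "acts_only_on m k {} N" by (intro acts_only_onI_commute m Nc)
  then obtain c where c: "N = c \<cdot>\<^sub>m 1\<^sub>m (m ^ k)" using acts_only_on_empty_scalar[OF m] by blast
  then have "cmod c = 1" using N m unitary_scalar_norm by simp
  moreover have "U = c \<cdot>\<^sub>m mat_adjoint Q"
  proof -
    have "U = N * mat_adjoint Q"
      unfolding N_def using assoc_mult_mat[OF Uc Qc mat_adjoint_carrier[OF Qc]] unitary_matD(3)[OF Q]
        right_mult_one_mat[OF Uc] by simp
    then show ?thesis
      unfolding c smult_mult_mat(1)[OF one_carrier_mat mat_adjoint_carrier[OF Qc]]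
        left_mult_one_mat[OF mat_adjoint_carrier[OF Qc]] .
  qed
  ultimately show ?thesis
    using is_pauli_smult[OF is_pauli_adjoint[OF m is_pauli_weyl]] by (simp add: Q_def)
qed

section \<open>Paulis on a partitioned code\<close>

locale partitioned_code =
  fixes m :: nat and C :: qudit_code
  assumes m2: "m \<ge> 2" and code: "stabilizer_code m C"
begin

abbreviation n where "n \<equiv> num_qudits C"
abbreviation k where "k \<equiv> num_logical C"
abbreviation S where "S \<equiv> stabilizer m C"
abbreviation d where "d \<equiv> m ^ num_qudits C"
abbreviation "acts T W \<equiv> acts_only_on m (num_qudits C) (\<Union>T) W"

lemma m_pos: "m > 0"
  using m2 by simp

lemma code_facts:
  shows k_pos: "k \<ge> 1" and parts_partition: "partition_on {..<n} (parts C)"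
    and gens_pauli: "set (stab_gens C) \<subseteq> pauli_group m n"
    and card_S: "card S = m ^ (n - k)"
    and logical_pauli_gens: "i < k \<Longrightarrow> logical_X C i \<in> pauli_group m n" "i < k \<Longrightarrow> logical_Z C i \<in> pauli_group m n"
    and logical_commute: "i < k \<Longrightarrow> s \<in> S \<Longrightarrow> logical_X C i * s = s * logical_X C i"
      "i < k \<Longrightarrow> s \<in> S \<Longrightarrow> logical_Z C i * s = s * logical_Z C i"
  using code unfolding stabilizer_code_def Let_def by blast+

lemma finite_parts: "finite (parts C)"
  using finite_elements[OF _ parts_partition] by simp

lemma Union_parts: "\<Union>(parts C) = {..<n}"
  using partition_onD1[OF parts_partition] by simp

lemma parts_eqI: "B \<in> parts C \<Longrightarrow> B' \<in> parts C \<Longrightarrow> j \<in> B \<Longrightarrow> j \<in> B' \<Longrightarrow> B = B'"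
  using partition_onD2[OF parts_partition] by (auto dest: disjointD)

lemma supp_subset: "supp m C g \<subseteq> parts C"
  by (auto simp: supp_def)

lemma finite_supp: "finite (supp m C g)"
  using finite_subset[OF supp_subset finite_parts] .

text \<open>An operator trivial on \<open>B\<close> commutes with \<open>X\<close> and
  \<open>Z\<close> on every qudit of \<open>B\<close>, which kills the exponents there. The support
  of a Pauli can therefore be read off its exponents.\<close>

lemma vanishes_on_part_iff:
  assumes "B \<in> parts C" "c \<noteq> 0"
  shows "B \<notin> supp m C (c \<cdot>\<^sub>m weyl m n a b) \<longleftrightarrow> vanishes_on m B a \<and> vanishes_on m B b"
proof
  assume "vanishes_on m B a \<and> vanishes_on m B b"
  then have "acts_only_on m n ({..<n} - B) (weyl m n a b)"
    by (intro acts_only_on_weyl m_pos) (auto simp: vanishes_on_def)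
  then show "B \<notin> supp m C (c \<cdot>\<^sub>m weyl m n a b)"
    using acts_only_on_smult by (simp add: supp_def)
next
  assume "B \<notin> supp m C (c \<cdot>\<^sub>m weyl m n a b)"
  then have "acts_only_on m n ({..<n} - B) (c \<cdot>\<^sub>m weyl m n a b)"
    using assms by (simp add: supp_def)
  from acts_only_on_smult[OF this, of "inverse c"]
  have w: "acts_only_on m n ({..<n} - B) (weyl m n a b)"
    unfolding smult_smult_mat left_inverse[OF assms(2)] by simp
  have "a j mod m = 0 \<and> b j mod m = 0" if j: "j \<in> B" for j
  proof -
    have "j < n" using j assms(1) Union_parts by auto
    have "acts_only_on m n {j} (weyl m n (unit_exp j) (\<lambda>_. 0))" "acts_only_on m n {j} (weyl m n (\<lambda>_. 0) (unit_exp j))"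
      by (intro acts_only_on_weyl m_pos; auto simp: vanishes_on_def unit_exp_def)+
    then show ?thesis
      using j by (intro weyl_exponent_zero[OF m_pos \<open>j < n\<close>] acts_only_on_disjoint_commute[OF m_pos w]) auto
  qed
  then show "vanishes_on m B a \<and> vanishes_on m B b" by (auto simp: vanishes_on_def)
qed

text \<open>Separates the action on \<open>T\<close> from the action elsewhere. The first factor
  lives only on the overlap of \<open>T\<close> with the support, the quantity that disjointness
  controls.\<close>

lemma pauli_split:
  assumes "is_pauli m n g" "T \<subseteq> parts C"
  obtains g1 g2 where "is_pauli m n g1" "is_pauli m n g2" "g = g1 * g2"
    "acts (T \<inter> supp m C g) g1" "acts_only_on m n (- \<Union>T) g2"
proof -
  obtain c a b where g: "cmod c = 1" "g = c \<cdot>\<^sub>m weyl m n a b" using assms(1) by (auto simp: is_pauli_def)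
  have c0: "c \<noteq> 0" using g(1) by auto
  define cut where "cut f j = (if j \<in> \<Union>T then f j else 0)" for f :: "nat \<Rightarrow> nat" and j
  define rest where "rest f j = (if j \<in> \<Union>T then 0 else f j)" for f :: "nat \<Rightarrow> nat" and j
  let ?g1 = "c \<cdot>\<^sub>m weyl m n (cut a) (cut b)" and ?g2 = "weyl m n (rest a) (rest b)"
  \<comment> \<open>No qudit carries both a cut and a remaining exponent, so the factorisation has
    no phase.\<close>
  have "omega m ^ (\<Sum>j<n. cut b j * rest a j) = 1"
    using sum.neutral[of "{..<n}" "\<lambda>j. cut b j * rest a j"] by (simp add: cut_def rest_def)
  moreover have "(\<lambda>j. cut f j + rest f j) = f" for f by (auto simp: cut_def rest_def)
  ultimately have "weyl m n (cut a) (cut b) * ?g2 = weyl m n a b"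
    unfolding weyl_mult[OF m_pos] by simp
  then have "g = ?g1 * ?g2" unfolding g(2) smult_mult_mat(1)[OF weyl_carrier weyl_carrier] by simp
  moreover have "acts (T \<inter> supp m C g) (weyl m n (cut a) (cut b))"
  proof (rule acts_only_on_weyl[OF m_pos])
    have *: "cut a j mod m = 0 \<and> cut b j mod m = 0" if j: "j \<in> {..<n} - \<Union>(T \<inter> supp m C g)" for j
    proof (cases "j \<in> \<Union>T")
      case True
      then obtain B where "B \<in> T" "j \<in> B" by blast
      then have "B \<in> parts C" "B \<notin> supp m C g" using assms(2) j by auto
      then show ?thesis using vanishes_on_part_iff[OF _ c0] \<open>j \<in> B\<close> True unfolding g(2) vanishes_on_def cut_def by simp
    qed (simp add: cut_def)
    then show "vanishes_on m ({..<n} - \<Union>(T \<inter> supp m C g)) (cut a)"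
      "vanishes_on m ({..<n} - \<Union>(T \<inter> supp m C g)) (cut b)" by (simp_all add: vanishes_on_def)
  qed
  then have "acts (T \<inter> supp m C g) ?g1" by (rule acts_only_on_smult)
  moreover have "acts_only_on m n (- \<Union>T) ?g2"
    by (rule acts_only_on_weyl[OF m_pos]) (auto simp: vanishes_on_def rest_def)
  moreover have "is_pauli m n ?g1" using is_pauli_smult[OF is_pauli_weyl g(1)] .
  ultimately show thesis using that is_pauli_weyl by blast
qed

text \<open>An \<open>X\<^sub>j\<close> or \<open>Z\<^sub>j\<close> on a qudit \<open>j\<close> outside \<open>T\<close> where \<open>g\<close> acts non-trivially commutes with
  \<open>W\<close> but commutes with \<open>g\<close> only up to a phase other than 1, which forces the trace to vanish.\<close>

lemma mtrace_pauli_zero: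
  assumes "is_pauli m n g" "T \<subseteq> parts C" "acts T W" "\<not> supp m C g \<subseteq> T"
  shows "mtrace (W * g) = 0"
proof -
  obtain c a b where g: "cmod c = 1" "g = c \<cdot>\<^sub>m weyl m n a b" using assms(1) by (auto simp: is_pauli_def)
  have c0: "c \<noteq> 0" using g(1) by auto
  have Wc: "W \<in> carrier_mat d d" using assms(3) by (rule acts_only_onD)
  obtain B where B: "B \<in> supp m C g" "B \<notin> T" using assms(4) by blast
  then have Bp: "B \<in> parts C" using supp_subset by blast
  then obtain j where j: "j \<in> B" "\<not> (a j mod m = 0 \<and> b j mod m = 0)"
    using vanishes_on_part_iff[OF Bp c0, of a b] B(1) unfolding g(2) vanishes_on_def by blast
  have jn: "j < n" using j(1) Bp Union_parts by auto
  have jT: "j \<notin> \<Union>T" using parts_eqI[OF Bp] j(1) B(2) assms(2) by blast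
  obtain a' b' where r: "a' = unit_exp j \<and> b' = (\<lambda>_. 0) \<or> a' = (\<lambda>_. 0) \<and> b' = unit_exp j"
    and nc: "weyl m n a b * weyl m n a' b' \<noteq> weyl m n a' b' * weyl m n a b"
    using weyl_exponent_zero[OF m_pos jn] j(2) by metis
  define r where "r = weyl m n a' b'"
  define w where "w = weyl m n a b"
  have runi: "unitary_mat d r" unfolding r_def by (rule weyl_unitary[OF m_pos])
  note rc = unitary_matD(1)[OF runi]
  have wc: "w \<in> carrier_mat d d" by (simp add: w_def)
  have "acts_only_on m n {j} r" unfolding r_def
    using r by (intro acts_only_on_weyl m_pos) (auto simp: vanishes_on_def unit_exp_def split: if_splits)
  then have Wr: "W * r = r * W"
    using jT by (intro acts_only_on_disjoint_commute[OF m_pos assms(3)]) auto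
  define f where "f = omega m ^ (\<Sum>j<n. b j * a' j) / omega m ^ (\<Sum>j<n. b' j * a j)"
  have "omega m ^ (\<Sum>j<n. b' j * a j) \<cdot>\<^sub>m (w * r) = omega m ^ (\<Sum>j<n. b' j * a j) \<cdot>\<^sub>m (f \<cdot>\<^sub>m (r * w))"
    unfolding w_def r_def f_def weyl_exchange[OF m_pos, where n = n and a = a and b = b and a' = a' and b' = b']
      smult_smult_mat by simp
  then have f: "w * r = f \<cdot>\<^sub>m (r * w)" by (rule smult_mat_cancel[rotated]) simp
  have f1: "f \<noteq> 1"
  proof
    assume "f = 1"
    then show False using f nc by (simp add: w_def r_def)
  qed
  have Ww: "W * w \<in> carrier_mat d d" using mult_carrier_mat[OF Wc wc] .
  have "W * w * r = f \<cdot>\<^sub>m (r * (W * w))"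
  proof -
    have "W * w * r = f \<cdot>\<^sub>m (W * (r * w))"
      unfolding assoc_mult_mat[OF Wc wc rc] f by (rule smult_mult_mat(2)[OF Wc mult_carrier_mat[OF rc wc]])
    also have "W * (r * w) = r * (W * w)"
      unfolding assoc_mult_mat[OF Wc rc wc, symmetric] Wr by (rule assoc_mult_mat[OF rc Wc wc])
    finally show ?thesis .
  qed
  then have "mtrace (W * w) = mtrace (mat_adjoint r * (f \<cdot>\<^sub>m (r * (W * w))))"
    using mtrace_conj[OF runi Ww] by simp
  also have "\<dots> = f * mtrace (W * w)"
    unfolding smult_mult_mat(2)[OF mat_adjoint_carrier[OF rc] mult_carrier_mat[OF rc Ww]]
      unitary_mat_cancel(1)[OF runi Ww] by (rule mtrace_smult[OF Ww])
  finally have "mtrace (W * w) = 0" using f1 by simp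
  then show ?thesis
    unfolding g(2) w_def[symmetric] smult_mult_mat(2)[OF Wc wc] mtrace_smult[OF Ww] by simp
qed

section \<open>The stabilizer and its cosets\<close>

lemma gens_is_pauli: "s \<in> set (stab_gens C) \<Longrightarrow> is_pauli m n s"
  using gens_pauli pauli_group_is_pauli[OF m_pos] by blast

lemma S_is_pauli: "s \<in> S \<Longrightarrow> is_pauli m n s"
  unfolding stabilizer_def by (rule generate_is_pauli[OF m_pos]) (auto simp: gens_is_pauli)

lemma S_unitary: "s \<in> S \<Longrightarrow> unitary_mat d s"
  using S_is_pauli is_pauli_unitary[OF m_pos] by blast

lemma S_carrier: "s \<in> S \<Longrightarrow> s \<in> carrier_mat d d"
  using S_unitary by (simp add: unitary_mat_def)

lemma S_mult: "s \<in> S \<Longrightarrow> t \<in> S \<Longrightarrow> s * t \<in> S"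
  unfolding stabilizer_def using generate.eng[of s "unitary_group d"] by simp

lemma S_one: "1\<^sub>m d \<in> S"
  unfolding stabilizer_def using generate.one[of "unitary_group d"] by simp

lemma S_adjoint:
  assumes "s \<in> S"
  shows "mat_adjoint s \<in> S"
proof -
  have "set (stab_gens C) \<subseteq> carrier (unitary_group d)"
    using gens_is_pauli is_pauli_unitary[OF m_pos] by auto
  from group.generate_m_inv_closed[OF group_unitary_group this, of s]
  show ?thesis using assms S_unitary[OF assms] by (simp add: stabilizer_def inv_unitary_group)
qed

lemma finite_S: "finite S"
  using card_S m_pos by (metis card.infinite power_not_zero not_gr_zero)

lemma finite_nontrivial: "finite (nontrivial_logical_paulis m C)"
proof -
  have "nontrivial_logical_paulis m C \<subseteq>
      (\<lambda>a. S #>\<^bsub>unitary_group d\<^esub> logical_pauli m C a) ` ({..<2 * k} \<rightarrow>\<^sub>E {..<m})"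
    by (auto simp: nontrivial_logical_paulis_def)
  then show ?thesis by (rule finite_subset) (auto intro!: finite_PiE)
qed

lemma coset_eq: "S #>\<^bsub>unitary_group d\<^esub> L = (\<lambda>s. s * L) ` S"
  by (auto simp: r_coset_def)

lemma coset_finite_nonempty:
  assumes "G \<in> nontrivial_logical_paulis m C"
  shows "finite G" "G \<noteq> {}"
  using assms finite_S S_one by (auto simp: nontrivial_logical_paulis_def coset_eq)

text \<open>The \<open>X\<close> exponents fill the first half and the \<open>Z\<close> exponents
  the second. Reduction modulo \<open>m\<close> and extensionality make the tuple an admissible
  index of a coset in \<open>nontrivial_logical_paulis\<close>.\<close>

definition exponents :: "(nat \<Rightarrow> nat) \<Rightarrow> (nat \<Rightarrow> nat) \<Rightarrow> nat \<Rightarrow> nat" where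
  "exponents a b = (\<lambda>i\<in>{..<2 * k}. (if i < k then a i else b (i - k)) mod m)"

lemma exponents_coset:
  assumes "\<not> (vanishes_on m {..<k} a \<and> vanishes_on m {..<k} b)"
  shows "S #>\<^bsub>unitary_group d\<^esub> logical_pauli m C (exponents a b) \<in> nontrivial_logical_paulis m C"
proof -
  have "exponents a b \<in> {..<2 * k} \<rightarrow>\<^sub>E {..<m}"
    using m_pos by (auto simp: exponents_def)
  moreover have "\<exists>i<2 * k. exponents a b i \<noteq> 0"
  proof -
    obtain j where j: "j < k" "a j mod m \<noteq> 0 \<or> b j mod m \<noteq> 0"
      using assms by (auto simp: vanishes_on_def)
    show ?thesis
    proof (cases "a j mod m = 0")
      case False
      then show ?thesis using j by (intro exI[of _ j]) (auto simp: exponents_def)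
    next
      case True
      then show ?thesis using j by (intro exI[of _ "j + k"]) (auto simp: exponents_def)
    qed
  qed
  ultimately show ?thesis unfolding nontrivial_logical_paulis_def by blast
qed

section \<open>Distances and disjointness\<close>

lemma min_distance_le:
  assumes "G \<in> nontrivial_logical_paulis m C" "g \<in> G"
  shows "min_distance m C \<le> card (supp m C g)"
proof -
  have "min_distance m C \<le> coset_dist m C G"
    unfolding min_distance_def using assms finite_nontrivial by (intro Min_le) auto
  also have "\<dots> \<le> card (supp m C g)"
    unfolding coset_dist_def using assms coset_finite_nonempty by (intro Min_le) auto
  finally show ?thesis .
qed

lemma max_distance_ge:
  assumes "G \<in> nontrivial_logical_paulis m C"
  shows "\<exists>g\<in>G. card (supp m C g) \<le> max_distance m C"
proof -
  have "coset_dist m C G \<in> (\<lambda>g. card (supp m C g)) ` G"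
    unfolding coset_dist_def using coset_finite_nonempty[OF assms] by (intro Min_in) auto
  moreover have "coset_dist m C G \<le> max_distance m C"
    unfolding max_distance_def using assms finite_nontrivial by (intro Max_ge) auto
  ultimately show ?thesis by auto
qed

lemma coset_disjointness_attained:
  assumes "finite G"
  obtains A where "A \<subseteq> G" "c_disjoint m C c A" "coset_disjointness m C c G = card A / c"
proof -
  have "{} \<in> {A. A \<subseteq> G \<and> c_disjoint m C c A}" by (simp add: c_disjoint_def)
  then have "Max (card ` {A. A \<subseteq> G \<and> c_disjoint m C c A}) \<in> card ` {A. A \<subseteq> G \<and> c_disjoint m C c A}"
    using assms by (intro Max_in) auto
  then show thesis using that by (auto simp: coset_disjointness_def)
qed

text \<open>Averaging over a largest \<open>c\<close>-disjoint subset of the coset: each part of \<open>T\<close> is counted at most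
  \<open>c\<close> times.\<close>

lemma coset_disjointness_le:
  assumes "finite G" "T \<subseteq> parts C" "c \<ge> 1" "\<And>g. g \<in> G \<Longrightarrow> t \<le> card (T \<inter> supp m C g)"
  shows "real t * coset_disjointness m C c G \<le> card T"
proof -
  obtain A where A: "A \<subseteq> G" "c_disjoint m C c A" "coset_disjointness m C c G = card A / c"
    using coset_disjointness_attained[OF assms(1)] .
  have fA: "finite A" using A(1) assms(1) finite_subset by blast
  have fT: "finite T" using assms(2) finite_parts finite_subset by blast
  have "card A * t = (\<Sum>g\<in>A. t)" by simp
  also have "\<dots> \<le> (\<Sum>g\<in>A. card (T \<inter> supp m C g))"
    using A(1) assms(4) by (intro sum_mono) auto
  also have "\<dots> = (\<Sum>g\<in>A. \<Sum>B\<in>T. if B \<in> supp m C g then 1 else 0)"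
    using fT by (simp add: sum.If_cases Int_def)
  also have "\<dots> = (\<Sum>B\<in>T. \<Sum>g\<in>A. if B \<in> supp m C g then 1 else 0)"
    by (rule sum.swap)
  also have "\<dots> = (\<Sum>B\<in>T. card {g \<in> A. B \<in> supp m C g})"
    using fA by (simp add: sum.If_cases Int_def)
  also have "\<dots> \<le> (\<Sum>B\<in>T. c)"
    using A(2) assms(2) by (intro sum_mono) (auto simp: c_disjoint_def)
  finally have "real (card A * t) \<le> real (card T * c)" unfolding of_nat_le_iff by simp
  then show ?thesis using assms(3) by (simp add: A(3) field_simps)
qed

text \<open>The representative of least overlap is chosen before \<open>c\<close>, so the averaging
  bound holds for it at every \<open>c\<close> and passes to the supremum.\<close>

lemma ex_small_overlap:
  assumes "G \<in> nontrivial_logical_paulis m C" "T \<subseteq> parts C"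
  shows "\<exists>g\<in>G. real (card (T \<inter> supp m C g)) * disjointness m C \<le> card T"
proof -
  note G = coset_finite_nonempty[OF assms(1)]
  define t where "t = Min ((\<lambda>g. card (T \<inter> supp m C g)) ` G)"
  have "t \<in> (\<lambda>g. card (T \<inter> supp m C g)) ` G" unfolding t_def using G by (intro Min_in) auto
  then obtain g where g: "g \<in> G" "card (T \<inter> supp m C g) = t" by auto
  have t: "t \<le> card (T \<inter> supp m C g)" if "g \<in> G" for g unfolding t_def using G that by (intro Min_le) auto
  have "real t * disjointness m C \<le> card T"
  proof (cases "t = 0")
    case False
    have "disjointness m C \<le> card T / t"
      unfolding disjointness_def
    proof (rule cSUP_least)
      fix c :: nat assume "c \<in> {1..}"
      then have "real t * coset_disjointness m C c G \<le> card T"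
        using coset_disjointness_le[OF G(1) assms(2) _ t] by simp
      then have "coset_disjointness m C c G \<le> card T / t" using False by (simp add: field_simps)
      moreover have "Min (coset_disjointness m C c ` nontrivial_logical_paulis m C) \<le> coset_disjointness m C c G"
        using assms(1) finite_nontrivial by (intro Min_le) auto
      ultimately show "Min (coset_disjointness m C c ` nontrivial_logical_paulis m C) \<le> card T / t" by simp
    qed auto
    then show ?thesis using False by (simp add: field_simps)
  qed simp
  then show ?thesis using g by auto
qed

lemma nontrivial_nonempty: "nontrivial_logical_paulis m C \<noteq> {}"
proof -
  have "\<not> vanishes_on m {..<k} (\<lambda>_. 1)" using k_pos m2 unfolding vanishes_on_def by (intro notI) (drule bspec[of _ _ 0], auto)
  then show ?thesis using exponents_coset by blast
qed

text \<open>A single representative is 1-disjoint, so \<open>c = 1\<close> already contributes at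
  least 1. The descent cancels factors of the disjointness and needs them positive.\<close>

lemma disjointness_ge_1: "disjointness m C \<ge> 1"
proof -
  let ?f = "\<lambda>c. Min (coset_disjointness m C c ` nontrivial_logical_paulis m C)"
  obtain G where G: "G \<in> nontrivial_logical_paulis m C" using nontrivial_nonempty by blast
  have "?f c \<le> card G" if "c \<ge> 1" for c
  proof -
    obtain A where A: "A \<subseteq> G" "coset_disjointness m C c G = card A / c"
      using coset_disjointness_attained[OF coset_finite_nonempty(1)[OF G]] by metis
    have "?f c \<le> coset_disjointness m C c G" using G finite_nontrivial by (intro Min_le) auto
    also have "\<dots> \<le> card A" using A(2) that by (simp add: divide_le_eq mult_le_cancel_left1)
    also have "\<dots> \<le> card G" using A(1) coset_finite_nonempty(1)[OF G] by (simp add: card_mono)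
    finally show ?thesis .
  qed
  \<comment> \<open>A real supremum dominates its values only if they are bounded above.\<close>
  then have bdd: "bdd_above (?f ` {1..})" by (intro bdd_aboveI2) simp
  have "1 \<le> coset_disjointness m C 1 G'" if G': "G' \<in> nontrivial_logical_paulis m C" for G'
  proof -
    obtain g where g: "g \<in> G'" using coset_finite_nonempty(2)[OF G'] by blast
    have "card {a. a = g \<and> B \<in> supp m C a} \<le> 1" for B
      using card_mono[of "{g}" "{a. a = g \<and> B \<in> supp m C a}"] by auto
    then have "{g} \<in> {A. A \<subseteq> G' \<and> c_disjoint m C 1 A}" using g by (auto simp: c_disjoint_def)
    then have "card {g} \<le> Max (card ` {A. A \<subseteq> G' \<and> c_disjoint m C 1 A})"
      using coset_finite_nonempty(1)[OF G'] by (intro Max_ge imageI) auto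
    then show ?thesis by (simp add: coset_disjointness_def)
  qed
  then have "1 \<le> ?f 1" using finite_nontrivial nontrivial_nonempty by simp
  also have "?f 1 \<le> disjointness m C"
    unfolding disjointness_def by (rule cSUP_upper[OF _ bdd]) simp
  finally show ?thesis .
qed

end

section \<open>Encoded operators\<close>

locale encoded_code = partitioned_code +
  fixes E :: "complex mat"
  assumes enc: "encoding m C E"
begin

abbreviation e where "e \<equiv> m ^ num_logical C"

lemma E_facts:
  shows Ec: "E \<in> carrier_mat d e" and E_isometry: "mat_adjoint E * E = 1\<^sub>m e"
    and E_range: "(\<lambda>v. E *\<^sub>v v) ` carrier_vec e = code_space m C"
    and E_logical: "i < k \<Longrightarrow> \<exists>c. cmod c = 1 \<and> logical_X C i * E = c \<cdot>\<^sub>m (E * pauli_X m k i)"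
      "i < k \<Longrightarrow> \<exists>c. cmod c = 1 \<and> logical_Z C i * E = c \<cdot>\<^sub>m (E * pauli_Z m k i)"
  using enc unfolding encoding_def Let_def by blast+

lemma Eac: "mat_adjoint E \<in> carrier_mat e d"
  using Ec by blast

lemma S_dim: "s \<in> S \<Longrightarrow> dim_row s = d" "s \<in> S \<Longrightarrow> dim_col s = d"
  using S_carrier by blast+

lemma S_E:
  assumes "s \<in> S"
  shows "s * E = E"
proof (rule mat_eqI_vec)
  show "s * E \<in> carrier_mat d e" using S_carrier[OF assms] Ec by simp
  show "E \<in> carrier_mat d e" by (rule Ec)
  fix v :: "complex vec" assume v: "v \<in> carrier_vec e"
  then have "E *\<^sub>v v \<in> code_space m C" using E_range by blast
  then have "s *\<^sub>v (E *\<^sub>v v) = E *\<^sub>v v" using assms by (simp add: code_space_def)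
  then show "(s * E) *\<^sub>v v = E *\<^sub>v v" using assoc_mult_mat_vec[OF S_carrier[OF assms] Ec v] by simp
qed

section \<open>The average over the stabilizer as the orthogonal projector onto the code
  space\<close>

definition stab_proj :: "complex mat" where
  "stab_proj = mat d d (\<lambda>(x, y). (\<Sum>s\<in>S. s $$ (x, y)) / of_nat (card S))"

lemma stab_proj_carrier: "stab_proj \<in> carrier_mat d d"
  by (simp add: stab_proj_def)

lemma card_S_pos: "card S > 0"
  using card_S m_pos by simp

lemma stab_proj_mult:
  assumes "B \<in> carrier_mat d c" "x < d" "y < c"
  shows "(stab_proj * B) $$ (x, y) = (\<Sum>s\<in>S. (s * B) $$ (x, y)) / of_nat (card S)"
proof -
  have "(stab_proj * B) $$ (x, y) = (\<Sum>z<d. (\<Sum>s\<in>S. s $$ (x, z)) / of_nat (card S) * B $$ (z, y))"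
    using assms by (simp add: mult_mat_index_sum stab_proj_def del: index_mult_mat(1))
  also have "\<dots> = (\<Sum>z<d. \<Sum>s\<in>S. s $$ (x, z) * B $$ (z, y)) / of_nat (card S)"
    by (simp add: sum_divide_distrib sum_distrib_right)
  also have "\<dots> = (\<Sum>s\<in>S. \<Sum>z<d. s $$ (x, z) * B $$ (z, y)) / of_nat (card S)"
    by (subst sum.swap) simp
  also have "\<dots> = (\<Sum>s\<in>S. (s * B) $$ (x, y)) / of_nat (card S)"
    using assms by (auto simp: mult_mat_index_sum S_dim simp del: index_mult_mat(1) intro!: sum.cong arg_cong2[of _ _ _ _ "(/)"])
  finally show ?thesis .
qed

lemma mtrace_stab_proj_mult:
  assumes "B \<in> carrier_mat d d"
  shows "mtrace (stab_proj * B) = (\<Sum>s\<in>S. mtrace (s * B)) / of_nat (card S)"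
proof -
  have "mtrace (stab_proj * B) = (\<Sum>x<d. (\<Sum>s\<in>S. (s * B) $$ (x, x)) / of_nat (card S))"
    using stab_proj_carrier stab_proj_mult[OF assms] by (simp add: mtrace_def del: index_mult_mat(1))
  also have "\<dots> = (\<Sum>s\<in>S. \<Sum>x<d. (s * B) $$ (x, x)) / of_nat (card S)"
    by (subst sum.swap) (simp add: sum_divide_distrib)
  also have "\<dots> = (\<Sum>s\<in>S. mtrace (s * B)) / of_nat (card S)"
    by (auto simp: mtrace_def S_dim simp del: index_mult_mat(1) intro!: sum.cong arg_cong2[of _ _ _ _ "(/)"])
  finally show ?thesis .
qed

lemma stab_proj_E: "stab_proj * E = E"
proof (rule eq_matI)
  fix x y assume "x < dim_row E" "y < dim_col E"
  then have xy: "x < d" "y < e" using Ec by auto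
  have "(stab_proj * E) $$ (x, y) = (\<Sum>s\<in>S. E $$ (x, y)) / of_nat (card S)"
    unfolding stab_proj_mult[OF Ec xy] by (simp add: S_E del: index_mult_mat(1))
  then show "(stab_proj * E) $$ (x, y) = E $$ (x, y)" using card_S_pos by (simp del: index_mult_mat(1))
qed (use Ec stab_proj_carrier in auto)

text \<open>Left multiplication by \<open>s\<close> permutes the summands, the stabilizer being a
  group.\<close>

lemma S_stab_proj:
  assumes "s \<in> S"
  shows "s * stab_proj = stab_proj"
proof (rule eq_matI)
  fix x y assume "x < dim_row stab_proj" "y < dim_col stab_proj"
  then have xy: "x < d" "y < d" using stab_proj_carrier by auto
  note sc = S_carrier[OF assms]
  have "(s * stab_proj) $$ (x, y) = (\<Sum>z<d. s $$ (x, z) * ((\<Sum>t\<in>S. t $$ (z, y)) / of_nat (card S)))"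
    using sc xy by (simp add: mult_mat_index_sum stab_proj_def del: index_mult_mat(1))
  also have "\<dots> = (\<Sum>z<d. \<Sum>t\<in>S. s $$ (x, z) * t $$ (z, y)) / of_nat (card S)"
    by (simp add: sum_divide_distrib sum_distrib_left)
  also have "\<dots> = (\<Sum>t\<in>S. \<Sum>z<d. s $$ (x, z) * t $$ (z, y)) / of_nat (card S)"
    by (subst sum.swap) simp
  also have "(\<Sum>t\<in>S. \<Sum>z<d. s $$ (x, z) * t $$ (z, y)) = (\<Sum>t\<in>S. (s * t) $$ (x, y))"
    using sc xy by (auto simp: mult_mat_index_sum S_dim simp del: index_mult_mat(1) intro!: sum.cong)
  also have "\<dots> = (\<Sum>t\<in>S. t $$ (x, y))"
  proof (rule sum.reindex_bij_witness[of S "\<lambda>t. mat_adjoint s * t" "\<lambda>t. s * t"])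
    fix t assume "t \<in> S"
    then show "mat_adjoint s * (s * t) = t" "s * (mat_adjoint s * t) = t"
      using unitary_mat_cancel[OF S_unitary[OF assms] S_carrier] by blast+
  qed (use assms S_mult S_adjoint in auto)
  finally show "(s * stab_proj) $$ (x, y) = stab_proj $$ (x, y)" using xy by (simp add: stab_proj_def)
qed (use S_carrier[OF assms] stab_proj_carrier in auto)

lemma stab_proj_adjoint: "mat_adjoint stab_proj = stab_proj"
proof (rule eq_matI)
  fix x y assume "x < dim_row stab_proj" "y < dim_col stab_proj"
  then have xy: "x < d" "y < d" using stab_proj_carrier by auto
  have "mat_adjoint stab_proj $$ (x, y) = (\<Sum>s\<in>S. cnj (s $$ (y, x))) / of_nat (card S)"
    using xy stab_proj_carrier by (simp add: mat_adjoint_index stab_proj_def)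
  also have "(\<Sum>s\<in>S. cnj (s $$ (y, x))) = (\<Sum>s\<in>S. mat_adjoint s $$ (x, y))"
    using xy by (auto simp: mat_adjoint_index S_dim intro!: sum.cong)
  also have "\<dots> = (\<Sum>s\<in>S. s $$ (x, y))"
    by (rule sum.reindex_bij_witness[of S mat_adjoint mat_adjoint]) (auto simp: S_adjoint)
  finally show "mat_adjoint stab_proj $$ (x, y) = stab_proj $$ (x, y)" using xy by (simp add: stab_proj_def)
qed (use stab_proj_carrier in auto)

text \<open>\<open>stab_proj\<close> maps into the code space, on which
  \<open>E * mat_adjoint E\<close> is the identity. Conversely \<open>stab_proj\<close> fixes the
  columns of \<open>E\<close>, and being self-adjoint it can be absorbed on the right as
  well.\<close>

lemma E_E_adjoint: "E * mat_adjoint E = stab_proj"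
proof -
  have EEc: "E * mat_adjoint E \<in> carrier_mat d d" using Ec Eac by simp
  have 1: "E * mat_adjoint E * stab_proj = stab_proj"
  proof (rule mat_eqI_vec)
    fix v :: "complex vec" assume v: "v \<in> carrier_vec d"
    have "s *\<^sub>v (stab_proj *\<^sub>v v) = stab_proj *\<^sub>v v" if "s \<in> S" for s
      using assoc_mult_mat_vec[OF S_carrier[OF that] stab_proj_carrier v] S_stab_proj[OF that] by simp
    then have "stab_proj *\<^sub>v v \<in> code_space m C"
      using mult_mat_vec_carrier[OF stab_proj_carrier v] by (simp add: code_space_def)
    then obtain w where w: "w \<in> carrier_vec e" "stab_proj *\<^sub>v v = E *\<^sub>v w" using E_range by blast
    have "E * mat_adjoint E * stab_proj *\<^sub>v v = E * mat_adjoint E *\<^sub>v (E *\<^sub>v w)"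
      unfolding assoc_mult_mat_vec[OF EEc stab_proj_carrier v] w(2) ..
    also have "\<dots> = E * mat_adjoint E * E *\<^sub>v w" by (rule assoc_mult_mat_vec[OF EEc Ec w(1), symmetric])
    also have "E * mat_adjoint E * E = E"
      unfolding assoc_mult_mat[OF Ec Eac Ec] E_isometry by (rule right_mult_one_mat[OF Ec])
    finally show "E * mat_adjoint E * stab_proj *\<^sub>v v = stab_proj *\<^sub>v v" by (simp add: w(2))
  qed (use EEc stab_proj_carrier in auto)
  have "mat_adjoint E * stab_proj = mat_adjoint E"
    using mat_adjoint_mult[OF stab_proj_carrier Ec] by (simp add: stab_proj_E stab_proj_adjoint)
  then have "E * mat_adjoint E * stab_proj = E * mat_adjoint E"
    unfolding assoc_mult_mat[OF Ec Eac stab_proj_carrier] by simp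
  then show ?thesis using 1 by simp
qed

text \<open>The phase is free because the encoding determines logical Paulis only up to phase;
  \<open>induces_smult\<close> shifts it between the two sides at will.\<close>

definition induces :: "complex mat \<Rightarrow> complex mat \<Rightarrow> bool" where
  "induces W V \<longleftrightarrow> unitary_mat d W \<and> unitary_mat e V \<and> (\<exists>c. cmod c = 1 \<and> W * E = c \<cdot>\<^sub>m (E * V))"

lemma inducesD:
  assumes "induces W V"
  shows "unitary_mat d W" "unitary_mat e V" "W \<in> carrier_mat d d" "V \<in> carrier_mat e e"
  using assms by (auto simp: induces_def unitary_mat_def)

lemma induces_mult:
  assumes "induces W V" "induces W' V'"
  shows "induces (W * W') (V * V')"
proof -
  note c = inducesD(3,4)[OF assms(1)] inducesD(3,4)[OF assms(2)]
  obtain x x' where x: "cmod x = 1" "W * E = x \<cdot>\<^sub>m (E * V)" "cmod x' = 1" "W' * E = x' \<cdot>\<^sub>m (E * V')"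
    using assms by (auto simp: induces_def)
  have "W * W' * E = W * (W' * E)" by (rule assoc_mult_mat[OF c(1,3) Ec])
  also have "\<dots> = x' \<cdot>\<^sub>m (W * E * V')"
    unfolding x(4) smult_mult_mat(2)[OF c(1) mult_carrier_mat[OF Ec c(4)]] assoc_mult_mat[OF c(1) Ec c(4)] ..
  also have "\<dots> = (x' * x) \<cdot>\<^sub>m (E * (V * V'))"
    unfolding x(2) smult_mult_mat(1)[OF mult_carrier_mat[OF Ec c(2)] c(4)] smult_smult_mat
      assoc_mult_mat[OF Ec c(2,4)] ..
  finally show ?thesis
    using unitary_mat_mult[OF inducesD(1)[OF assms(1)] inducesD(1)[OF assms(2)]]
      unitary_mat_mult[OF inducesD(2)[OF assms(1)] inducesD(2)[OF assms(2)]] x(1,3)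
    unfolding induces_def by (metis norm_mult mult_1)
qed

lemma induces_one: "induces (1\<^sub>m d) (1\<^sub>m e)"
  unfolding induces_def using unitary_mat_one Ec
  by (auto intro!: exI[of _ 1] simp: left_mult_one_mat[OF Ec] right_mult_one_mat[OF Ec])

text \<open>Since \<open>V\<close> is invertible, \<open>W\<close> maps the code space onto itself,
  and so its inverse preserves it too.\<close>

lemma induces_adjoint:
  assumes "induces W V"
  shows "induces (mat_adjoint W) (mat_adjoint V)"
proof -
  note c = inducesD(3,4)[OF assms] and u = inducesD(1,2)[OF assms]
  note Vac = mat_adjoint_carrier[OF c(2)] and Wac = mat_adjoint_carrier[OF c(1)]
  obtain x where x: "cmod x = 1" "W * E = x \<cdot>\<^sub>m (E * V)" using assms by (auto simp: induces_def)
  have EV: "E * V \<in> carrier_mat d e" using mult_carrier_mat[OF Ec c(2)] .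
  have "W * (E * mat_adjoint V) = x \<cdot>\<^sub>m (E * V * mat_adjoint V)"
    unfolding assoc_mult_mat[OF c(1) Ec Vac, symmetric] x(2) by (rule smult_mult_mat(1)[OF EV Vac])
  also have "E * V * mat_adjoint V = E"
    unfolding assoc_mult_mat[OF Ec c(2) Vac] unitary_matD(3)[OF u(2)] by (rule right_mult_one_mat[OF Ec])
  finally have "mat_adjoint W * (W * (E * mat_adjoint V)) = mat_adjoint W * (x \<cdot>\<^sub>m E)" by simp
  then have "E * mat_adjoint V = x \<cdot>\<^sub>m (mat_adjoint W * E)"
    unfolding unitary_mat_cancel(1)[OF u(1) mult_carrier_mat[OF Ec Vac]] smult_mult_mat(2)[OF Wac Ec] .
  then have "inverse x \<cdot>\<^sub>m (E * mat_adjoint V) = (inverse x * x) \<cdot>\<^sub>m (mat_adjoint W * E)"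
    by (simp add: smult_smult_mat)
  moreover have "x \<noteq> 0" using x(1) by auto
  ultimately have "mat_adjoint W * E = inverse x \<cdot>\<^sub>m (E * mat_adjoint V)" by simp
  moreover have "cmod (inverse x) = 1" using x(1) by (simp add: norm_inverse)
  ultimately show ?thesis using unitary_mat_adjoint u unfolding induces_def by blast
qed

lemma induces_commutator: "induces W V \<Longrightarrow> induces W' V' \<Longrightarrow> induces (commutator W W') (commutator V V')"
  unfolding commutator_def by (intro induces_mult induces_adjoint)

lemma induces_smult:
  assumes "induces W V" "cmod x = 1"
  shows "induces W (x \<cdot>\<^sub>m V)"
proof -
  obtain y where y: "cmod y = 1" "W * E = y \<cdot>\<^sub>m (E * V)" using assms(1) by (auto simp: induces_def)
  have "x \<noteq> 0" using assms(2) by auto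
  then have "W * E = (y / x) \<cdot>\<^sub>m (E * (x \<cdot>\<^sub>m V))"
    unfolding y(2) smult_mult_mat(2)[OF Ec inducesD(4)[OF assms(1)]] smult_smult_mat by simp
  moreover have "cmod (y / x) = 1" using y(1) assms(2) by (simp add: norm_divide)
  ultimately show ?thesis
    using inducesD(1,2)[OF assms(1)] unitary_mat_smult[OF _ assms(2)] unfolding induces_def by blast
qed

lemma induces_power:
  assumes "induces W V"
  shows "induces (W ^\<^sub>m t) (V ^\<^sub>m t)"
  by (induction t)
    (use assms induces_one induces_mult inducesD(3,4)[OF assms] in \<open>auto simp: carrier_matD(1)\<close>)

section \<open>Logical Paulis and their cosets\<close>

lemma weyl_power_phase: "\<exists>c. cmod c = 1 \<and> weyl m k a b ^\<^sub>m t = c \<cdot>\<^sub>m weyl m k (\<lambda>j. t * a j) (\<lambda>j. t * b j)"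
proof (induction t)
  case 0
  then show ?case
    by (intro exI[of _ 1]) (simp add: weyl_zero[OF m_pos] vanishes_on_def)
next
  case (Suc t)
  then obtain c where c: "cmod c = 1" "weyl m k a b ^\<^sub>m t = c \<cdot>\<^sub>m weyl m k (\<lambda>j. t * a j) (\<lambda>j. t * b j)" by blast
  have "weyl m k a b ^\<^sub>m Suc t = (c * omega m ^ (\<Sum>j<k. t * b j * a j)) \<cdot>\<^sub>m
      weyl m k (\<lambda>j. Suc t * a j) (\<lambda>j. Suc t * b j)"
    by (simp add: c(2) smult_mult_mat(1)[OF weyl_carrier weyl_carrier] weyl_mult[OF m_pos] smult_smult_mat add.commute)
  moreover have "cmod (c * omega m ^ (\<Sum>j<k. t * b j * a j)) = 1" using c(1) by (simp add: norm_mult)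
  ultimately show ?case by blast
qed

lemma induces_weyl_cancel:
  assumes "induces W (x \<cdot>\<^sub>m V)" "cmod x = 1" "V \<in> carrier_mat e e"
  shows "induces W V"
proof -
  have "x \<noteq> 0" "cmod (inverse x) = 1" using assms(2) by (auto simp: norm_inverse)
  then show ?thesis using induces_smult[OF assms(1), of "inverse x"] by (simp add: smult_smult_mat)
qed

lemma induces_logical_gens:
  assumes "i < k"
  shows "induces (logical_X C i) (weyl m k (unit_exp i) (\<lambda>_. 0))"
    and "induces (logical_Z C i) (weyl m k (\<lambda>_. 0) (unit_exp i))"
proof -
  have "unitary_mat d (logical_X C i)" "unitary_mat d (logical_Z C i)"
    using logical_pauli_gens[OF assms] pauli_group_is_pauli[OF m_pos] is_pauli_unitary[OF m_pos] by blast+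
  then show "induces (logical_X C i) (weyl m k (unit_exp i) (\<lambda>_. 0))"
    "induces (logical_Z C i) (weyl m k (\<lambda>_. 0) (unit_exp i))"
    unfolding induces_def
    using E_logical[OF assms] weyl_unitary[OF m_pos] by (simp_all add: pauli_X_eq_weyl[OF m_pos] pauli_Z_eq_weyl[OF assms])
qed

lemma logical_factor:
  fixes a :: "nat \<Rightarrow> nat"
  assumes i: "i < k"
  defines "L \<equiv> logical_X C i ^\<^sub>m a i * logical_Z C i ^\<^sub>m a (i + k)"
  shows "induces L (weyl m k (\<lambda>j. a i * unit_exp i j) (\<lambda>j. a (i + k) * unit_exp i j))"
    and "is_pauli m n L" and "s \<in> S \<Longrightarrow> L * s = s * L"
proof -
  let ?X = "logical_X C i" and ?Z = "logical_Z C i"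
  obtain x where x: "cmod x = 1"
    "weyl m k (unit_exp i) (\<lambda>_. 0) ^\<^sub>m a i = x \<cdot>\<^sub>m weyl m k (\<lambda>j. a i * unit_exp i j) (\<lambda>j. 0)"
    using weyl_power_phase[of "unit_exp i" "\<lambda>_. 0" "a i"] unfolding mult_0_right by blast
  obtain z where z: "cmod z = 1"
    "weyl m k (\<lambda>_. 0) (unit_exp i) ^\<^sub>m a (i + k) = z \<cdot>\<^sub>m weyl m k (\<lambda>j. 0) (\<lambda>j. a (i + k) * unit_exp i j)"
    using weyl_power_phase[of "\<lambda>_. 0" "unit_exp i" "a (i + k)"] unfolding mult_0_right by blast
  have "induces (?X ^\<^sub>m a i) (weyl m k (\<lambda>j. a i * unit_exp i j) (\<lambda>j. 0))"
    using induces_power[OF induces_logical_gens(1)[OF i], of "a i"] unfolding x(2)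
    by (rule induces_weyl_cancel[OF _ x(1) weyl_carrier])
  moreover have "induces (?Z ^\<^sub>m a (i + k)) (weyl m k (\<lambda>j. 0) (\<lambda>j. a (i + k) * unit_exp i j))"
    using induces_power[OF induces_logical_gens(2)[OF i], of "a (i + k)"] unfolding z(2)
    by (rule induces_weyl_cancel[OF _ z(1) weyl_carrier])
  ultimately have "induces L (weyl m k (\<lambda>j. a i * unit_exp i j) (\<lambda>j. 0) *
      weyl m k (\<lambda>j. 0) (\<lambda>j. a (i + k) * unit_exp i j))"
    unfolding L_def by (rule induces_mult)
  \<comment> \<open>With the \<open>X\<close> power on the left there is nothing to move past, so
    the product acquires no phase.\<close>
  then show "induces L (weyl m k (\<lambda>j. a i * unit_exp i j) (\<lambda>j. a (i + k) * unit_exp i j))"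
    unfolding weyl_mult[OF m_pos] by simp
  have XZ: "is_pauli m n ?X" "is_pauli m n ?Z"
    using logical_pauli_gens[OF i] pauli_group_is_pauli[OF m_pos] by blast+
  have pow: "is_pauli m n (g ^\<^sub>m t) \<and> (s \<in> S \<longrightarrow> g * s = s * g \<longrightarrow> g ^\<^sub>m t * s = s * g ^\<^sub>m t)"
    if g: "is_pauli m n g" for g t s
  proof -
    have gc: "g \<in> carrier_mat d d" using is_pauli_unitary[OF m_pos g] by (simp add: unitary_mat_def)
    have pc: "g ^\<^sub>m t \<in> carrier_mat d d" for t using gc by simp
    have "is_pauli m n (g ^\<^sub>m t)"
    proof (induction t)
      case 0
      have "g ^\<^sub>m 0 = weyl m n (\<lambda>_. 0) (\<lambda>_. 0)" using gc by (simp add: weyl_zero[OF m_pos] vanishes_on_def)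
      then show ?case using is_pauli_weyl by simp
    qed (use is_pauli_mult[OF m_pos _ g] in simp)
    moreover have "g ^\<^sub>m t * s = s * g ^\<^sub>m t" if s: "s \<in> S" "g * s = s * g"
    proof (induction t)
      case 0
      then show ?case using S_carrier[OF s(1)] gc by (simp add: carrier_matD)
    next
      case (Suc t)
      note sc = S_carrier[OF s(1)]
      have "g ^\<^sub>m Suc t * s = g ^\<^sub>m t * (s * g)"
        using assoc_mult_mat[OF pc gc sc] s(2) by simp
      also have "\<dots> = s * g ^\<^sub>m t * g" unfolding assoc_mult_mat[OF pc sc gc, symmetric] Suc ..
      also have "\<dots> = s * g ^\<^sub>m Suc t" using assoc_mult_mat[OF sc pc gc] by simp
      finally show ?case .
    qed
    ultimately show ?thesis by blast
  qed
  show "is_pauli m n L" unfolding L_def using pow XZ by (intro is_pauli_mult[OF m_pos]) auto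
  assume s: "s \<in> S"
  let ?x = "?X ^\<^sub>m a i" and ?z = "?Z ^\<^sub>m a (i + k)"
  have c: "?x \<in> carrier_mat d d" "?z \<in> carrier_mat d d" "s \<in> carrier_mat d d"
    using pow XZ is_pauli_unitary[OF m_pos] S_carrier[OF s] by (auto simp: unitary_mat_def)
  have "L * s = ?x * (s * ?z)"
    unfolding L_def assoc_mult_mat[OF c] using pow[OF XZ(2)] s logical_commute(2)[OF i s] by simp
  also have "\<dots> = s * ?x * ?z"
    unfolding assoc_mult_mat[OF c(1,3,2), symmetric] using pow[OF XZ(1)] s logical_commute(1)[OF i s] by simp
  also have "\<dots> = s * L" unfolding L_def by (rule assoc_mult_mat[OF c(3,1,2)])
  finally show "L * s = s * L" .
qed

lemma logical_pauli_facts: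
  "induces (logical_pauli m C a) (weyl m k a (\<lambda>i. a (i + k)))"
  "is_pauli m n (logical_pauli m C a)"
  "s \<in> S \<Longrightarrow> logical_pauli m C a * s = s * logical_pauli m C a"
proof -
  define L where "L is = mat_prod_list d (map (\<lambda>i. logical_X C i ^\<^sub>m a i * logical_Z C i ^\<^sub>m a (i + k)) is)" for "is"
  have "induces (L is) (weyl m k (\<lambda>j. if j \<in> set is then a j else 0) (\<lambda>j. if j \<in> set is then a (j + k) else 0)) \<and>
      is_pauli m n (L is) \<and> (\<forall>s\<in>S. L is * s = s * L is)"
    if "distinct is" "set is \<subseteq> {..<k}" for "is"
    using that
  proof (induction "is")
    case Nil
    have "weyl m l (\<lambda>_. 0) (\<lambda>_. 0) = 1\<^sub>m (m ^ l)" for l by (simp add: weyl_zero[OF m_pos] vanishes_on_def)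
    then have "is_pauli m n (1\<^sub>m d)" "weyl m k (\<lambda>_. 0) (\<lambda>_. 0) = 1\<^sub>m e" using is_pauli_weyl by metis+
    then show ?case
      using induces_one by (auto simp: L_def S_dim)
  next
    case (Cons i "is")
    let ?f = "logical_X C i ^\<^sub>m a i * logical_Z C i ^\<^sub>m a (i + k)"
    let ?a = "\<lambda>j. if j \<in> set is then a j else 0" and ?b = "\<lambda>j. if j \<in> set is then a (j + k) else 0"
    have i: "i < k" "i \<notin> set is" using Cons.prems by auto
    note f = logical_factor[OF i(1), where a = a]
    have IH: "induces (L is) (weyl m k ?a ?b)" "is_pauli m n (L is)" "\<And>s. s \<in> S \<Longrightarrow> L is * s = s * L is"
      using Cons by auto
    have L: "L (i # is) = ?f * L is" by (simp add: L_def)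
    \<comment> \<open>The phase pairs the \<open>Z\<close> exponent of qudit \<open>i\<close> with
      \<open>X\<close> exponents of other qudits, so it is trivial.\<close>
    have "(\<Sum>j<k. a (i + k) * unit_exp i j * ?a j) = 0"
      using i(2) by (intro sum.neutral) (auto simp: unit_exp_def)
    moreover have "(\<lambda>j. a i * unit_exp i j + ?a j) = (\<lambda>j. if j \<in> set (i # is) then a j else 0)"
      "(\<lambda>j. a (i + k) * unit_exp i j + ?b j) = (\<lambda>j. if j \<in> set (i # is) then a (j + k) else 0)"
      using i(2) by (auto simp: unit_exp_def)
    ultimately have w: "weyl m k (\<lambda>j. a i * unit_exp i j) (\<lambda>j. a (i + k) * unit_exp i j) * weyl m k ?a ?b =
        weyl m k (\<lambda>j. if j \<in> set (i # is) then a j else 0) (\<lambda>j. if j \<in> set (i # is) then a (j + k) else 0)"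
      by (simp only: weyl_mult[OF m_pos] power_0 smult_one_mat)
    have "L (i # is) * s = s * L (i # is)" if s: "s \<in> S" for s
    proof -
      have c: "?f \<in> carrier_mat d d" "L is \<in> carrier_mat d d" "s \<in> carrier_mat d d"
        using f(2) IH(2) is_pauli_unitary[OF m_pos] S_carrier[OF s] by (auto simp: unitary_mat_def)
      show ?thesis
        unfolding L assoc_mult_mat[OF c] IH(3)[OF s] assoc_mult_mat[OF c(1,3,2), symmetric] f(3)[OF s]
        by (rule assoc_mult_mat[OF c(3,1,2)])
    qed
    then show ?case
      using induces_mult[OF f(1) IH(1)] is_pauli_mult[OF m_pos f(2) IH(2)] unfolding L w by blast
  qed
  note step = this
  have "distinct [0..<k]" "set [0..<k] \<subseteq> {..<k}" by auto
  note * = step[OF this]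
  have w: "weyl m k (\<lambda>j. if j \<in> set [0..<k] then a j else 0) (\<lambda>j. if j \<in> set [0..<k] then a (j + k) else 0) =
      weyl m k a (\<lambda>i. a (i + k))"
    by (intro weyl_cong m_pos) auto
  have L: "L [0..<k] = logical_pauli m C a" by (simp add: L_def logical_pauli_def)
  show "induces (logical_pauli m C a) (weyl m k a (\<lambda>i. a (i + k)))" using * unfolding w L by blast
  show "is_pauli m n (logical_pauli m C a)" using * unfolding L by blast
  show "s \<in> S \<Longrightarrow> logical_pauli m C a * s = s * logical_pauli m C a" using * unfolding L by blast
qed

lemma S_induces:
  assumes "s \<in> S"
  shows "induces s (1\<^sub>m e)"
  unfolding induces_def using S_unitary[OF assms] unitary_mat_one S_E[OF assms]
  by (auto intro!: exI[of _ 1] simp: right_mult_one_mat[OF Ec])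

text \<open>Stabilizers induce the identity, so all representatives of a coset act alike on the
  logical qudits. This freedom is spent on choosing light or barely overlapping
  representatives.\<close>

lemma coset_induces:
  assumes "g \<in> S #>\<^bsub>unitary_group d\<^esub> logical_pauli m C a"
  shows "is_pauli m n g" "induces g (weyl m k a (\<lambda>i. a (i + k)))"
proof -
  obtain s where s: "s \<in> S" "g = s * logical_pauli m C a" using assms by (auto simp: coset_eq)
  show "is_pauli m n g" unfolding s(2) by (rule is_pauli_mult[OF m_pos S_is_pauli[OF s(1)] logical_pauli_facts(2)])
  show "induces g (weyl m k a (\<lambda>i. a (i + k)))"
    using induces_mult[OF S_induces[OF s(1)] logical_pauli_facts(1)[of a]]
    unfolding s(2) left_mult_one_mat[OF weyl_carrier] .
qed

lemma weyl_exponents: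
  "weyl m k (exponents a b) (\<lambda>i. exponents a b (i + k)) = weyl m k a b"
  by (intro weyl_cong m_pos) (auto simp: exponents_def)

text \<open>The cleaning lemma. Writing \<open>E E\<^sup>\<dagger>\<close> as the average of the stabilizer turns the trace of \<open>V\<close>
  against a logical Weyl operator into an average of the traces of \<open>W\<close> against a coset, none of whose
  elements is supported in \<open>T\<close>.\<close>

lemma cleaning:
  assumes ind: "induces W V" and T: "T \<subseteq> parts C" "acts T W" "card T < min_distance m C"
  shows "\<exists>c. cmod c = 1 \<and> V = c \<cdot>\<^sub>m 1\<^sub>m e"
proof -
  note c = inducesD(3,4)[OF ind] and u = inducesD(1,2)[OF ind]
  obtain x where x: "cmod x = 1" "W * E = x \<cdot>\<^sub>m (E * V)" using ind by (auto simp: induces_def)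
  have x0: "x \<noteq> 0" using x(1) by auto
  have "mtrace (V * weyl m k a b) = 0" if nz: "\<not> (vanishes_on m {..<k} a \<and> vanishes_on m {..<k} b)" for a b
  proof -
    define L where "L = logical_pauli m C (exponents a b)"
    define w where "w = weyl m k a b"
    have wc: "w \<in> carrier_mat e e" by (simp add: w_def)
    have L: "induces L w" unfolding L_def w_def using logical_pauli_facts(1) weyl_exponents by metis
    obtain y where y: "cmod y = 1" "L * E = y \<cdot>\<^sub>m (E * w)" using L by (auto simp: induces_def)
    have y0: "y \<noteq> 0" using y(1) by auto
    note Lc = inducesD(3)[OF L]
    have coset: "S #>\<^bsub>unitary_group d\<^esub> L \<in> nontrivial_logical_paulis m C"
      unfolding L_def by (rule exponents_coset[OF nz])
    have LE: "L * E \<in> carrier_mat d e" and EV: "E * V \<in> carrier_mat d e"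
      and Vw: "V * w \<in> carrier_mat e e" and WL: "W * L \<in> carrier_mat d d"
      using mult_carrier_mat[OF Lc Ec] mult_carrier_mat[OF Ec c(2)] mult_carrier_mat[OF c(2) wc]
        mult_carrier_mat[OF c(1) Lc] by auto
    have "W * L * E = y \<cdot>\<^sub>m (W * E * w)"
      unfolding assoc_mult_mat[OF c(1) Lc Ec] y(2) smult_mult_mat(2)[OF c(1) mult_carrier_mat[OF Ec wc]]
        assoc_mult_mat[OF c(1) Ec wc] ..
    also have "\<dots> = (y * x) \<cdot>\<^sub>m (E * (V * w))"
      unfolding x(2) smult_mult_mat(1)[OF EV wc] smult_smult_mat assoc_mult_mat[OF Ec c(2) wc] ..
    finally have WLE: "W * L * E = (y * x) \<cdot>\<^sub>m (E * (V * w))" .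
    \<comment> \<open>Inserting \<open>mat_adjoint E * E\<close> and cycling the trace moves the
      computation from the logical to the physical qudits.\<close>
    have "(y * x) * mtrace (V * w) = mtrace (mat_adjoint E * ((y * x) \<cdot>\<^sub>m (E * (V * w))))"
      unfolding smult_mult_mat(2)[OF Eac mult_carrier_mat[OF Ec Vw]]
        assoc_mult_mat[OF Eac Ec Vw, symmetric] E_isometry left_mult_one_mat[OF Vw]
        mtrace_smult[OF Vw] ..
    also have "\<dots> = mtrace (mat_adjoint E * (W * L * E))" unfolding WLE ..
    also have "\<dots> = mtrace (W * L * E * mat_adjoint E)"
      by (rule mtrace_comm[OF Eac mult_carrier_mat[OF WL Ec]])
    also have "\<dots> = mtrace (stab_proj * (W * L))"
      unfolding assoc_mult_mat[OF WL Ec Eac] E_E_adjoint by (rule mtrace_comm[OF WL stab_proj_carrier])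
    also have "\<dots> = (\<Sum>s\<in>S. mtrace (s * (W * L))) / of_nat (card S)"
      by (rule mtrace_stab_proj_mult[OF WL])
    also have "(\<Sum>s\<in>S. mtrace (s * (W * L))) = 0"
    proof (rule sum.neutral, rule)
      fix s assume s: "s \<in> S"
      note sc = S_carrier[OF s]
      have "mtrace (s * (W * L)) = mtrace (W * L * s)" by (rule mtrace_comm[OF sc WL])
      also have "W * L * s = W * (s * L)"
        unfolding assoc_mult_mat[OF c(1) Lc sc] using logical_pauli_facts(3)[OF s] by (simp add: L_def)
      also have "mtrace \<dots> = 0"
      proof (rule mtrace_pauli_zero[OF _ T(1,2)])
        have sL: "s * L \<in> S #>\<^bsub>unitary_group d\<^esub> L" using s by (auto simp: coset_eq)
        show "is_pauli m n (s * L)" using coset_induces(1) sL unfolding L_def by blast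
        have "card T < card (supp m C (s * L))" using min_distance_le[OF coset sL] T(3) by simp
        then show "\<not> supp m C (s * L) \<subseteq> T"
          using card_mono[OF finite_subset[OF T(1) finite_parts]] by (metis leD)
      qed
      finally show "mtrace (s * (W * L)) = 0" .
    qed
    finally show ?thesis using x0 y0 by (simp add: w_def)
  qed
  then obtain z where z: "V = z \<cdot>\<^sub>m 1\<^sub>m e" using scalar_if_mtrace_zero[OF m_pos c(2)] by blast
  then have "cmod z = 1" using u(2) unitary_scalar_norm m_pos by simp
  then show ?thesis using z by blast
qed

lemma coset_of_pauli:
  assumes "is_pauli m k p" "\<not> (\<exists>c. p = c \<cdot>\<^sub>m 1\<^sub>m e)"
  shows "\<exists>G\<in>nontrivial_logical_paulis m C. \<forall>g\<in>G. is_pauli m n g \<and> induces g p"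
proof -
  obtain c a b where p: "cmod c = 1" "p = c \<cdot>\<^sub>m weyl m k a b" using assms(1) by (auto simp: is_pauli_def)
  have nz: "\<not> (vanishes_on m {..<k} a \<and> vanishes_on m {..<k} b)"
    using assms(2) weyl_zero[OF m_pos] unfolding p(2) by metis
  show ?thesis
  proof (rule bexI[OF ballI exponents_coset[OF nz]])
    fix g assume "g \<in> S #>\<^bsub>unitary_group d\<^esub> logical_pauli m C (exponents a b)"
    note g = coset_induces[OF this]
    then show "is_pauli m n g \<and> induces g p"
      using induces_smult[OF g(2) p(1)] unfolding p(2) weyl_exponents by blast
  qed
qed

text \<open>A representative of weight 0 would be a scalar and so induce a scalar, whereas its
  logical Weyl operator has a non-trivial exponent.\<close>

lemma min_distance_pos: "min_distance m C \<ge> 1"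
proof (rule ccontr)
  assume neg: "\<not> ?thesis"
  have "coset_dist m C ` nontrivial_logical_paulis m C \<noteq> {}" using nontrivial_nonempty by simp
  then have "min_distance m C \<in> coset_dist m C ` nontrivial_logical_paulis m C"
    unfolding min_distance_def using finite_nontrivial by (intro Min_in) auto
  then obtain G where G: "G \<in> nontrivial_logical_paulis m C" "coset_dist m C G = min_distance m C" by auto
  have "coset_dist m C G \<in> (\<lambda>g. card (supp m C g)) ` G"
    unfolding coset_dist_def using coset_finite_nonempty[OF G(1)] by (intro Min_in) auto
  then obtain g where g: "g \<in> G" "card (supp m C g) = 0" using neg G(2) by auto
  then have supp: "supp m C g = {}" using finite_supp by simp
  obtain a where a: "a \<in> {..<2 * k} \<rightarrow>\<^sub>E {..<m}" "\<exists>i<2 * k. a i \<noteq> 0"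
    "G = S #>\<^bsub>unitary_group d\<^esub> logical_pauli m C a"
    using G(1) by (auto simp: nontrivial_logical_paulis_def)
  note gi = coset_induces[OF g(1)[unfolded a(3)]]
  obtain c \<alpha> \<beta> where gw: "cmod c = 1" "g = c \<cdot>\<^sub>m weyl m n \<alpha> \<beta>" using gi(1) by (auto simp: is_pauli_def)
  have c0: "c \<noteq> 0" using gw(1) by auto
  have "vanishes_on m {..<n} \<alpha> \<and> vanishes_on m {..<n} \<beta>"
    using vanishes_on_part_iff[OF _ c0, of _ \<alpha> \<beta>] supp
    unfolding gw(2)[symmetric] Union_parts[symmetric] vanishes_on_def by auto
  then have g1: "g = c \<cdot>\<^sub>m 1\<^sub>m d" unfolding gw(2) using weyl_zero[OF m_pos] by simp
  let ?w = "weyl m k a (\<lambda>i. a (i + k))"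
  obtain x where x: "cmod x = 1" "g * E = x \<cdot>\<^sub>m (E * ?w)" using gi(2) by (auto simp: induces_def)
  have "x \<noteq> 0" using x(1) by auto
  have "c \<cdot>\<^sub>m E = x \<cdot>\<^sub>m (E * ?w)"
    using x(2) unfolding g1 smult_mult_mat(1)[OF one_carrier_mat Ec] left_mult_one_mat[OF Ec] .
  then have "mat_adjoint E * (c \<cdot>\<^sub>m E) = mat_adjoint E * (x \<cdot>\<^sub>m (E * ?w))" by simp
  then have "c \<cdot>\<^sub>m 1\<^sub>m e = x \<cdot>\<^sub>m ?w"
    unfolding smult_mult_mat(2)[OF Eac Ec] smult_mult_mat(2)[OF Eac mult_carrier_mat[OF Ec weyl_carrier]]
      assoc_mult_mat[OF Eac Ec weyl_carrier, symmetric] E_isometry left_mult_one_mat[OF weyl_carrier] .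
  then have "inverse x \<cdot>\<^sub>m (x \<cdot>\<^sub>m ?w) = inverse x \<cdot>\<^sub>m (c \<cdot>\<^sub>m 1\<^sub>m e)" by simp
  then have w: "?w = (inverse x * c) \<cdot>\<^sub>m 1\<^sub>m e"
    unfolding smult_smult_mat left_inverse[OF \<open>x \<noteq> 0\<close>] smult_one_mat .
  \<comment> \<open>A scalar commutes with the logical \<open>X\<close> and \<open>Z\<close> of
    every qudit, which by nondegeneracy kills all exponents.\<close>
  have "?w * V = V * ?w" if "V \<in> carrier_mat e e" for V
    unfolding w smult_mult_mat(1)[OF one_carrier_mat that] smult_mult_mat(2)[OF that one_carrier_mat]
      left_mult_one_mat[OF that] right_mult_one_mat[OF that] ..
  then have zero: "a j mod m = 0 \<and> a (j + k) mod m = 0" if "j < k" for j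
    using that by (intro weyl_exponent_zero[OF m_pos]) auto
  obtain i where i: "i < 2 * k" "a i \<noteq> 0" using a(2) by blast
  then have "a i < m" using a(1) by auto
  then have "a i mod m \<noteq> 0" using i(2) by simp
  moreover have "i - k < k" if "\<not> i < k" using i(1) that by linarith
  ultimately show False using zero[of i] zero[of "i - k"] by (cases "i < k") auto
qed

end

section \<open>Spreading of supports\<close>

lemma conj_mult:
  fixes U V A :: "complex mat"
  assumes U: "U \<in> carrier_mat d d" and V: "V \<in> carrier_mat d d" and A: "A \<in> carrier_mat d d"
  shows "(U * V) * A * mat_adjoint (U * V) = U * (V * A * mat_adjoint V) * mat_adjoint U"
proof -
  note a = mat_adjoint_carrier[OF U] mat_adjoint_carrier[OF V]
  have VA: "V * A \<in> carrier_mat d d" using V A by simp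
  have "(U * V) * A * mat_adjoint (U * V) = U * (V * A) * (mat_adjoint V * mat_adjoint U)"
    unfolding mat_adjoint_mult[OF U V] assoc_mult_mat[OF U V A] ..
  also have "\<dots> = U * (V * A) * mat_adjoint V * mat_adjoint U"
    by (rule assoc_mult_mat[OF mult_carrier_mat[OF U VA] a(2,1), symmetric])
  also have "\<dots> = U * (V * A * mat_adjoint V) * mat_adjoint U"
    unfolding assoc_mult_mat[OF U VA a(2)] ..
  finally show ?thesis .
qed

lemma conj_commuting:
  assumes U: "unitary_mat d U" and A: "A \<in> carrier_mat d d" and comm: "U * A = A * U"
  shows "U * A * mat_adjoint U = A"
  unfolding comm assoc_mult_mat[OF A unitary_matD(1)[OF U] mat_adjoint_carrier[OF unitary_matD(1)[OF U]]]
    unitary_matD(3)[OF U] by (rule right_mult_one_mat[OF A])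

lemma conj_block:
  assumes m: "m > 0" and U: "unitary_mat (m ^ n) U" "acts_only_on m n B U"
    and B: "B \<subseteq> Q \<or> B \<inter> Q = {}" and A: "acts_only_on m n Q A"
  shows "acts_only_on m n Q (U * A * mat_adjoint U)"
  using B
proof
  assume "B \<subseteq> Q"
  then have "acts_only_on m n Q U" using acts_only_on_mono[OF m U(2)] by blast
  then show ?thesis using A by (intro acts_only_on_mult acts_only_on_adjoint m)
next
  assume "B \<inter> Q = {}"
  then have "U * A = A * U" by (intro acts_only_on_disjoint_commute[OF m U(2) A]) auto
  then show ?thesis using conj_commuting[OF U(1) acts_only_onD(1)[OF A]] A by simp
qed

text \<open>When no block crosses the boundary of \<open>Q\<close>, each factor either acts inside
  \<open>Q\<close> or cancels against its adjoint. Both directions of conjugation are carried along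
  because spreading is required of adjoints too.\<close>

lemma conj_blocks:
  assumes m: "m > 0"
    and F: "\<forall>B\<in>set Bs. unitary_mat (m ^ n) (F B) \<and> acts_only_on m n B (F B) \<and> (B \<subseteq> Q \<or> B \<inter> Q = {})"
  defines "U \<equiv> mat_prod_list (m ^ n) (map F Bs)"
  shows "unitary_mat (m ^ n) U"
    and "acts_only_on m n Q A \<Longrightarrow> acts_only_on m n Q (U * A * mat_adjoint U)"
    and "acts_only_on m n Q A \<Longrightarrow> acts_only_on m n Q (mat_adjoint U * A * U)"
proof -
  have "unitary_mat (m ^ n) (mat_prod_list (m ^ n) (map F Bs)) \<and>
    (\<forall>A. acts_only_on m n Q A \<longrightarrow>
      acts_only_on m n Q (mat_prod_list (m ^ n) (map F Bs) * A * mat_adjoint (mat_prod_list (m ^ n) (map F Bs))) \<and>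
      acts_only_on m n Q (mat_adjoint (mat_prod_list (m ^ n) (map F Bs)) * A * mat_prod_list (m ^ n) (map F Bs)))"
    using F
  proof (induction Bs)
    case Nil
    show ?case
    proof (intro conjI allI impI)
      fix A assume A: "acts_only_on m n Q A"
      note Ac = acts_only_onD(1)[OF A]
      show "acts_only_on m n Q (mat_prod_list (m ^ n) (map F []) * A * mat_adjoint (mat_prod_list (m ^ n) (map F [])))"
        "acts_only_on m n Q (mat_adjoint (mat_prod_list (m ^ n) (map F [])) * A * mat_prod_list (m ^ n) (map F []))"
        using A by (simp_all add: left_mult_one_mat[OF Ac] right_mult_one_mat[OF Ac])
    qed (simp add: unitary_mat_one)
  next
    case (Cons B Bs)
    let ?V = "mat_prod_list (m ^ n) (map F Bs)"
    have B: "unitary_mat (m ^ n) (F B)" "acts_only_on m n B (F B)" "B \<subseteq> Q \<or> B \<inter> Q = {}"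
      using Cons.prems by auto
    have V: "unitary_mat (m ^ n) ?V"
      and VA: "\<And>A. acts_only_on m n Q A \<Longrightarrow> acts_only_on m n Q (?V * A * mat_adjoint ?V)"
        "\<And>A. acts_only_on m n Q A \<Longrightarrow> acts_only_on m n Q (mat_adjoint ?V * A * ?V)"
      using Cons by auto
    note c = unitary_matD(1)[OF B(1)] unitary_matD(1)[OF V]
    show ?case
    proof (intro conjI allI impI)
      show "unitary_mat (m ^ n) (mat_prod_list (m ^ n) (map F (B # Bs)))"
        using unitary_mat_mult[OF B(1) V] by simp
      fix A assume A: "acts_only_on m n Q A"
      note Ac = acts_only_onD(1)[OF A]
      show "acts_only_on m n Q (mat_prod_list (m ^ n) (map F (B # Bs)) * A *
          mat_adjoint (mat_prod_list (m ^ n) (map F (B # Bs))))"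
        using conj_block[OF m B VA(1)[OF A]] conj_mult[OF c Ac] by simp
      have "acts_only_on m n Q (mat_adjoint (F B) * A * F B)"
        using conj_block[OF m unitary_mat_adjoint[OF B(1)] acts_only_on_adjoint[OF B(2)] B(3) A] by simp
      from VA(2)[OF this]
      show "acts_only_on m n Q (mat_adjoint (mat_prod_list (m ^ n) (map F (B # Bs))) * A *
          mat_prod_list (m ^ n) (map F (B # Bs)))"
        using conj_mult[OF mat_adjoint_carrier[OF c(2)] mat_adjoint_carrier[OF c(1)] Ac] mat_adjoint_mult[OF c]
          mat_adjoint_mult[OF mat_adjoint_carrier[OF c(2)] mat_adjoint_carrier[OF c(1)]]
        by simp
    qed
  qed
  then show "unitary_mat (m ^ n) U"
    "acts_only_on m n Q A \<Longrightarrow> acts_only_on m n Q (U * A * mat_adjoint U)"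
    "acts_only_on m n Q A \<Longrightarrow> acts_only_on m n Q (mat_adjoint U * A * U)"
    unfolding U_def by blast+
qed

section \<open>Spreading factors of Paulis, circuits and commutators\<close>

context partitioned_code
begin

text \<open>\<open>T'\<close> has to contain \<open>T\<close> so that \<open>A\<close> itself acts
  on it: a commutator multiplies the conjugate of an operator by the adjoint of that same
  operator.\<close>

definition spreads_into :: "nat \<Rightarrow> complex mat \<Rightarrow> bool" where
  "spreads_into q U \<longleftrightarrow> (\<forall>T A. T \<subseteq> parts C \<longrightarrow> acts T A \<longrightarrow>
     (\<exists>T'\<subseteq>parts C. T \<subseteq> T' \<and> card T' \<le> q * card T \<and> acts T' (U * A * mat_adjoint U)))"

text \<open>Including the adjoint makes the notion usable for commutators, in which both
  \<open>U\<close> and \<open>mat_adjoint U\<close> occur.\<close>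

definition spreads :: "nat \<Rightarrow> complex mat \<Rightarrow> bool" where
  "spreads q U \<longleftrightarrow> unitary_mat d U \<and> spreads_into q U \<and> spreads_into q (mat_adjoint U)"

lemma spreads_into_mult:
  assumes "U \<in> carrier_mat d d" "V \<in> carrier_mat d d" "spreads_into q U" "spreads_into r V"
  shows "spreads_into (q * r) (U * V)"
  unfolding spreads_into_def
proof (intro allI impI)
  fix T A assume T: "T \<subseteq> parts C" and A: "acts T A"
  obtain T1 where T1: "T1 \<subseteq> parts C" "T \<subseteq> T1" "card T1 \<le> r * card T" "acts T1 (V * A * mat_adjoint V)"
    using assms(4)[unfolded spreads_into_def, rule_format, OF T A] by blast
  obtain T2 where T2: "T2 \<subseteq> parts C" "T1 \<subseteq> T2" "card T2 \<le> q * card T1"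
    "acts T2 (U * (V * A * mat_adjoint V) * mat_adjoint U)"
    using assms(3)[unfolded spreads_into_def, rule_format, OF T1(1,4)] by blast
  have "card T2 \<le> q * (r * card T)" using T2(3) T1(3) by (meson le_trans mult_le_mono2)
  then show "\<exists>T'\<subseteq>parts C. T \<subseteq> T' \<and> card T' \<le> q * r * card T \<and> acts T' (U * V * A * mat_adjoint (U * V))"
    using T1 T2 unfolding conj_mult[OF assms(1,2) acts_only_onD(1)[OF A]]
    by (intro exI[of _ T2]) (auto simp: mult.assoc)
qed

lemma spreads_mult:
  assumes "spreads q U" "spreads r V"
  shows "spreads (q * r) (U * V)"
proof -
  have c: "U \<in> carrier_mat d d" "V \<in> carrier_mat d d"
    using assms by (auto simp: spreads_def unitary_mat_def)
  have "spreads_into (r * q) (mat_adjoint (U * V))"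
    unfolding mat_adjoint_mult[OF c]
    using assms by (intro spreads_into_mult mat_adjoint_carrier c) (simp_all add: spreads_def)
  moreover have "spreads_into (q * r) (U * V)"
    using assms by (intro spreads_into_mult c) (simp_all add: spreads_def)
  ultimately show ?thesis
    using assms unitary_mat_mult unfolding spreads_def mult.commute[of r] by blast
qed

lemma spreads_adjoint: "spreads q U \<Longrightarrow> spreads q (mat_adjoint U)"
  unfolding spreads_def by (auto intro: unitary_mat_adjoint)

text \<open>The factor of \<open>g\<close> off \<open>T\<close> commutes with the conjugated
  operator and drops out, and the factor on \<open>T\<close> does not leave
  \<open>T\<close>.\<close>

lemma is_pauli_spreads:
  assumes g: "is_pauli m n g"
  shows "spreads 1 g"
proof -
  have "spreads_into 1 g" if g: "is_pauli m n g" for g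
    unfolding spreads_into_def
  proof (intro allI impI)
    fix T A assume T: "T \<subseteq> parts C" and A: "acts T A"
    obtain g1 g2 where g12: "is_pauli m n g1" "is_pauli m n g2" "g = g1 * g2"
      "acts (T \<inter> supp m C g) g1" "acts_only_on m n (- \<Union>T) g2"
      using pauli_split[OF g T] .
    note u = is_pauli_unitary[OF m_pos g12(1)] is_pauli_unitary[OF m_pos g12(2)]
    have g1T: "acts T g1" using acts_only_on_mono[OF m_pos g12(4)] by blast
    have "acts T (g2 * A * mat_adjoint g2)"
      using A by (intro conj_block[OF m_pos u(2) g12(5)]) auto
    then have "acts T (g * A * mat_adjoint g)"
      unfolding g12(3) conj_mult[OF unitary_matD(1)[OF u(1)] unitary_matD(1)[OF u(2)] acts_only_onD(1)[OF A]]
      by (rule acts_only_on_mult[OF m_pos acts_only_on_mult[OF m_pos g1T] acts_only_on_adjoint[OF g1T]])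
    then show "\<exists>T'\<subseteq>parts C. T \<subseteq> T' \<and> card T' \<le> 1 * card T \<and> acts T' (g * A * mat_adjoint g)"
      using T by auto
  qed
  then show ?thesis
    unfolding spreads_def using g is_pauli_adjoint[OF m_pos g] is_pauli_unitary[OF m_pos g] by blast
qed

lemma is_pauli_one: "is_pauli m n (1\<^sub>m d)"
  using is_pauli_weyl[of m n "\<lambda>_. 0" "\<lambda>_. 0"] by (simp add: weyl_zero[OF m_pos] vanishes_on_def)

text \<open>Completing \<open>T\<close> to a union of blocks costs at most \<open>q\<close> parts
  for each part of \<open>T\<close>, and conjugation by a product of block operators cannot leave
  such a union.\<close>

lemma local_depth_one_spreads:
  assumes "local_depth_one m C q U"
  shows "spreads q U"
proof -
  obtain R where R: "partition_on {..<n} R" "\<forall>B\<in>R. \<exists>T\<subseteq>parts C. card T \<le> q \<and> B = \<Union>T"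
    "transversal m n R U" using assms unfolding local_depth_one_def by blast
  obtain Bs F where F: "set Bs = R" "\<forall>B\<in>R. unitary_mat d (F B) \<and> acts_only_on m n B (F B)"
    "U = mat_prod_list d (map F Bs)" using R(3) unfolding transversal_def by blast
  have "\<exists>D. D \<subseteq> parts C \<and> card D \<le> q \<and> \<Union>D \<in> R \<and> p \<in> D" if p: "p \<in> parts C" for p
  proof -
    obtain j where j: "j \<in> p" using partition_onD3[OF parts_partition] p by (metis ex_in_conv)
    then have "j \<in> {..<n}" using p Union_parts by blast
    then obtain B where B: "B \<in> R" "j \<in> B" using partition_onD1[OF R(1)] by blast
    obtain D where D: "D \<subseteq> parts C" "card D \<le> q" "B = \<Union>D" using R(2) B(1) by blast
    then obtain p' where "p' \<in> D" "j \<in> p'" using B(2) by blast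
    then have "p \<in> D" using parts_eqI[OF p _ j] D(1) by blast
    then show ?thesis using B(1) D by blast
  qed
  then obtain D where D: "\<And>p. p \<in> parts C \<Longrightarrow> D p \<subseteq> parts C \<and> card (D p) \<le> q \<and> \<Union>(D p) \<in> R \<and> p \<in> D p"
    by metis
  \<comment> \<open>\<open>D p\<close> is the set of parts making up the block that contains
    \<open>p\<close>; the union of these sets over \<open>T\<close> is the completion.\<close>
  have grow: "\<exists>T'\<subseteq>parts C. T \<subseteq> T' \<and> card T' \<le> q * card T \<and> (\<forall>B\<in>R. B \<subseteq> \<Union>T' \<or> B \<inter> \<Union>T' = {})"
    if T: "T \<subseteq> parts C" for T
  proof (intro exI conjI)
    have fT: "finite T" using T finite_parts finite_subset by blast
    show "\<Union>(D ` T) \<subseteq> parts C" "T \<subseteq> \<Union>(D ` T)" using D T by blast+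
    have "card (\<Union>(D ` T)) \<le> (\<Sum>p\<in>T. card (D p))" by (rule card_UN_le[OF fT])
    also have "\<dots> \<le> (\<Sum>p\<in>T. q)" using D T by (intro sum_mono) auto
    finally show "card (\<Union>(D ` T)) \<le> q * card T" by (simp add: mult.commute)
    show "\<forall>B\<in>R. B \<subseteq> \<Union>(\<Union>(D ` T)) \<or> B \<inter> \<Union>(\<Union>(D ` T)) = {}"
    proof
      fix B assume B: "B \<in> R"
      show "B \<subseteq> \<Union>(\<Union>(D ` T)) \<or> B \<inter> \<Union>(\<Union>(D ` T)) = {}"
      proof (cases "\<exists>p\<in>T. B = \<Union>(D p)")
        case False
        have "B \<inter> \<Union>(D p) = {}" if "p \<in> T" for p
        proof (rule disjointD[OF partition_onD2[OF R(1)] B])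
          show "\<Union>(D p) \<in> R" using D T that by blast
          show "B \<noteq> \<Union>(D p)" using False that by blast
        qed
        then show ?thesis by blast
      qed blast
    qed
  qed
  have block: "\<forall>B\<in>set Bs. unitary_mat d (F B) \<and> acts_only_on m n B (F B) \<and> (B \<subseteq> \<Union>T' \<or> B \<inter> \<Union>T' = {})"
    if "\<forall>B\<in>R. B \<subseteq> \<Union>T' \<or> B \<inter> \<Union>T' = {}" for T'
    using F(2) that unfolding F(1) by blast
  have sp: "\<exists>T'\<subseteq>parts C. T \<subseteq> T' \<and> card T' \<le> q * card T \<and>
      acts T' (U * A * mat_adjoint U) \<and> acts T' (mat_adjoint U * A * U)"
    if T: "T \<subseteq> parts C" and A: "acts T A" for T A
  proof -
    obtain T' where T': "T' \<subseteq> parts C" "T \<subseteq> T'" "card T' \<le> q * card T"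
      "\<forall>B\<in>R. B \<subseteq> \<Union>T' \<or> B \<inter> \<Union>T' = {}"
      using grow[OF T] by (elim exE conjE) (rule that)
    have "acts T' A" using T'(2) by (intro acts_only_on_mono[OF m_pos A]) blast
    then have "acts T' (U * A * mat_adjoint U)" "acts T' (mat_adjoint U * A * U)"
      unfolding F(3) by (rule conj_blocks(2,3)[OF m_pos block[OF T'(4)]])+
    then show ?thesis using T'(1-3) by (intro exI[of _ T'] conjI)
  qed
  \<comment> \<open>Unitarity does not depend on the region, so the empty one serves.\<close>
  have "unitary_mat d U" using conj_blocks(1)[OF m_pos block[of "{}"]] unfolding F(3) by simp
  then show ?thesis using sp unfolding spreads_def spreads_into_def mat_adjoint_adjoint by meson
qed

lemma local_circuit_spreads:
  assumes "local_circuit m C q h U"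
  shows "spreads (q ^ h) U"
proof -
  obtain Us where Us: "length Us = h" "\<forall>W\<in>set Us. local_depth_one m C q W" "U = mat_prod_list d Us"
    using assms unfolding local_circuit_def by blast
  have "spreads (q ^ length Us) (mat_prod_list d Us)"
    using Us(2)
  proof (induction Us)
    case Nil
    \<comment> \<open>The empty circuit is the identity, a Pauli, matching
      \<open>q ^ 0 = 1\<close>.\<close>
    then show ?case using is_pauli_spreads[OF is_pauli_one] by simp
  next
    case (Cons W Us)
    then show ?case using spreads_mult[OF local_depth_one_spreads, of q W] by simp
  qed
  then show ?thesis using Us by simp
qed

text \<open>The part of \<open>g\<close> outside \<open>T\<close> commutes with \<open>W\<close>, so only the overlap of the supports matters.\<close>

lemma commutator_support:
  assumes W: "spreads s W" "acts T W" and T: "T \<subseteq> parts C" and g: "is_pauli m n g"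
  shows "\<exists>T'\<subseteq>parts C. card T' \<le> s * card (T \<inter> supp m C g) \<and> acts T' (commutator W g)"
proof -
  obtain g1 g2 where g12: "is_pauli m n g1" "is_pauli m n g2" "g = g1 * g2"
    "acts (T \<inter> supp m C g) g1" "acts_only_on m n (- \<Union>T) g2"
    using pauli_split[OF g T] .
  have Wu: "unitary_mat d W" using W(1) by (simp add: spreads_def)
  note c = unitary_matD(1)[OF is_pauli_unitary[OF m_pos g12(1)]] unitary_matD(1)[OF is_pauli_unitary[OF m_pos g12(2)]]
    unitary_matD(1)[OF Wu]
  note a = mat_adjoint_carrier[OF c(1)] mat_adjoint_carrier[OF c(2)] mat_adjoint_carrier[OF c(3)]
  have comm: "g2 * mat_adjoint W = mat_adjoint W * g2"
    by (rule acts_only_on_disjoint_commute[OF m_pos g12(5) acts_only_on_adjoint[OF W(2)]]) auto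
  have "commutator W g = W * g1 * (g2 * mat_adjoint W * mat_adjoint g2) * mat_adjoint g1"
  proof -
    have Wg1: "W * g1 \<in> carrier_mat d d" using c by simp
    have "commutator W g = W * (g1 * g2) * mat_adjoint W * (mat_adjoint g2 * mat_adjoint g1)"
      unfolding commutator_def g12(3) mat_adjoint_mult[OF c(1,2)] ..
    also have "W * (g1 * g2) * mat_adjoint W = W * g1 * (g2 * mat_adjoint W)"
      unfolding assoc_mult_mat[OF c(3,1,2), symmetric] by (rule assoc_mult_mat[OF Wg1 c(2) a(3)])
    also have "W * g1 * (g2 * mat_adjoint W) * (mat_adjoint g2 * mat_adjoint g1) =
        W * g1 * (g2 * mat_adjoint W) * mat_adjoint g2 * mat_adjoint g1"
      by (rule assoc_mult_mat[OF mult_carrier_mat[OF Wg1 mult_carrier_mat[OF c(2) a(3)]] a(2,1), symmetric])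
    also have "W * g1 * (g2 * mat_adjoint W) * mat_adjoint g2 = W * g1 * (g2 * mat_adjoint W * mat_adjoint g2)"
      by (rule assoc_mult_mat[OF Wg1 mult_carrier_mat[OF c(2) a(3)] a(2)])
    finally show ?thesis .
  qed
  also have "g2 * mat_adjoint W * mat_adjoint g2 = mat_adjoint W"
    by (rule conj_commuting[OF is_pauli_unitary[OF m_pos g12(2)] a(3) comm])
  \<comment> \<open>Now \<open>g1\<close> is conjugated by \<open>W\<close>, which spreading
    controls, and multiplied by \<open>mat_adjoint g1\<close>, which stays inside the enlarged
    set.\<close>
  finally have eq: "commutator W g = W * g1 * mat_adjoint W * mat_adjoint g1" .
  have "T \<inter> supp m C g \<subseteq> parts C" using T by blast
  moreover have "spreads_into s W" using W(1) by (simp add: spreads_def)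
  ultimately obtain T' where T': "T' \<subseteq> parts C" "T \<inter> supp m C g \<subseteq> T'" "card T' \<le> s * card (T \<inter> supp m C g)"
    "acts T' (W * g1 * mat_adjoint W)"
    using g12(4) unfolding spreads_into_def by meson
  have "acts T' g1" using T'(2) by (intro acts_only_on_mono[OF m_pos g12(4)]) blast
  then have "acts T' (commutator W g)"
    unfolding eq by (intro acts_only_on_mult[OF m_pos T'(4)] acts_only_on_adjoint)
  then show ?thesis using T'(1,3) by blast
qed

text \<open>\<open>W\<close> and its adjoint contribute a factor \<open>s\<close> each and the
  Paulis contribute 1.\<close>

lemma commutator_spreads:
  assumes "spreads s W" "is_pauli m n g"
  shows "spreads (s * s) (commutator W g)"
proof -
  note g = is_pauli_spreads[OF assms(2)]
  show ?thesis
    using spreads_mult[OF spreads_mult[OF spreads_mult[OF assms(1) g] spreads_adjoint[OF assms(1)]] spreads_adjoint[OF g]]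
    unfolding commutator_def by simp
qed

end

section \<open>The Clifford hierarchy\<close>

text \<open>Level 0 consists of the scalars, so that the descent can start below the Paulis.\<close>

definition clifford_level :: "nat \<Rightarrow> nat \<Rightarrow> nat \<Rightarrow> complex mat set" where
  "clifford_level m k j =
     (if j = 0 then {c \<cdot>\<^sub>m 1\<^sub>m (m ^ k) | c. cmod c = 1} else clifford_hierarchy m k j)"

text \<open>Only \<open>j = 0\<close> has content: scalar commutators mean commutation up to
  scalars, which by completeness of the Weyl operators makes \<open>V\<close> a Pauli up to phase.
  From there on the claim is the recursive definition.\<close>

lemma clifford_hierarchy_Suc:
  assumes m: "m > 0" and V: "unitary_mat (m ^ k) V"
    and comm: "\<And>p. p \<in> pauli_group m k \<Longrightarrow> commutator V p \<in> clifford_level m k j"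
  shows "V \<in> clifford_hierarchy m k (Suc j)"
proof (cases j)
  case 0
  have "\<exists>c. V * weyl m k a b = c \<cdot>\<^sub>m (weyl m k a b * V)" for a b
  proof -
    let ?w = "weyl m k a b"
    obtain x where x: "cmod x = 1" "x \<cdot>\<^sub>m ?w \<in> pauli_group m k" using weyl_in_pauli_group[OF m] by blast
    define p where "p = x \<cdot>\<^sub>m ?w"
    have p: "unitary_mat (m ^ k) p" unfolding p_def by (rule unitary_mat_smult[OF weyl_unitary[OF m] x(1)])
    note c = unitary_matD(1)[OF V] unitary_matD(1)[OF p] and a = mat_adjoint_carrier[OF unitary_matD(1)[OF V]]
      mat_adjoint_carrier[OF unitary_matD(1)[OF p]]
    obtain y where y: "commutator V p = y \<cdot>\<^sub>m 1\<^sub>m (m ^ k)"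
      using comm[of p] x(2) 0 by (auto simp: clifford_level_def p_def)
    have Vp: "V * p \<in> carrier_mat (m ^ k) (m ^ k)" and pV: "p * V \<in> carrier_mat (m ^ k) (m ^ k)" using c by simp_all
    \<comment> \<open>Multiplying on the right by \<open>p * V\<close> undoes the second half of the
      commutator and leaves commutation up to \<open>y\<close>.\<close>
    have "commutator V p = V * p * mat_adjoint (p * V)"
      unfolding commutator_def mat_adjoint_mult[OF c(2,1)] by (rule assoc_mult_mat[OF Vp a])
    then have "V * p * mat_adjoint (p * V) * (p * V) = y \<cdot>\<^sub>m (p * V)"
      unfolding y[symmetric] using y smult_mult_mat(1)[OF one_carrier_mat pV, of y] left_mult_one_mat[OF pV] by simp
    moreover have "V * p * mat_adjoint (p * V) * (p * V) = V * p"
      unfolding assoc_mult_mat[OF Vp mat_adjoint_carrier[OF pV] pV]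
        unitary_matD(2)[OF unitary_mat_mult[OF p V]] by (rule right_mult_one_mat[OF Vp])
    ultimately have "V * p = y \<cdot>\<^sub>m (p * V)" by simp
    then have "x \<cdot>\<^sub>m (V * ?w) = x \<cdot>\<^sub>m (y \<cdot>\<^sub>m (?w * V))"
      unfolding p_def smult_mult_mat(2)[OF c(1) weyl_carrier] smult_mult_mat(1)[OF weyl_carrier c(1)] smult_smult_mat
      by (simp add: mult.commute)
    moreover have "x \<noteq> 0" using x(1) by auto
    ultimately show ?thesis using smult_mat_cancel by blast
  qed
  then have "is_pauli m k V" by (rule is_pauli_if_commutes_up_to_scalar[OF m V])
  then show ?thesis using clifford_hierarchy_one[OF m] 0 by simp
next
  case (Suc i)
  then show ?thesis using V comm by (simp add: clifford_level_def)
qed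

text \<open>Each commutator costs the current factor \<open>s\<close>, after which
  \<open>s * s\<close> takes its place. In closed form this is
  \<open>s ^ (2 ^ j - 1)\<close>.\<close>

fun spread_factor :: "nat \<Rightarrow> nat \<Rightarrow> nat" where
  "spread_factor 0 s = 1"
| "spread_factor (Suc j) s = s * spread_factor j (s * s)"

lemma spread_factor_pos: "s > 0 \<Longrightarrow> spread_factor j s > 0"
  by (induction j arbitrary: s) auto

section \<open>Descent through nested commutators\<close>

context encoded_code
begin

lemma supp_one: "supp m C (1\<^sub>m d) = {}"
  using supp_subset vanishes_on_part_iff[of _ 1 "\<lambda>_. 0" "\<lambda>_. 0"]
  by (auto simp: weyl_zero[OF m_pos] vanishes_on_def)

text \<open>\<open>P\<close> stands for low weight or small overlap. A scalar \<open>p\<close>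
  corresponds to no non-trivial coset and is represented by the identity, which therefore has to
  satisfy \<open>P\<close> as well.\<close>

lemma pauli_representative:
  assumes p: "p \<in> pauli_group m k" and P: "P (1\<^sub>m d)"
    "\<And>G. G \<in> nontrivial_logical_paulis m C \<Longrightarrow> \<exists>g\<in>G. P g"
  shows "\<exists>g. is_pauli m n g \<and> induces g p \<and> P g"
proof (cases "\<exists>c. p = c \<cdot>\<^sub>m 1\<^sub>m e")
  case True
  then obtain c where c: "p = c \<cdot>\<^sub>m 1\<^sub>m e" by blast
  have "unitary_mat e p" using pauli_group_is_pauli[OF m_pos p] is_pauli_unitary[OF m_pos] by blast
  then have "cmod c = 1" unfolding c by (rule unitary_scalar_norm) (use m_pos in simp)
  then have "induces (1\<^sub>m d) p" unfolding c by (rule induces_smult[OF induces_one])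
  then show ?thesis using is_pauli_one P(1) by blast
next
  case False
  obtain G where G: "G \<in> nontrivial_logical_paulis m C" "\<forall>g\<in>G. is_pauli m n g \<and> induces g p"
    using coset_of_pauli[OF pauli_group_is_pauli[OF m_pos p] False] by blast
  obtain g where "g \<in> G" "P g" using P(2)[OF G(1)] by blast
  then show ?thesis using G(2) by blast
qed

text \<open>The inequality is built to reproduce itself: passing to a commutator multiplies the
  support by at most \<open>s\<close> over the disjointness, which uses up one power of the latter,
  and turns \<open>s\<close> into \<open>s * s\<close> as in \<open>spread_factor\<close>.\<close>

lemma level_if_small_support:
  assumes "induces W V" "spreads s W" "T \<subseteq> parts C" "acts T W"
    and "real (card T) * real (spread_factor j s) < real (min_distance m C) * disjointness m C ^ j"
  shows "V \<in> clifford_level m k j"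
  using assms
proof (induction j arbitrary: W V s T)
  case 0
  \<comment> \<open>Both the spreading factor and the power of the disjointness are 1 here, so the
    cleaning lemma applies.\<close>
  then have "card T < min_distance m C" by simp
  then show ?case using cleaning[OF 0(1,3,4)] by (auto simp: clifford_level_def)
next
  case (Suc j)
  note \<Delta> = disjointness_ge_1
  have "commutator V p \<in> clifford_level m k j" if p: "p \<in> pauli_group m k" for p
  proof -
    have "\<exists>g. is_pauli m n g \<and> induces g p \<and>
      real (card (T \<inter> supp m C g)) * disjointness m C \<le> card T"
      by (rule pauli_representative[OF p _ ex_small_overlap[OF _ Suc.prems(3)]]) (simp add: supp_one)
    then obtain g where g: "is_pauli m n g" "induces g p"
      "real (card (T \<inter> supp m C g)) * disjointness m C \<le> card T" by blast
    obtain T' where T': "T' \<subseteq> parts C" "card T' \<le> s * card (T \<inter> supp m C g)" "acts T' (commutator W g)"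
      using commutator_support[OF Suc.prems(2,4,3) g(1)] by blast
    show ?thesis
    proof (rule Suc.IH[OF _ _ T'(1,3)])
      show "induces (commutator W g) (commutator V p)"
        by (rule induces_commutator[OF Suc.prems(1) g(2)])
      show "spreads (s * s) (commutator W g)" by (rule commutator_spreads[OF Suc.prems(2) g(1)])
      let ?K = "real (spread_factor j (s * s))"
      have "real (card T') * disjointness m C \<le> real s * real (card (T \<inter> supp m C g)) * disjointness m C"
        using T'(2) \<Delta> by (intro mult_right_mono) (simp_all flip: of_nat_mult)
      also have "\<dots> \<le> real s * real (card T)"
        unfolding mult.assoc using g(3) by (intro mult_left_mono) auto
      finally have "real (card T') * disjointness m C * ?K \<le> real s * real (card T) * ?K"
        by (intro mult_right_mono) auto
      also have "\<dots> < real (min_distance m C) * disjointness m C ^ Suc j"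
        using Suc.prems(5) by (simp add: mult_ac)
      \<comment> \<open>Arranged with a common positive factor that can be cancelled.\<close>
      finally have "disjointness m C * (real (card T') * ?K) <
          disjointness m C * (real (min_distance m C) * disjointness m C ^ j)" by (simp add: mult_ac)
      then show "real (card T') * ?K < real (min_distance m C) * disjointness m C ^ j"
        using \<Delta> by (subst (asm) mult_less_cancel_left_pos) auto
    qed
  qed
  then have "V \<in> clifford_hierarchy m k (Suc j)"
    by (rule clifford_hierarchy_Suc[OF m_pos inducesD(2)[OF Suc.prems(1)]])
  then show ?case by (simp add: clifford_level_def)
qed

text \<open>The first commutator is treated apart: nothing bounds the support of \<open>U\<close>,
  so the lightest representative has to do, without a gain from disjointness. Hence
  \<open>Suc j\<close> commutators against the power \<open>j\<close>.\<close>

lemma level_if_spreads: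
  assumes "induces U V" "spreads s U"
    and "real (max_distance m C) * real (spread_factor (Suc j) s) < real (min_distance m C) * disjointness m C ^ j"
  shows "V \<in> clifford_hierarchy m k (Suc j)"
proof (rule clifford_hierarchy_Suc[OF m_pos inducesD(2)[OF assms(1)]])
  fix p assume p: "p \<in> pauli_group m k"
  have "\<exists>g. is_pauli m n g \<and> induces g p \<and> card (supp m C g) \<le> max_distance m C"
    by (rule pauli_representative[OF p _ max_distance_ge]) (simp add: supp_one)
  then obtain g where g: "is_pauli m n g" "induces g p" "card (supp m C g) \<le> max_distance m C" by blast
  \<comment> \<open>With all parts as the region, the overlap in \<open>commutator_support\<close>
    is the full support of \<open>g\<close>.\<close>
  have "acts (parts C) U"
  proof (rule acts_only_onI_commute[OF m_pos inducesD(3)[OF assms(1)]])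
    fix a b :: "nat \<Rightarrow> nat" assume "\<forall>j\<in>\<Union>(parts C). a j = 0 \<and> b j = 0"
    then have "weyl m n a b = 1\<^sub>m d" by (intro weyl_zero m_pos) (auto simp: vanishes_on_def Union_parts)
    then show "U * weyl m n a b = weyl m n a b * U"
      using left_mult_one_mat[OF inducesD(3)[OF assms(1)]] right_mult_one_mat[OF inducesD(3)[OF assms(1)]] by simp
  qed
  then obtain T where T: "T \<subseteq> parts C" "card T \<le> s * card (parts C \<inter> supp m C g)" "acts T (commutator U g)"
    using commutator_support[OF assms(2) _ order_refl g(1)] by blast
  have "card T \<le> s * max_distance m C"
    using T(2) g(3) supp_subset by (metis Int_absorb1 le_trans mult_le_mono2)
  then have "card T * spread_factor j (s * s) \<le> s * max_distance m C * spread_factor j (s * s)"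
    by (rule mult_le_mono1)
  also have "\<dots> = max_distance m C * spread_factor (Suc j) s" by (simp add: mult_ac)
  finally have "card T * spread_factor j (s * s) \<le> max_distance m C * spread_factor (Suc j) s" .
  then have "real (card T) * real (spread_factor j (s * s)) \<le> real (max_distance m C) * real (spread_factor (Suc j) s)"
    by (simp only: of_nat_mult[symmetric] of_nat_le_iff)
  also note assms(3)
  finally show "commutator V p \<in> clifford_level m k j"
    by (rule level_if_small_support[OF induces_commutator[OF assms(1) g(2)] commutator_spreads[OF assms(2) g(1)] T(1,3)])
qed

end

section \<open>The limit along the code family\<close>

theorem corollary10:
  fixes m M :: nat and C :: "nat \<Rightarrow> qudit_code"
  assumes "m \<ge> 2"
    and "\<And>l. l \<ge> 1 \<Longrightarrow> stabilizer_code m (C l)"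
    and "M \<ge> 1"
    and "(\<lambda>l. real (max_distance m (C l)) /
              (real (min_distance m (C l)) * disjointness m (C l) ^ (M - 1))) \<longlonglongrightarrow> 0"
  shows "\<forall>q h V. q \<ge> 1 \<longrightarrow> h \<ge> 1 \<longrightarrow>
           (\<forall>l\<ge>1. unitary_mat (m ^ num_logical (C l)) (V l)) \<longrightarrow>
           has_local_gate m C q h V \<longrightarrow> gate_in_level m C M V"
proof (intro allI impI)
  fix q h V
  assume q: "(1 :: nat) \<le> q" and V: "\<forall>l\<ge>1. unitary_mat (m ^ num_logical (C l)) (V l)"
    and gate: "has_local_gate m C q h V"
  obtain j where M: "M = Suc j" using assms(3) by (cases M) auto
  \<comment> \<open>Independent of \<open>l\<close>, so the ratio, which tends to 0, is eventually
    below the inverse of \<open>K\<close>.\<close>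
  define K where "K = real (spread_factor (Suc j) (q ^ h))"
  have K: "K > 0" unfolding K_def using spread_factor_pos[of "q ^ h" "Suc j"] q by simp
  let ?r = "\<lambda>l. real (max_distance m (C l)) / (real (min_distance m (C l)) * disjointness m (C l) ^ (M - 1))"
  obtain l0 where l0: "\<forall>l\<ge>l0. \<exists>U. local_circuit m (C l) q h U \<and> implements m (C l) U (V l)"
    using gate unfolding has_local_gate_def by blast
  have "\<forall>\<^sub>F l in sequentially. ?r l < inverse K"
    using order_tendstoD(2)[OF assms(4), of "inverse K"] K by simp
  then obtain l2 where l2: "\<forall>l\<ge>l2. ?r l < inverse K" unfolding eventually_sequentially by blast
  have "V l \<in> clifford_hierarchy m (num_logical (C l)) M" if l: "l \<ge> max 1 (max l0 l2)" for l
  proof -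
    obtain U where U: "local_circuit m (C l) q h U" "implements m (C l) U (V l)" using l0 l by auto
    obtain E c where E: "encoding m (C l) E" "cmod c = 1" "U * E = c \<cdot>\<^sub>m (E * V l)"
      and Uu: "logical_operator m (C l) U" using U(2) unfolding implements_def by blast
    interpret encoded_code m "C l" E
      by unfold_locales (use assms(1,2) l E(1) in auto)
    have "induces U (V l)"
      unfolding induces_def using Uu V l E(2,3) by (auto simp: logical_operator_def)
    moreover have "spreads (q ^ h) U" by (rule local_circuit_spreads[OF U(1)])
    moreover have "real (max_distance m (C l)) * K < real (min_distance m (C l)) * disjointness m (C l) ^ j"
    proof -
      \<comment> \<open>With denominator 0 the quotient would be 0 by convention and carry no
        information; positivity turns its bound into the inequality that the descent needs.\<close>
      have "real (min_distance m (C l)) * disjointness m (C l) ^ j > 0"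
        using min_distance_pos disjointness_ge_1 by (intro mult_pos_pos zero_less_power) auto
      moreover have "?r l < inverse K" using l2 l by auto
      ultimately show ?thesis using K by (simp add: M field_simps)
    qed
    ultimately show ?thesis unfolding M K_def by (rule level_if_spreads)
  qed
  then show "gate_in_level m C M V" unfolding gate_in_level_def by blast
qed

end
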